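(* Every $\mathsf{RQCD}$ space is irreducible. That is: let $(X,d,m)$ be an infinitesimally Hilbertian geodesic Monge space satisfying $\mathsf{QCD}(Q,K,N)$ for some $Q\ge1$, $K\in\mathbb R$, $N\in(1,\infty)$, and let $(P_t)_{t\ge0}$ be its heat semigroup. If $A\subset X$ is $m$-measurable and invariant, i.e. $\mathbf 1_AP_tf=P_t(\mathbf 1_Af)$ $m$-a.e. for every $f\in L^\infty(m)$ and every $t>0$, then $m(A)=0$ or $m(X\setminus A)=0$.
   Context: A metric measure space $(X,d,m)$ is a complete separable metric space $(X,d)$ with an atomless Borel measure $m$ which is finite on bounded sets and has full topological support. It is geodesic if any two points are joined by a constant-speed geodesic. $\mathscr P_2(X)$ is the set of Borel probability measures with finite second moment, with the $L^2$-Wasserstein distance $W_2$; $\mathscr P^m_c(X)$ is the set of compactly supported Borel probability measures absolutely continuous w.r.t. $m$. Let $I=[0,1]$, let $\mathrm{Geo}(X,d)$ be the set of constant-speed geodesics $\gamma:I\to X$, i.e. $d(\gamma_s,\gamma_t)=|s-t|\,d(\gamma_0,\gamma_1)$, and let $\mathrm{ev}_t(\gamma)=\gamma_t$. $\mathrm{OptGeo}(\mu_0,\mu_1)$ is the set of Borel probability measures $\pi$ on $\mathcal C(I;X)$ concentrated on $\mathrm{Geo}(X,d)$ with $(\mathrm{ev}_i)_\sharp\pi=\mu_i$, $i=0,1$, and $W_2(\mu_0,\mu_1)^2=\int\int_I|\dot\gamma|_t^2\,dt\,d\pi(\gamma)$. Monge space: for every $\mu_0,\mu_1\in\mathscr P_2(X)$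 with $\mu_0\ll m$: (a) there is a unique $\pi\in\mathrm{OptGeo}(\mu_0,\mu_1)$; (b) $\pi=T_\sharp\mu_0$ for some map $T:X\to\mathrm{Geo}(X,d)$; (c) $\mu_t:=(\mathrm{ev}_t)_\sharp\pi\ll m$ for all $t\in[0,1)$. Write $\rho_t=d\mu_t/dm$. Distortion coefficients: for $K\in\mathbb R$, $N\in(1,\infty)$, $t\in(0,1)$, $\theta\ge0$, put $\tau^{(t)}_{K,N}(\theta)=t^{1/N}\big(\sigma^{(t)}_{K,N-1}(\theta)\big)^{1-1/N}$, where, with $\kappa=K/(N-1)$, $\sigma^{(t)}_{K,N-1}(\theta)=\sin(t\theta\sqrt{\kappa})/\sin(\theta\sqrt{\kappa})$ if $K>0$ and $0<\theta<\pi/\sqrt\kappa$, $=+\infty$ if $K>0$ and $\theta\ge\pi/\sqrt\kappa$, $=t$ if $K=0$ or $\theta=0$, and $=\sinh(t\theta\sqrt{-\kappa})/\sinh(\theta\sqrt{-\kappa})$ if $K<0$ and $\theta>0$. A geodesic Monge space satisfies $\mathsf{QCD}(Q,K,N)$ if for every $\mu_0,\mu_1\in\mathscr P^m_c(X)$, with $\pi$ the unique element of $\mathrm{OptGeo}(\mu_0,\mu_1)$, $$\rho_t^{-1/N}(\gamma_t)\ge Q^{-1/N}\Big(\tau^{(1-t)}_{K,N}(d(\gamma_0,\gamma_1))\,\rho_0^{-1/N}(\gamma_0)+\tau^{(t)}_{K,N}(d(\gamma_0,\gamma_1))\,\rho_1^{-1/N}(\gamma_1)\Big)$$ for every $t\in(0,1)$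 and $\pi$-a.e. $\gamma$. Cheeger energy: for Lipschitz $f$ the slope is $|\mathrm Df|(x)=\limsup_{y\to x}|f(y)-f(x)|/d(x,y)$ ($0$ if $x$ is isolated). $\mathrm{Lip}_{bs}(d)$ is the space of Lipschitz functions with bounded support. $\mathsf{Ch}(f)=\inf\{\liminf_n\int_X|\mathrm Df_n|^2\,dm: f_n\in\mathrm{Lip}_{bs}(d),\ f_n\to f\text{ in }L^2(m)\}$ ($\inf\varnothing=+\infty$), and $W^{1,2}=\{f\in L^2(m):\mathsf{Ch}(f)<\infty\}$. The space is infinitesimally Hilbertian if $\mathsf{Ch}$ is a quadratic functional; then $\mathsf{Ch}$ defines by polarization a Dirichlet form on $L^2(m)$ with domain $W^{1,2}$. $(P_t)_{t\ge0}$ is the strongly continuous contraction semigroup on $L^2(m)$ associated with this Dirichlet form; the same symbol denotes its standard (sub-Markovian) extension to $L^\infty(m)$. *)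

theory Defs
  imports "HOL-Probability.Probability"
begin

section \<open>The space of continuous paths\<close>

text \<open>The interval \<open>[0,1]\<close> as a metric space, so that \<open>unit_interval \<Rightarrow>\<^sub>C 'a\<close>, with the
  supremum distance and the Borel sigma-algebra of the library, is the space of continuous paths;
  boundedness is automatic by the lemma below.\<close>

typedef unit_interval = "{0..1::real}"
  morphisms real_of_unit unit_of_real
  by auto

instantiation unit_interval :: metric_space
begin

definition dist_unit_interval :: "unit_interval \<Rightarrow> unit_interval \<Rightarrow> real"
  where "dist_unit_interval s t = dist (real_of_unit s) (real_of_unit t)"

definition uniformity_unit_interval :: "(unit_interval \<times> unit_interval) filter"
  where "uniformity_unit_interval = (INF e\<in>{0 <..}. principal {(s, t). dist s t < e})"

definition open_unit_interval :: "unit_interval set \<Rightarrow> bool"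
  where "open_unit_interval U = (\<forall>s\<in>U. \<forall>\<^sub>F (s', t) in uniformity. s' = s \<longrightarrow> t \<in> U)"

instance
proof
  fix s t u :: unit_interval
  show "dist s t = 0 \<longleftrightarrow> s = t"
    by (simp add: dist_unit_interval_def real_of_unit_inject)
  show "dist s t \<le> dist s u + dist t u"
    by (simp add: dist_unit_interval_def dist_triangle2)
qed (simp_all add: uniformity_unit_interval_def open_unit_interval_def)

end

lemma continuous_path_in_bcontfun:
  fixes f :: "unit_interval \<Rightarrow> 'a :: metric_space"
  assumes "continuous_on UNIV f"
  shows "f \<in> bcontfun"
proof -
  have "continuous_on {0..1} unit_of_real"
    unfolding continuous_on_iff
    by (auto simp: dist_unit_interval_def unit_of_real_inverse)
  moreover have "unit_of_real ` {0..1} = UNIV"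
    using type_definition.Abs_image[OF type_definition_unit_interval] .
  ultimately have "compact (UNIV :: unit_interval set)"
    using compact_continuous_image[of "{0..1::real}" unit_of_real] by simp
  then have "bounded (range f)"
    using assms by (intro compact_imp_bounded compact_continuous_image)
  then show ?thesis
    using assms by (simp add: bcontfun_def)
qed

type_synonym 'a path = "unit_interval \<Rightarrow>\<^sub>C 'a"

text \<open>The evaluation map; only used for \<open>t \<in> {0..1}\<close>.\<close>

definition ev :: "real \<Rightarrow> ('a :: metric_space) path \<Rightarrow> 'a"
  where "ev t \<gamma> = apply_bcontfun \<gamma> (unit_of_real t)"

definition Geo :: "('a :: metric_space) path set"
  where "Geo = {\<gamma>. \<forall>s\<in>{0..1}. \<forall>t\<in>{0..1}.
    dist (ev s \<gamma>) (ev t \<gamma>) = \<bar>s - t\<bar> * dist (ev 0 \<gamma>) (ev 1 \<gamma>)}"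

definition geodesic_space :: "('a :: metric_space) itself \<Rightarrow> bool"
  where "geodesic_space _ \<longleftrightarrow> (\<forall>x y :: 'a. \<exists>\<gamma>\<in>Geo. ev 0 \<gamma> = x \<and> ev 1 \<gamma> = y)"

definition metric_speed :: "('a :: metric_space) path \<Rightarrow> real \<Rightarrow> real"
  where "metric_speed \<gamma> t =
    Lim (at t within {0..1}) (\<lambda>s. dist (ev s \<gamma>) (ev t \<gamma>) / \<bar>s - t\<bar>)"


section \<open>Metric measure spaces\<close>

definition topological_support :: "('a :: topological_space) measure \<Rightarrow> 'a set"
  where "topological_support \<mu> = {x. \<forall>U. open U \<and> x \<in> U \<longrightarrow> emeasure \<mu> U > 0}"

definition atomless :: "'a measure \<Rightarrow> bool"
  where "atomless \<mu> \<longleftrightarrow> (\<forall>A\<in>sets \<mu>. emeasure \<mu> A > 0 \<longrightarrow>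
    (\<exists>B\<in>sets \<mu>. B \<subseteq> A \<and> 0 < emeasure \<mu> B \<and> emeasure \<mu> B < emeasure \<mu> A))"

text \<open>Completeness and separability of the space are part of the class \<open>polish_space\<close>, which
  fixes a complete metric.\<close>

definition metric_measure_space :: "('a :: polish_space) measure \<Rightarrow> bool"
  where "metric_measure_space m \<longleftrightarrow>
    sets m = sets borel \<and>
    atomless m \<and>
    (\<forall>B\<in>sets borel. bounded B \<longrightarrow> emeasure m B < \<infinity>) \<and>
    topological_support m = UNIV"


section \<open>Optimal transport and Monge spaces\<close>

definition borel_prob :: "('a :: topological_space) measure \<Rightarrow> bool"
  where "borel_prob \<mu> \<longleftrightarrow> sets \<mu> = sets borel \<and> prob_space \<mu>"

definition P2 :: "('a :: polish_space) measure set"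
  where "P2 = {\<mu>. borel_prob \<mu> \<and> (\<exists>x0. (\<integral>\<^sup>+x. ennreal ((dist x x0)\<^sup>2) \<partial>\<mu>) < \<infinity>)}"

definition Pcm :: "('a :: polish_space) measure \<Rightarrow> 'a measure set"
  where "Pcm m = {\<mu>. borel_prob \<mu> \<and> compact (topological_support \<mu>) \<and> absolutely_continuous m \<mu>}"

definition couplings :: "('a :: polish_space) measure \<Rightarrow> 'a measure \<Rightarrow> ('a \<times> 'a) measure set"
  where "couplings \<mu> \<nu> = {\<eta>. borel_prob \<eta> \<and> distr \<eta> borel fst = \<mu> \<and> distr \<eta> borel snd = \<nu>}"

text \<open>Powers with a positive exponent, with \<open>\<infinity>\<close> to the power \<open>a\<close> equal to \<open>\<infinity>\<close>.\<close>

definition ennreal_powr :: "ennreal \<Rightarrow> real \<Rightarrow> ennreal"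
  where "ennreal_powr x a = (if x = \<infinity> then \<infinity> else ennreal (enn2real x powr a))"

definition W2 :: "('a :: polish_space) measure \<Rightarrow> 'a measure \<Rightarrow> ennreal"
  where "W2 \<mu> \<nu> =
    ennreal_powr (INF \<eta>\<in>couplings \<mu> \<nu>. \<integral>\<^sup>+(x, y). ennreal ((dist x y)\<^sup>2) \<partial>\<eta>) (1 / 2)"

definition OptGeo :: "('a :: polish_space) measure \<Rightarrow> 'a measure \<Rightarrow> 'a path measure set"
  where "OptGeo \<mu>0 \<mu>1 = {\<pi>. borel_prob \<pi> \<and>
    (AE \<gamma> in \<pi>. \<gamma> \<in> Geo) \<and>
    distr \<pi> borel (ev 0) = \<mu>0 \<and> distr \<pi> borel (ev 1) = \<mu>1 \<and>
    (W2 \<mu>0 \<mu>1)\<^sup>2 =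
      (\<integral>\<^sup>+\<gamma>. (\<integral>\<^sup>+t\<in>{0..1}. ennreal ((metric_speed \<gamma> t)\<^sup>2) \<partial>lborel) \<partial>\<pi>)}"

definition Monge_space :: "('a :: polish_space) measure \<Rightarrow> bool"
  where "Monge_space m \<longleftrightarrow> (\<forall>\<mu>0\<in>P2. \<forall>\<mu>1\<in>P2. absolutely_continuous m \<mu>0 \<longrightarrow>
    (\<exists>!\<pi>. \<pi> \<in> OptGeo \<mu>0 \<mu>1) \<and>
    (\<forall>\<pi>\<in>OptGeo \<mu>0 \<mu>1.
      (\<exists>T\<in>borel_measurable \<mu>0. range T \<subseteq> Geo \<and> \<pi> = distr \<mu>0 borel T) \<and>
      (\<forall>t\<in>{0..<1}. absolutely_continuous m (distr \<pi> borel (ev t)))))"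


section \<open>The condition QCD\<close>

text \<open>The second argument \<open>n\<close> is the dimension parameter \<open>N - 1\<close>.\<close>

definition sigma_coeff :: "real \<Rightarrow> real \<Rightarrow> real \<Rightarrow> real \<Rightarrow> ennreal"
  where "sigma_coeff K n t \<theta> = (let \<kappa> = K / n in
    if K = 0 \<or> \<theta> = 0 then ennreal t
    else if K > 0 then
      (if \<theta> < pi / sqrt \<kappa> then ennreal (sin (t * \<theta> * sqrt \<kappa>) / sin (\<theta> * sqrt \<kappa>)) else \<infinity>)
    else ennreal (sinh (t * \<theta> * sqrt (- \<kappa>)) / sinh (\<theta> * sqrt (- \<kappa>))))"

definition tau_coeff :: "real \<Rightarrow> real \<Rightarrow> real \<Rightarrow> real \<Rightarrow> ennreal"
  where "tau_coeff K N t \<theta> =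
    ennreal (t powr (1 / N)) * ennreal_powr (sigma_coeff K (N - 1) t \<theta>) (1 - 1 / N)"

text \<open>The density \<open>d\<mu>/dm\<close>, as a real number: it is finite \<open>m\<close>-almost everywhere. In the
  condition below all densities are evaluated at points where they are almost surely positive and
  finite, so the value of \<open>powr\<close> at \<open>0\<close> plays no role.\<close>

definition dens :: "'a measure \<Rightarrow> 'a measure \<Rightarrow> 'a \<Rightarrow> real"
  where "dens m \<mu> x = enn2real (RN_deriv m \<mu> x)"

text \<open>To be used in geodesic Monge spaces, where \<open>OptGeo \<mu>0 \<mu>1\<close> below is a singleton.\<close>

definition QCD :: "('a :: polish_space) measure \<Rightarrow> real \<Rightarrow> real \<Rightarrow> real \<Rightarrow> bool"
  where "QCD m Q K N \<longleftrightarrow> (\<forall>\<mu>0\<in>Pcm m. \<forall>\<mu>1\<in>Pcm m. \<forall>\<pi>\<in>OptGeo \<mu>0 \<mu>1. \<forall>t\<in>{0<..<1}. AE \<gamma> in \<pi>.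
    ennreal (dens m (distr \<pi> borel (ev t)) (ev t \<gamma>) powr (- 1 / N)) \<ge>
      ennreal (Q powr (- 1 / N)) *
        (tau_coeff K N (1 - t) (dist (ev 0 \<gamma>) (ev 1 \<gamma>)) *
            ennreal (dens m \<mu>0 (ev 0 \<gamma>) powr (- 1 / N)) +
         tau_coeff K N t (dist (ev 0 \<gamma>) (ev 1 \<gamma>)) *
            ennreal (dens m \<mu>1 (ev 1 \<gamma>) powr (- 1 / N))))"


section \<open>Cheeger energy\<close>

text \<open>Elements of the Lebesgue spaces are represented by functions measurable with respect to the
  completion of \<open>m\<close>; equality of elements is equality almost everywhere.\<close>

definition L2 :: "'a measure \<Rightarrow> ('a \<Rightarrow> real) set"
  where "L2 m = {f \<in> borel_measurable (completion m). integrable (completion m) (\<lambda>x. (f x)\<^sup>2)}"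

definition Linf :: "'a measure \<Rightarrow> ('a \<Rightarrow> real) set"
  where "Linf m = {f \<in> borel_measurable (completion m). \<exists>C. AE x in m. \<bar>f x\<bar> \<le> C}"

definition L2_inner :: "'a measure \<Rightarrow> ('a \<Rightarrow> real) \<Rightarrow> ('a \<Rightarrow> real) \<Rightarrow> real"
  where "L2_inner m f g = (\<integral>x. f x * g x \<partial>completion m)"

definition L2_norm :: "'a measure \<Rightarrow> ('a \<Rightarrow> real) \<Rightarrow> real"
  where "L2_norm m f = sqrt (L2_inner m f f)"

text \<open>At an isolated point the filter \<open>at x\<close> is trivial and the slope is \<open>0\<close>.\<close>

definition slope :: "('a :: metric_space \<Rightarrow> real) \<Rightarrow> 'a \<Rightarrow> ennreal"
  where "slope f x = Limsup (at x) (\<lambda>y. ennreal (\<bar>f y - f x\<bar> / dist x y))"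

definition Lip_bs :: "('a :: metric_space \<Rightarrow> real) set"
  where "Lip_bs = {f. (\<exists>L. L-lipschitz_on UNIV f) \<and> bounded (closure {x. f x \<noteq> 0})}"

definition Ch :: "('a :: polish_space) measure \<Rightarrow> ('a \<Rightarrow> real) \<Rightarrow> ennreal"
  where "Ch m f = Inf {liminf (\<lambda>n. \<integral>\<^sup>+x. (slope (F n) x)\<^sup>2 \<partial>m) | F :: nat \<Rightarrow> 'a \<Rightarrow> real.
    (\<forall>n. F n \<in> Lip_bs) \<and> (\<lambda>n. L2_norm m (\<lambda>x. F n x - f x)) \<longlonglongrightarrow> 0}"

definition W12 :: "('a :: polish_space) measure \<Rightarrow> ('a \<Rightarrow> real) set"
  where "W12 m = {f \<in> L2 m. Ch m f < \<infinity>}"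

definition infinitesimally_Hilbertian :: "('a :: polish_space) measure \<Rightarrow> bool"
  where "infinitesimally_Hilbertian m \<longleftrightarrow> (\<forall>f\<in>L2 m. \<forall>g\<in>L2 m.
    Ch m (\<lambda>x. f x + g x) + Ch m (\<lambda>x. f x - g x) = 2 * Ch m f + 2 * Ch m g)"

definition Dirichlet_form :: "('a :: polish_space) measure \<Rightarrow> ('a \<Rightarrow> real) \<Rightarrow> ('a \<Rightarrow> real) \<Rightarrow> real"
  where "Dirichlet_form m f g =
    (enn2real (Ch m (\<lambda>x. f x + g x)) - enn2real (Ch m (\<lambda>x. f x - g x))) / 4"


section \<open>Heat semigroup\<close>

definition L2_contraction_semigroup ::
    "'a measure \<Rightarrow> (real \<Rightarrow> ('a \<Rightarrow> real) \<Rightarrow> 'a \<Rightarrow> real) \<Rightarrow> bool"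
  where "L2_contraction_semigroup m P \<longleftrightarrow>
    (\<forall>t\<ge>0. \<forall>f\<in>L2 m. P t f \<in> L2 m \<and> L2_norm m (P t f) \<le> L2_norm m f) \<and>
    (\<forall>t\<ge>0. \<forall>f\<in>L2 m. \<forall>g\<in>L2 m. \<forall>a b. AE x in m.
      P t (\<lambda>y. a * f y + b * g y) x = a * P t f x + b * P t g x) \<and>
    (\<forall>f\<in>L2 m. AE x in m. P 0 f x = f x) \<and>
    (\<forall>s\<ge>0. \<forall>t\<ge>0. \<forall>f\<in>L2 m. AE x in m. P (s + t) f x = P s (P t f) x) \<and>
    (\<forall>f\<in>L2 m. ((\<lambda>t. L2_norm m (\<lambda>x. P t f x - f x)) \<longlongrightarrow> 0) (at_right 0))"

text \<open>\<open>h = L f\<close> for the operator \<open>L\<close> with \<open>\<E>(f, g) = - \<langle>L f, g\<rangle>\<close> for all \<open>g\<close> in the form domain.\<close>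

definition form_generator ::
    "('a :: polish_space) measure \<Rightarrow> ('a \<Rightarrow> real) \<Rightarrow> ('a \<Rightarrow> real) \<Rightarrow> bool"
  where "form_generator m f h \<longleftrightarrow>
    f \<in> W12 m \<and> h \<in> L2 m \<and> (\<forall>g\<in>W12 m. Dirichlet_form m f g = - L2_inner m h g)"

definition semigroup_generator ::
    "'a measure \<Rightarrow> (real \<Rightarrow> ('a \<Rightarrow> real) \<Rightarrow> 'a \<Rightarrow> real) \<Rightarrow> ('a \<Rightarrow> real) \<Rightarrow> ('a \<Rightarrow> real) \<Rightarrow> bool"
  where "semigroup_generator m P f h \<longleftrightarrow> f \<in> L2 m \<and> h \<in> L2 m \<and>
    ((\<lambda>t. L2_norm m (\<lambda>x. (P t f x - f x) / t - h x)) \<longlongrightarrow> 0) (at_right 0)"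

text \<open>The extension of the semigroup to bounded functions, by monotone limits from square
  integrable ones for nonnegative functions and by linearity in general.\<close>

definition Linf_extension ::
    "'a measure \<Rightarrow> (real \<Rightarrow> ('a \<Rightarrow> real) \<Rightarrow> 'a \<Rightarrow> real) \<Rightarrow> bool"
  where "Linf_extension m P \<longleftrightarrow>
    (\<forall>t\<ge>0. \<forall>f\<in>Linf m. \<forall>F :: nat \<Rightarrow> 'a \<Rightarrow> real.
      (\<forall>n. F n \<in> L2 m \<inter> Linf m) \<and>
      (AE x in m. (\<forall>n. 0 \<le> F n x \<and> F n x \<le> F (Suc n) x) \<and> (\<lambda>n. F n x) \<longlonglongrightarrow> f x) \<longrightarrow>
      (AE x in m. (\<lambda>n. P t (F n) x) \<longlonglongrightarrow> P t f x)) \<and>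
    (\<forall>t\<ge>0. \<forall>f\<in>Linf m. AE x in m.
      P t f x = P t (\<lambda>y. max (f y) 0) x - P t (\<lambda>y. max (- f y) 0) x)"

text \<open>A single family \<open>P\<close> acts on square integrable and on bounded functions. These conditions
  determine \<open>P t f\<close> up to null sets for \<open>t \<ge> 0\<close> and \<open>f\<close> square integrable or bounded.\<close>

definition heat_semigroup ::
    "('a :: polish_space) measure \<Rightarrow> (real \<Rightarrow> ('a \<Rightarrow> real) \<Rightarrow> 'a \<Rightarrow> real) \<Rightarrow> bool"
  where "heat_semigroup m P \<longleftrightarrow>
    L2_contraction_semigroup m P \<and>
    (\<forall>f h. semigroup_generator m P f h \<longleftrightarrow> form_generator m f h) \<and>
    Linf_extension m P"

definition invariant_set ::
    "'a measure \<Rightarrow> (real \<Rightarrow> ('a \<Rightarrow> real) \<Rightarrow> 'a \<Rightarrow> real) \<Rightarrow> 'a set \<Rightarrow> bool"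
  where "invariant_set m P A \<longleftrightarrow> (\<forall>f\<in>Linf m. \<forall>t>0. AE x in m.
    indicator A x * P t f x = P t (\<lambda>y. indicator A y * f y) x)"

end

theory Submission
  imports Defs
begin

text \<open>
  Invariance passes to the generator, and the resolvent of the generator is obtained variationally,
  as the minimiser of \<open>Ch v + c \<parallel>v - f\<parallel>\<^sup>2\<close>. For \<open>v\<close> in the domain of the generator the functions
  \<open>1\<^sub>A v\<close> and \<open>v - 1\<^sub>A v\<close> are therefore orthogonal for the Dirichlet form; letting \<open>c \<rightarrow> \<infinity>\<close> gives
  \<open>Ch (1\<^sub>A f) \<le> Ch f\<close>, so \<open>u = 1\<^sub>A \<phi>\<close> has finite energy for a cutoff \<open>\<phi>\<close> equal to \<open>1\<close> on a large
  ball. Since \<open>u\<close> only takes the values \<open>0\<close> and \<open>1\<close> there, truncating an energy-minimising sequence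
  of Lipschitz functions yields approximations of \<open>u / 2\<close> whose slopes tend to \<open>0\<close> on the ball.
  If \<open>A\<close> and its complement both have positive measure, one transports the uniform measure of a
  compact subset of the complement to that of a compact subset of \<open>A\<close>. By \<open>QCD\<close> the intermediate
  measures have bounded densities, so integrating the slope along the geodesics bounds the difference
  of the averages over the two compact sets by the integral of the slope. These averages are close to
  \<open>1/2\<close> and \<open>0\<close>, a contradiction.
\<close>

section \<open>Square integrable functions\<close>

text \<open>The obstacle is that a function which takes only two values on a ball should have
  vanishing weak gradient there. That is locality of weak gradients, whereas \<open>Ch\<close> is
  given only as a relaxation of energies of Lipschitz functions, and slopes vanish at once only on
  open sets. The proof therefore never leaves Lipschitz functions: one approximation of
  \<open>u / 2\<close> that is nearly flat on the ball is enough, and it comes from the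
  parallelogram law of \<open>L2 m\<close> applied to slopes. Hilbertianity of \<open>Ch\<close>
  serves the other half, the passage from invariance to energy. The two meet only in the generator,
  and a function of finite energy need not lie in its domain; resolvents supply approximants in the
  domain, and lower semicontinuity of \<open>Ch\<close> carries the bound back.\<close>

lemma L2_I:
  "f \<in> borel_measurable (completion m) \<Longrightarrow> integrable (completion m) (\<lambda>x. (f x)\<^sup>2) \<Longrightarrow> f \<in> L2 m"
  by (simp add: L2_def)

lemma L2_measurable [measurable_dest]: "f \<in> L2 m \<Longrightarrow> f \<in> borel_measurable (completion m)"
  by (simp add: L2_def)

lemma L2_integrable_square: "f \<in> L2 m \<Longrightarrow> integrable (completion m) (\<lambda>x. (f x)\<^sup>2)"
  by (simp add: L2_def)

lemma L2_integrable_mult: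
  assumes "f \<in> L2 m" "g \<in> L2 m"
  shows "integrable (completion m) (\<lambda>x. f x * g x)"
proof (rule Bochner_Integration.integrable_bound)
  show "integrable (completion m) (\<lambda>x. (f x)\<^sup>2 + (g x)\<^sup>2)"
    using assms by (intro Bochner_Integration.integrable_add L2_integrable_square)
  have "\<bar>a * b\<bar> \<le> a\<^sup>2 + b\<^sup>2" for a b :: real
    using sum_squares_bound[of "\<bar>a\<bar>" "\<bar>b\<bar>"] mult_nonneg_nonneg[of "\<bar>a\<bar>" "\<bar>b\<bar>"]
    unfolding abs_mult power2_abs by linarith
  then show "AE x in completion m. norm (f x * g x) \<le> norm ((f x)\<^sup>2 + (g x)\<^sup>2)"
    by (intro AE_I2) simp
qed (use assms in measurable)

lemma L2_lincomb:
  assumes "f \<in> L2 m" "g \<in> L2 m"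
  shows "(\<lambda>x. a * f x + b * g x) \<in> L2 m"
proof (rule L2_I)
  have "integrable (completion m) (\<lambda>x. a\<^sup>2 * (f x)\<^sup>2 + b\<^sup>2 * (g x)\<^sup>2 + 2 * a * b * (f x * g x))"
    using assms by (intro Bochner_Integration.integrable_add integrable_mult_right
      L2_integrable_square L2_integrable_mult)
  then show "integrable (completion m) (\<lambda>x. (a * f x + b * g x)\<^sup>2)"
    by (simp add: power2_eq_square algebra_simps)
qed (use assms in measurable)

lemma L2_add: "f \<in> L2 m \<Longrightarrow> g \<in> L2 m \<Longrightarrow> (\<lambda>x. f x + g x) \<in> L2 m"
  using L2_lincomb[of f m g 1 1] by simp

lemma L2_diff: "f \<in> L2 m \<Longrightarrow> g \<in> L2 m \<Longrightarrow> (\<lambda>x. f x - g x) \<in> L2 m"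
  using L2_lincomb[of f m g 1 "-1"] by simp

lemma L2_scale: "f \<in> L2 m \<Longrightarrow> (\<lambda>x. c * f x) \<in> L2 m"
  using L2_lincomb[of f m f c 0] by simp

lemma L2_zero: "(\<lambda>x. 0) \<in> L2 m"
  by (rule L2_I) auto

lemma L2_bound:
  assumes "f \<in> L2 m" "g \<in> borel_measurable (completion m)" "AE x in m. \<bar>g x\<bar> \<le> \<bar>f x\<bar>"
  shows "g \<in> L2 m"
proof (rule L2_I)
  have "AE x in completion m. norm ((g x)\<^sup>2) \<le> norm ((f x)\<^sup>2)"
    using AE_completion[OF assms(3)] by eventually_elim (simp add: abs_le_square_iff)
  then show "integrable (completion m) (\<lambda>x. (g x)\<^sup>2)"
    by (rule Bochner_Integration.integrable_bound[OF L2_integrable_square[OF assms(1)], rotated])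
      (use assms(2) in measurable)
qed (use assms in measurable)

lemma L2_indicator:
  assumes "A \<in> sets (completion m)" "f \<in> L2 m"
  shows "(\<lambda>x. indicator A x * f x) \<in> L2 m"
proof (rule L2_bound[OF assms(2)])
  show "(\<lambda>x. indicator A x * f x) \<in> borel_measurable (completion m)"
    using assms by measurable
qed (auto simp: indicator_def)

lemma L2_norm_nonneg: "L2_norm m f \<ge> 0"
  by (simp add: L2_norm_def L2_inner_def)

lemma L2_norm_square: "(L2_norm m f)\<^sup>2 = (\<integral>x. (f x)\<^sup>2 \<partial>completion m)"
  by (simp add: L2_norm_def L2_inner_def power2_eq_square)

lemma L2_inner_commute: "L2_inner m f g = L2_inner m g f"
  by (simp add: L2_inner_def mult.commute)

lemma L2_inner_lincomb:
  assumes "f \<in> L2 m" "g \<in> L2 m" "h \<in> L2 m"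
  shows "L2_inner m (\<lambda>x. a * f x + b * g x) h = a * L2_inner m f h + b * L2_inner m g h"
  using L2_integrable_mult[OF assms(1,3)] L2_integrable_mult[OF assms(2,3)]
  by (simp add: L2_inner_def ring_distribs mult.assoc)

lemma L2_norm_square_lincomb:
  assumes "f \<in> L2 m" "g \<in> L2 m"
  shows "(L2_norm m (\<lambda>x. a * f x + b * g x))\<^sup>2
    = a\<^sup>2 * (L2_norm m f)\<^sup>2 + b\<^sup>2 * (L2_norm m g)\<^sup>2 + 2 * a * b * L2_inner m f g"
proof -
  have "(\<integral>x. (a * f x + b * g x)\<^sup>2 \<partial>completion m)
    = (\<integral>x. a\<^sup>2 * (f x)\<^sup>2 + b\<^sup>2 * (g x)\<^sup>2 + 2 * a * b * (f x * g x) \<partial>completion m)"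
    by (rule Bochner_Integration.integral_cong) (simp_all add: power2_eq_square algebra_simps)
  then show ?thesis
    using assms by (simp add: L2_norm_square L2_inner_def L2_integrable_square L2_integrable_mult)
qed

lemma L2_norm_scale: "L2_norm m (\<lambda>x. c * f x) = \<bar>c\<bar> * L2_norm m f"
proof -
  have "L2_inner m (\<lambda>x. c * f x) (\<lambda>x. c * f x) = c\<^sup>2 * L2_inner m f f"
    unfolding L2_inner_def by (subst integral_mult_right_zero[symmetric])
      (simp add: power2_eq_square algebra_simps)
  then show ?thesis by (simp add: L2_norm_def real_sqrt_mult)
qed

text \<open>The square norm of \<open>f + t g\<close> is a polynomial in \<open>t\<close> that is
  never negative. Since \<open>L2_norm\<close> is only a seminorm on functions, its leading
  coefficient may vanish and needs a case of its own.\<close>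

lemma L2_Cauchy_Schwarz:
  assumes "f \<in> L2 m" "g \<in> L2 m"
  shows "\<bar>L2_inner m f g\<bar> \<le> L2_norm m f * L2_norm m g"
proof -
  define a b c where "a = (L2_norm m f)\<^sup>2" and "b = L2_inner m f g" and "c = (L2_norm m g)\<^sup>2"
  have pos: "0 \<le> a + t\<^sup>2 * c + 2 * t * b" for t
    using L2_norm_square_lincomb[OF assms, of 1 t] zero_le_power2[of "L2_norm m (\<lambda>x. 1 * f x + t * g x)"]
    by (simp add: a_def b_def c_def)
  have "b\<^sup>2 \<le> a * c"
  proof (cases "c = 0")
    case True
    have "b = 0"
    proof (rule ccontr)
      assume "b \<noteq> 0"
      \<comment> \<open>With \<open>c = 0\<close> the polynomial is affine in \<open>t\<close>; this
        \<open>t\<close> makes it -1.\<close>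
      then show False using pos[of "- (a + 1) / (2 * b)"] True by (simp add: field_simps)
    qed
    then show ?thesis using True by simp
  next
    case False
    then have "c > 0" by (simp add: c_def)
    then show ?thesis using pos[of "- b / c"] by (simp add: field_simps power2_eq_square)
  qed
  then have "\<bar>b\<bar>\<^sup>2 \<le> (L2_norm m f * L2_norm m g)\<^sup>2"
    by (simp add: a_def c_def power_mult_distrib)
  then show ?thesis
    unfolding b_def by (rule power2_le_imp_le) (simp add: L2_norm_nonneg)
qed

lemma L2_norm_triangle:
  assumes "f \<in> L2 m" "g \<in> L2 m"
  shows "L2_norm m (\<lambda>x. f x + g x) \<le> L2_norm m f + L2_norm m g"
proof (rule power2_le_imp_le)
  show "(L2_norm m (\<lambda>x. f x + g x))\<^sup>2 \<le> (L2_norm m f + L2_norm m g)\<^sup>2"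
    using L2_norm_square_lincomb[OF assms, of 1 1] L2_Cauchy_Schwarz[OF assms]
    by (simp add: power2_sum)
qed (simp add: L2_norm_nonneg)

lemma L2_norm_minus_commute: "L2_norm m (\<lambda>x. f x - g x) = L2_norm m (\<lambda>x. g x - f x)"
  using L2_norm_scale[of m "-1" "\<lambda>x. f x - g x"] by simp

lemma L2_norm_triangle_diff:
  assumes "f \<in> L2 m" "g \<in> L2 m" "h \<in> L2 m"
  shows "L2_norm m (\<lambda>x. f x - h x) \<le> L2_norm m (\<lambda>x. f x - g x) + L2_norm m (\<lambda>x. g x - h x)"
  using L2_norm_triangle[OF L2_diff[OF assms(1,2)] L2_diff[OF assms(2,3)]] by simp

lemma L2_norm_mono_AE:
  assumes "f \<in> L2 m" "g \<in> borel_measurable (completion m)" "AE x in m. \<bar>g x\<bar> \<le> \<bar>f x\<bar>"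
  shows "L2_norm m g \<le> L2_norm m f"
proof -
  have "AE x in completion m. (g x)\<^sup>2 \<le> (f x)\<^sup>2"
    using AE_completion[OF assms(3)] by eventually_elim (simp add: abs_le_square_iff)
  then have "(L2_norm m g)\<^sup>2 \<le> (L2_norm m f)\<^sup>2"
    unfolding L2_norm_square
    by (intro integral_mono_AE L2_integrable_square L2_bound[OF assms] assms(1))
  then show ?thesis by (rule power2_le_imp_le) (simp add: L2_norm_nonneg)
qed

lemma L2_norm_indicator_le:
  "A \<in> sets (completion m) \<Longrightarrow> f \<in> L2 m \<Longrightarrow> L2_norm m (\<lambda>x. indicator A x * f x) \<le> L2_norm m f"
  by (intro L2_norm_mono_AE L2_measurable L2_indicator) (auto simp: indicator_def)

text \<open>Truncation brings a square integrable function into \<open>Linf m\<close>, the space on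
  which invariance is stated. Dominated convergence applies with the bound
  \<open>(u x)\<^sup>2\<close>.\<close>

lemma truncation_converges:
  assumes u: "u \<in> L2 m"
  shows "(\<lambda>n. L2_norm m (\<lambda>x. u x - max (- real n) (min (real n) (u x)))) \<longlonglongrightarrow> 0"
proof -
  have [measurable]: "u \<in> borel_measurable (completion m)" by (rule L2_measurable[OF u])
  have "(\<lambda>n. \<integral>x. (u x - max (- real n) (min (real n) (u x)))\<^sup>2 \<partial>completion m) \<longlonglongrightarrow> (\<integral>x. 0 \<partial>completion m)"
  proof (rule integral_dominated_convergence)
    show "integrable (completion m) (\<lambda>x. (u x)\<^sup>2)" by (rule L2_integrable_square[OF u])
    show "AE x in completion m. (\<lambda>n. (u x - max (- real n) (min (real n) (u x)))\<^sup>2) \<longlonglongrightarrow> 0"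
    proof (rule AE_I2)
      fix x
      obtain k :: nat where k: "\<bar>u x\<bar> \<le> real k" using real_arch_simple by blast
      have "\<forall>\<^sub>F n in sequentially. (u x - max (- real n) (min (real n) (u x)))\<^sup>2 = 0"
        by (rule eventually_mono[OF eventually_ge_at_top[of k]]) (use k in \<open>auto simp: max_def min_def\<close>)
      then show "(\<lambda>n. (u x - max (- real n) (min (real n) (u x)))\<^sup>2) \<longlonglongrightarrow> 0"
        by (rule tendsto_eventually)
    qed
    show "AE x in completion m. norm ((u x - max (- real n) (min (real n) (u x)))\<^sup>2) \<le> (u x)\<^sup>2" for n
    proof (rule AE_I2)
      fix x
      have "\<bar>u x - max (- real n) (min (real n) (u x))\<bar> \<le> \<bar>u x\<bar>" by (auto simp: max_def min_def)
      then show "norm ((u x - max (- real n) (min (real n) (u x)))\<^sup>2) \<le> (u x)\<^sup>2"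
        by (simp add: abs_le_square_iff)
    qed
  qed measurable
  then have "(\<lambda>n. (L2_norm m (\<lambda>x. u x - max (- real n) (min (real n) (u x))))\<^sup>2) \<longlonglongrightarrow> 0"
    by (simp add: L2_norm_square)
  then have "(\<lambda>n. sqrt ((L2_norm m (\<lambda>x. u x - max (- real n) (min (real n) (u x))))\<^sup>2)) \<longlonglongrightarrow> sqrt 0"
    by (rule tendsto_real_sqrt)
  then show ?thesis by (simp add: L2_norm_nonneg)
qed

lemma L2_norm_cong_AE:
  assumes "f \<in> borel_measurable (completion m)" "g \<in> borel_measurable (completion m)"
    "AE x in m. g x = f x"
  shows "L2_norm m g = L2_norm m f"
proof -
  have "(\<integral>x. g x * g x \<partial>completion m) = (\<integral>x. f x * f x \<partial>completion m)"
    using AE_completion[OF assms(3)] assms(1,2) by (intro integral_cong_AE) auto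
  then show ?thesis by (simp add: L2_norm_def L2_inner_def)
qed

lemma L2_norm_square_nn:
  assumes "f \<in> L2 m"
  shows "(\<integral>\<^sup>+x. ennreal ((f x)\<^sup>2) \<partial>m) = ennreal ((L2_norm m f)\<^sup>2)"
  using nn_integral_eq_integral[OF L2_integrable_square[OF assms]]
  by (simp add: L2_norm_square nn_integral_completion)

lemma L2_I_nn:
  assumes "f \<in> borel_measurable (completion m)" "(\<integral>\<^sup>+x. ennreal ((f x)\<^sup>2) \<partial>m) < \<infinity>"
  shows "f \<in> L2 m"
proof (rule L2_I[OF assms(1)], rule integrableI_nonneg)
  show "(\<integral>\<^sup>+x. ennreal ((f x)\<^sup>2) \<partial>completion m) < \<infinity>"
    using assms(2) by (simp add: nn_integral_completion)
qed (use assms(1) in auto)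

lemma L2_norm_le_nn:
  assumes "f \<in> L2 m" "(\<integral>\<^sup>+x. ennreal ((f x)\<^sup>2) \<partial>m) \<le> ennreal (c\<^sup>2)" "c \<ge> 0"
  shows "L2_norm m f \<le> c"
proof (rule power2_le_imp_le)
  show "(L2_norm m f)\<^sup>2 \<le> c\<^sup>2"
    using assms(2) unfolding L2_norm_square_nn[OF assms(1)] by simp
qed fact

section \<open>Completeness of the space of square integrable functions\<close>

lemma term_le_suminf: "f n \<le> (\<Sum>n. f n)" for f :: "nat \<Rightarrow> ennreal"
  using sum_le_suminf[of f "{n}"] by auto

text \<open>Squared increments are at most \<open>(1/16) ^ n\<close>, so weights
  \<open>4 ^ n\<close> keep the series of integrals summable. Almost everywhere finiteness of the
  weighted sum bounds the \<open>n\<close>-th increment by a multiple of \<open>(1/2) ^ n\<close>,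
  which gives pointwise convergence.\<close>

lemma L2_Cauchy_AE_limit:
  assumes F: "\<And>n. F n \<in> L2 m"
    and fast: "\<And>n. L2_norm m (\<lambda>x. F (Suc n) x - F n x) \<le> (1/4) ^ n"
  shows "AE x in m. convergent (\<lambda>n. F n x)"
proof -
  define a where "a n x = F (Suc n) x - F n x" for n x
  have aL [measurable]: "a n \<in> L2 m" for n
    unfolding a_def by (intro L2_diff F)
  have [measurable]: "a n \<in> borel_measurable (completion m)" for n using L2_measurable[OF aL] .
  have "(\<integral>\<^sup>+x. (\<Sum>n. ennreal (4 ^ n * (a n x)\<^sup>2)) \<partial>completion m)
      = (\<Sum>n. \<integral>\<^sup>+x. ennreal (4 ^ n * (a n x)\<^sup>2) \<partial>completion m)"
    by (rule nn_integral_suminf) simp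
  also have "\<dots> \<le> (\<Sum>n. ennreal ((1/4) ^ n))"
  proof (rule suminf_le)
    fix n
    have "(\<integral>\<^sup>+x. ennreal (4 ^ n * (a n x)\<^sup>2) \<partial>completion m)
        = ennreal (4 ^ n) * (\<integral>\<^sup>+x. ennreal ((a n x)\<^sup>2) \<partial>completion m)"
      by (subst nn_integral_cmult[symmetric]) (auto simp: ennreal_mult)
    also have "\<dots> = ennreal (4 ^ n * (L2_norm m (a n))\<^sup>2)"
      by (simp add: nn_integral_completion L2_norm_square_nn aL ennreal_mult)
    also have "\<dots> \<le> ennreal ((1/4) ^ n)"
    proof (rule ennreal_leI)
      have "(L2_norm m (a n))\<^sup>2 \<le> ((1/4) ^ n)\<^sup>2"
        using fast[of n] by (intro power_mono) (auto simp: a_def[abs_def] L2_norm_nonneg)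
      then have "4 ^ n * (L2_norm m (a n))\<^sup>2 \<le> 4 ^ n * ((1/4) ^ n)\<^sup>2" by simp
      also have "\<dots> = (1/4) ^ n"
        by (simp add: power2_eq_square mult.assoc[symmetric] power_mult_distrib[symmetric])
      finally show "4 ^ n * (L2_norm m (a n))\<^sup>2 \<le> (1/4) ^ n" .
    qed
    finally show "(\<integral>\<^sup>+x. ennreal (4 ^ n * (a n x)\<^sup>2) \<partial>completion m) \<le> ennreal ((1/4) ^ n)" .
  qed auto
  also have "\<dots> = ennreal (\<Sum>n. (1/4) ^ n)"
    by (rule suminf_ennreal2) (auto intro: summable_geometric)
  also have "\<dots> < \<infinity>" by (rule ennreal_less_top[folded infinity_ennreal_def])
  finally have "AE x in completion m. (\<Sum>n. ennreal (4 ^ n * (a n x)\<^sup>2)) \<noteq> \<infinity>"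
    by (intro nn_integral_PInf_AE) auto
  then have "AE x in m. (\<Sum>n. ennreal (4 ^ n * (a n x)\<^sup>2)) \<noteq> \<infinity>"
    by (simp add: AE_completion_iff)
  then show ?thesis
  proof eventually_elim
    fix x assume fin: "(\<Sum>n. ennreal (4 ^ n * (a n x)\<^sup>2)) \<noteq> \<infinity>"
    define B where "B = enn2real (\<Sum>n. ennreal (4 ^ n * (a n x)\<^sup>2))"
    have "B \<ge> 0" by (simp add: B_def)
    have "4 ^ n * (a n x)\<^sup>2 \<le> B" for n
    proof -
      have "ennreal (4 ^ n * (a n x)\<^sup>2) \<le> (\<Sum>n. ennreal (4 ^ n * (a n x)\<^sup>2))"
        by (rule term_le_suminf)
      also have "\<dots> = ennreal B" using fin by (simp add: B_def less_top[symmetric])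
      finally show ?thesis using \<open>B \<ge> 0\<close> by simp
    qed
    then have "\<bar>a n x\<bar> \<le> sqrt B * (1/2) ^ n" for n
    proof -
      assume *: "\<And>n. 4 ^ n * (a n x)\<^sup>2 \<le> B"
      have "(2 ^ n * \<bar>a n x\<bar>)\<^sup>2 = 4 ^ n * (a n x)\<^sup>2"
        by (simp add: power_mult_distrib power_mult[symmetric] mult.commute[of n] power_mult)
      then have "2 ^ n * \<bar>a n x\<bar> \<le> sqrt B"
        using *[of n] by (intro real_le_rsqrt) simp
      then show ?thesis by (simp add: power_one_over field_simps)
    qed
    then have "summable (\<lambda>n. a n x)"
      by (intro summable_comparison_test'[OF summable_mult[OF summable_geometric], of "1/2" 0 _ "sqrt B"])
        simp_all
    then have "convergent (\<lambda>n. \<Sum>i<n. a i x)" by (simp add: summable_iff_convergent)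
    then have "convergent (\<lambda>n. F n x - F 0 x)"
      unfolding a_def sum_lessThan_telescope[of "\<lambda>n. F n x"] .
    then show "convergent (\<lambda>n. F n x)"
      using convergent_diff_const_right_iff by blast
  qed
qed

text \<open>Riesz-Fischer: the limit is found along a rapidly converging subsequence, and Fatou's
  lemma turns pointwise into norm convergence. Minimising sequences of the resolvent functional get
  their limit here.\<close>

lemma L2_complete:
  assumes F: "\<And>n. F n \<in> L2 m"
    and Cauchy: "\<And>\<epsilon>. \<epsilon> > 0 \<Longrightarrow> \<exists>M. \<forall>i\<ge>M. \<forall>j\<ge>M. L2_norm m (\<lambda>x. F i x - F j x) \<le> \<epsilon>"
  shows "\<exists>f\<in>L2 m. (\<lambda>n. L2_norm m (\<lambda>x. F n x - f x)) \<longlonglongrightarrow> 0"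
proof -
  have "\<forall>k. \<exists>M. \<forall>i\<ge>M. \<forall>j\<ge>M. L2_norm m (\<lambda>x. F i x - F j x) \<le> (1/4) ^ k"
    by (intro allI Cauchy) simp
  then obtain M where M: "\<And>k i j. i \<ge> M k \<Longrightarrow> j \<ge> M k \<Longrightarrow> L2_norm m (\<lambda>x. F i x - F j x) \<le> (1/4) ^ k"
    unfolding choice_iff by blast
  \<comment> \<open>Adding up thresholds and \<open>k\<close> itself puts both \<open>r k\<close>
    and \<open>r (Suc k)\<close> beyond \<open>M k\<close> and sends \<open>r k\<close> to
    infinity.\<close>
  define r where "r k = k + (\<Sum>i\<le>k. M i)" for k
  have rM: "r k \<ge> M k" "r (Suc k) \<ge> M k" "r k \<ge> k" for k
    using member_le_sum[of k "{..k}" M] member_le_sum[of k "{..Suc k}" M] by (auto simp: r_def)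
  have "AE x in m. convergent (\<lambda>k. F (r k) x)"
    using L2_Cauchy_AE_limit[of "\<lambda>k. F (r k)" m] F M rM by blast
  moreover define f where "f x = lim (\<lambda>k. F (r k) x)" for x
  ultimately have lim: "AE x in m. (\<lambda>k. F (r k) x) \<longlonglongrightarrow> f x"
    by (simp add: convergent_LIMSEQ_iff)
  have [measurable]: "F n \<in> borel_measurable (completion m)" for n using L2_measurable[OF F] .
  have [measurable]: "f \<in> borel_measurable (completion m)"
    unfolding f_def by (rule borel_measurable_lim_metric) measurable
  \<comment> \<open>Fatou is applied in the second index only: \<open>n\<close> stays arbitrary, so
    the bound concerns the whole sequence and not just the subsequence \<open>r\<close>.\<close>
  have est: "(\<integral>\<^sup>+x. ennreal ((F n x - f x)\<^sup>2) \<partial>m) \<le> ennreal (\<epsilon>\<^sup>2)"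
    if "\<forall>i\<ge>M0. \<forall>j\<ge>M0. L2_norm m (\<lambda>x. F i x - F j x) \<le> \<epsilon>" "n \<ge> M0" for n M0 \<epsilon>
  proof -
    have "(\<integral>\<^sup>+x. ennreal ((F n x - f x)\<^sup>2) \<partial>completion m)
      = (\<integral>\<^sup>+x. liminf (\<lambda>k. ennreal ((F n x - F (r k) x)\<^sup>2)) \<partial>completion m)"
      using AE_completion[OF lim]
      by (intro nn_integral_cong_AE, eventually_elim)
        (intro lim_imp_Liminf[symmetric] tendsto_ennrealI tendsto_intros, auto)
    also have "\<dots> \<le> liminf (\<lambda>k. \<integral>\<^sup>+x. ennreal ((F n x - F (r k) x)\<^sup>2) \<partial>completion m)"
      by (rule nn_integral_liminf) simp
    also have "\<dots> \<le> ennreal (\<epsilon>\<^sup>2)"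
    proof (rule Liminf_le[OF _ eventually_sequentiallyI[of M0]])
      fix k assume "k \<ge> M0"
      then have "L2_norm m (\<lambda>x. F n x - F (r k) x) \<le> \<epsilon>"
        using that rM(3)[of k] by auto
      then have "(L2_norm m (\<lambda>x. F n x - F (r k) x))\<^sup>2 \<le> \<epsilon>\<^sup>2"
        by (intro power_mono L2_norm_nonneg)
      then show "(\<integral>\<^sup>+x. ennreal ((F n x - F (r k) x)\<^sup>2) \<partial>completion m) \<le> ennreal (\<epsilon>\<^sup>2)"
        by (simp add: nn_integral_completion L2_norm_square_nn[OF L2_diff[OF F F]])
    qed simp
    finally show ?thesis by (simp add: nn_integral_completion)
  qed
  have "(\<lambda>x. F n x - f x) \<in> L2 m" if "\<forall>i\<ge>M0. \<forall>j\<ge>M0. L2_norm m (\<lambda>x. F i x - F j x) \<le> \<epsilon>" "n \<ge> M0"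
    for n M0 \<epsilon>
    using est[OF that] by (intro L2_I_nn) (auto intro: le_less_trans)
  note diff = this
  obtain M1 where M1: "\<forall>i\<ge>M1. \<forall>j\<ge>M1. L2_norm m (\<lambda>x. F i x - F j x) \<le> 1" using Cauchy[of 1] by auto
  have fL: "f \<in> L2 m"
    using L2_diff[OF F[of M1] diff[OF M1 order_refl]] by simp
  have "(\<lambda>n. L2_norm m (\<lambda>x. F n x - f x)) \<longlonglongrightarrow> 0"
  proof (rule LIMSEQ_I)
    fix e :: real assume "e > 0"
    then obtain M0 where M0: "\<forall>i\<ge>M0. \<forall>j\<ge>M0. L2_norm m (\<lambda>x. F i x - F j x) \<le> e / 2"
      using Cauchy[of "e/2"] by auto
    have "norm (L2_norm m (\<lambda>x. F n x - f x) - 0) < e" if "n \<ge> M0" for n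
      using L2_norm_le_nn[OF diff[OF M0 that] est[OF M0 that]] \<open>e > 0\<close> by (simp add: L2_norm_nonneg)
    then show "\<exists>no. \<forall>n\<ge>no. norm (L2_norm m (\<lambda>x. F n x - f x) - 0) < e" by blast
  qed
  then show ?thesis using fL by blast
qed

section \<open>Slopes and the Cheeger energy\<close>

lemma mms_sets: "metric_measure_space m \<Longrightarrow> sets m = sets borel"
  by (simp add: metric_measure_space_def)

lemma mms_space: "metric_measure_space m \<Longrightarrow> space m = UNIV"
  using sets_eq_imp_space_eq[OF mms_sets] by simp

lemma mms_bounded_finite:
  "metric_measure_space m \<Longrightarrow> B \<in> sets borel \<Longrightarrow> bounded B \<Longrightarrow> emeasure m B < \<infinity>"
  by (simp add: metric_measure_space_def)

lemma mms_borel_measurable: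
  assumes "metric_measure_space m" "f \<in> borel_measurable borel"
  shows "f \<in> borel_measurable m" "f \<in> borel_measurable (completion m)"
proof -
  show "f \<in> borel_measurable m"
    using assms(2) by (simp cong: measurable_cong_sets add: mms_sets[OF assms(1)])
  then show "f \<in> borel_measurable (completion m)" by (rule measurable_completion)
qed

text \<open>With \<open>slope_leI\<close>, this trades the limit superior for eventual Lipschitz
  bounds free of division. The strict bound is what makes the estimate hold on a whole punctured
  neighbourhood.\<close>

lemma slope_lessD:
  fixes f :: "'a :: metric_space \<Rightarrow> real"
  assumes "slope f x < ennreal c"
  shows "\<forall>\<^sub>F y in at x. \<bar>f y - f x\<bar> \<le> c * dist x y"
proof -
  have "\<forall>\<^sub>F y in at x. ennreal (\<bar>f y - f x\<bar> / dist x y) < ennreal c"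
    using assms unfolding slope_def by (rule Limsup_lessD)
  moreover have "\<forall>\<^sub>F y in at x. y \<noteq> x" by (simp add: eventually_at_filter)
  ultimately show ?thesis
  proof eventually_elim
    fix y assume *: "ennreal (\<bar>f y - f x\<bar> / dist x y) < ennreal c" and "y \<noteq> x"
    then have "dist x y > 0" by simp
    moreover have "\<bar>f y - f x\<bar> / dist x y < c"
      using * by (subst (asm) ennreal_less_iff) auto
    ultimately show "\<bar>f y - f x\<bar> \<le> c * dist x y" by (simp add: field_simps)
  qed
qed

lemma slope_leI:
  fixes f :: "'a :: metric_space \<Rightarrow> real"
  assumes "\<forall>\<^sub>F y in at x. \<bar>f y - f x\<bar> \<le> c * dist x y"
  shows "slope f x \<le> ennreal c"
  unfolding slope_def
proof (rule Limsup_bounded)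
  have "\<forall>\<^sub>F y in at x. y \<noteq> x" by (simp add: eventually_at_filter)
  with assms show "\<forall>\<^sub>F y in at x. ennreal (\<bar>f y - f x\<bar> / dist x y) \<le> ennreal c"
  proof eventually_elim
    fix y assume *: "\<bar>f y - f x\<bar> \<le> c * dist x y" and "y \<noteq> x"
    then have "dist x y > 0" by simp
    with * show "ennreal (\<bar>f y - f x\<bar> / dist x y) \<le> ennreal c"
      by (intro ennreal_leI) (simp add: field_simps)
  qed
qed

lemma slope_mono:
  fixes f g :: "'a :: metric_space \<Rightarrow> real"
  assumes "\<And>y. \<bar>g y - g x\<bar> \<le> \<bar>f y - f x\<bar>"
  shows "slope g x \<le> slope f x"
  unfolding slope_def
  by (intro Limsup_mono always_eventually allI ennreal_leI divide_right_mono assms) simp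

lemma slope_lipschitz:
  fixes f :: "'a :: metric_space \<Rightarrow> real"
  assumes "L-lipschitz_on UNIV f"
  shows "slope f x \<le> ennreal L"
  using lipschitz_onD[OF assms] by (intro slope_leI always_eventually) (auto simp: dist_real_def abs_minus_commute dist_commute)

lemma slope_eq_0:
  fixes f :: "'a :: metric_space \<Rightarrow> real"
  assumes "open U" "x \<in> U" "\<And>y. y \<in> U \<Longrightarrow> f y = f x"
  shows "slope f x = 0"
proof -
  have "\<forall>\<^sub>F y in at x. y \<in> U" using assms(1,2) by (rule eventually_at_in_open')
  then have "slope f x \<le> ennreal 0"
    using assms(3) by (intro slope_leI) (auto elim!: eventually_mono)
  then show ?thesis by simp
qed

lemma slope_const [simp]: "slope (\<lambda>x. c) x = 0"
  by (rule slope_eq_0[of UNIV]) auto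

text \<open>Suprema over punctured balls decrease with the radius, so a countable sequence of radii
  decides the limit superior; measurability of slopes depends on this.\<close>

lemma slope_sublevel_iff:
  fixes f :: "'a :: metric_space \<Rightarrow> real"
  shows "slope f x < c \<longleftrightarrow>
    (\<exists>n. (SUP y\<in>{y. y \<noteq> x \<and> dist y x < 1 / real (Suc n)}. ennreal (\<bar>f y - f x\<bar> / dist x y)) < c)"
    (is "_ \<longleftrightarrow> (\<exists>n. ?S n < c)")
proof
  assume "slope f x < c"
  then obtain P where P: "eventually P (at x)" "(SUP y\<in>{y. P y}. ennreal (\<bar>f y - f x\<bar> / dist x y)) < c"
    unfolding slope_def Limsup_def by (auto simp: INF_less_iff)
  then obtain d where d: "d > 0" "\<And>y. y \<noteq> x \<Longrightarrow> dist y x < d \<Longrightarrow> P y"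
    unfolding eventually_at by auto
  then obtain n where n: "1 / real (Suc n) < d" using nat_approx_posE by blast
  have "?S n \<le> (SUP y\<in>{y. P y}. ennreal (\<bar>f y - f x\<bar> / dist x y))"
    using d n by (intro SUP_subset_mono) auto
  then show "\<exists>n. ?S n < c" using P(2) by (blast intro: le_less_trans)
next
  assume "\<exists>n. ?S n < c"
  then obtain n where n: "?S n < c" by blast
  have "slope f x \<le> ?S n"
    unfolding slope_def Limsup_def
    by (intro INF_lower2[of "\<lambda>y. y \<noteq> x \<and> dist y x < 1 / real (Suc n)"])
      (auto simp: eventually_at intro!: exI[of _ "1 / real (Suc n)"])
  then show "slope f x < c" using n by simp
qed

text \<open>At a fixed radius the supremum is lower semicontinuous: for fixed \<open>y\<close>, the
  condition that \<open>y\<close> witnesses a quotient above \<open>c\<close> is open in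
  \<open>x\<close>. Countably many radii then give the slope.\<close>

lemma slope_borel [measurable]:
  fixes f :: "'a :: metric_space \<Rightarrow> real"
  assumes cont: "continuous_on UNIV f"
  shows "slope f \<in> borel_measurable borel"
proof -
  define S where "S n x = (SUP y\<in>{y. y \<noteq> x \<and> dist y x < 1 / real (Suc n)}. ennreal (\<bar>f y - f x\<bar> / dist x y))"
    for n x
  have "open {x. c < S n x}" for n c
  proof -
    have "{x. c < S n x} = (\<Union>y. {x. 0 < dist y x \<and> dist y x < 1 / real (Suc n) \<and> c < ennreal (\<bar>f y - f x\<bar> / dist x y)})"
      by (auto simp: S_def less_SUP_iff)
    moreover have "open {x. 0 < dist y x \<and> dist y x < 1 / real (Suc n) \<and> c < ennreal (\<bar>f y - f x\<bar> / dist x y)}" for y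
    proof -
      have c: "continuous_on (- {y}) (\<lambda>x. ennreal (\<bar>f y - f x\<bar> / dist x y))"
        by (intro continuous_on_ennreal continuous_intros continuous_on_subset[OF cont]) auto
      have "open (- {y} \<inter> (\<lambda>x. ennreal (\<bar>f y - f x\<bar> / dist x y)) -` {c<..})"
        by (rule continuous_open_preimage[OF c]) auto
      then have "open ({x. 0 < dist y x \<and> dist y x < 1 / real (Suc n)} \<inter>
          (- {y} \<inter> (\<lambda>x. ennreal (\<bar>f y - f x\<bar> / dist x y)) -` {c<..}))"
        by (intro open_Int[OF open_Collect_conj] open_Collect_less continuous_intros)
      also have "({x. 0 < dist y x \<and> dist y x < 1 / real (Suc n)} \<inter>
          (- {y} \<inter> (\<lambda>x. ennreal (\<bar>f y - f x\<bar> / dist x y)) -` {c<..}))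
        = {x. 0 < dist y x \<and> dist y x < 1 / real (Suc n) \<and> c < ennreal (\<bar>f y - f x\<bar> / dist x y)}" by auto
      finally show ?thesis .
    qed
    ultimately show ?thesis by auto
  qed
  then have S [measurable]: "S n \<in> borel_measurable borel" for n
    by (intro borel_measurableI_greater) auto
  have "{x. slope f x < c} = (\<Union>n. {x. S n x < c})" for c
    unfolding S_def by (auto simp: slope_sublevel_iff)
  moreover have "{x. S n x < c} \<in> sets borel" for n c by measurable
  ultimately have "{x. slope f x < c} \<in> sets borel" for c by auto
  then show ?thesis by (intro borel_measurableI_less) auto
qed

section \<open>Lipschitz functions with bounded support\<close>

lemma Lip_bsE:
  assumes "f \<in> Lip_bs"
  obtains L B where "L-lipschitz_on UNIV f" "bounded (closure {x. f x \<noteq> 0})" "\<forall>x. \<bar>f x\<bar> \<le> B"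
proof -
  from assms obtain L where L: "L-lipschitz_on UNIV f" and b: "bounded (closure {x. f x \<noteq> 0})"
    by (auto simp: Lip_bs_def)
  have "\<exists>B. \<forall>x. \<bar>f x\<bar> \<le> B"
  proof (cases "\<exists>x0. f x0 \<noteq> 0")
    case True
    then obtain x0 where x0: "f x0 \<noteq> 0" by blast
    from b obtain R where R: "\<And>x y. f x \<noteq> 0 \<Longrightarrow> f y \<noteq> 0 \<Longrightarrow> dist x y \<le> R"
      using closure_subset[of "{x. f x \<noteq> 0}"] unfolding bounded_two_points by blast
    have "\<bar>f x\<bar> \<le> \<bar>f x0\<bar> + L * R" for x
    proof (cases "f x = 0")
      case True
      have "R \<ge> 0" using R[OF x0 x0] by simp
      then show ?thesis using True lipschitz_on_nonneg[OF L] by simp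
    next
      case False
      have "\<bar>f x - f x0\<bar> \<le> L * dist x x0"
        using lipschitz_onD[OF L, of x x0] by (simp add: dist_real_def)
      also have "\<dots> \<le> L * R" using R[OF False x0] lipschitz_on_nonneg[OF L] by (intro mult_left_mono)
      finally show ?thesis by linarith
    qed
    then show ?thesis by blast
  qed (auto intro: exI[of _ 0])
  with L b that show thesis by blast
qed

lemma Lip_bs_continuous: "f \<in> Lip_bs \<Longrightarrow> continuous_on UNIV f"
  by (auto elim!: Lip_bsE intro: lipschitz_on_continuous_on)

lemma Lip_bs_borel: "f \<in> Lip_bs \<Longrightarrow> f \<in> borel_measurable borel"
  by (intro borel_measurable_continuous_onI Lip_bs_continuous)

lemma Lip_bs_midpoint:
  assumes "f \<in> Lip_bs" "g \<in> Lip_bs"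
  shows "(\<lambda>x. (f x + g x) / 2) \<in> Lip_bs"
proof -
  from assms obtain L1 L2 where L: "L1-lipschitz_on UNIV f" "L2-lipschitz_on UNIV g"
    and b: "bounded (closure {x. f x \<noteq> 0} \<union> closure {x. g x \<noteq> 0})"
    by (auto simp: Lip_bs_def)
  have "(L1 + L2)-lipschitz_on UNIV (\<lambda>x. (f x + g x) / 2)"
  proof (rule lipschitz_onI)
    fix x y
    have *: "\<bar>f x - f y\<bar> \<le> L1 * dist x y" "\<bar>g x - g y\<bar> \<le> L2 * dist x y"
      using lipschitz_onD[OF L(1)] lipschitz_onD[OF L(2)] by (auto simp: dist_real_def)
    have "\<bar>(f x + g x) / 2 - (f y + g y) / 2\<bar> \<le> \<bar>f x - f y\<bar> + \<bar>g x - g y\<bar>" by argo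
    then show "dist ((f x + g x) / 2) ((f y + g y) / 2) \<le> (L1 + L2) * dist x y"
      using * unfolding dist_real_def distrib_right by linarith
  qed (use lipschitz_on_nonneg[OF L(1)] lipschitz_on_nonneg[OF L(2)] in simp)
  moreover have "closure {x. (f x + g x) / 2 \<noteq> 0} \<subseteq> closure {x. f x \<noteq> 0} \<union> closure {x. g x \<noteq> 0}"
    unfolding closure_Un[symmetric] by (rule closure_mono) auto
  ultimately show ?thesis
    using bounded_subset[OF b] by (auto simp: Lip_bs_def)
qed

lemma Lip_bs_contraction:
  assumes "f \<in> Lip_bs" "\<And>x y. \<bar>g x - g y\<bar> \<le> \<bar>f x - f y\<bar>" "\<And>x. f x = 0 \<Longrightarrow> g x = 0"
  shows "g \<in> Lip_bs"
proof -
  from assms(1) obtain L where L: "L-lipschitz_on UNIV f" and b: "bounded (closure {x. f x \<noteq> 0})"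
    by (auto simp: Lip_bs_def)
  have "L-lipschitz_on UNIV g"
    using lipschitz_onD[OF L] unfolding dist_real_def
    by (intro lipschitz_onI lipschitz_on_nonneg[OF L]) (auto simp: dist_real_def intro: order_trans[OF assms(2)])
  moreover have "closure {x. g x \<noteq> 0} \<subseteq> closure {x. f x \<noteq> 0}"
    by (rule closure_mono) (use assms(3) in auto)
  ultimately show ?thesis using bounded_subset[OF b] by (auto simp: Lip_bs_def)
qed

lemma Lip_bs_L2:
  assumes mm: "metric_measure_space m" and f: "f \<in> Lip_bs"
  shows "f \<in> L2 m"
proof -
  from f obtain L B where L: "L-lipschitz_on UNIV f" and S: "bounded (closure {x. f x \<noteq> 0})"
    and B: "\<forall>x. \<bar>f x\<bar> \<le> B" by (rule Lip_bsE)
  let ?S = "closure {x. f x \<noteq> 0}"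
  have [measurable]: "f \<in> borel_measurable m" "?S \<in> sets m"
    using mms_borel_measurable[OF mm Lip_bs_borel[OF f]] by (simp_all add: mms_sets[OF mm])
  show ?thesis
  proof (rule L2_I_nn)
    have "(\<integral>\<^sup>+x. ennreal ((f x)\<^sup>2) \<partial>m) \<le> (\<integral>\<^sup>+x. ennreal (B\<^sup>2) * indicator ?S x \<partial>m)"
    proof (intro nn_integral_mono)
      fix x
      show "ennreal ((f x)\<^sup>2) \<le> ennreal (B\<^sup>2) * indicator ?S x"
      proof (cases "x \<in> ?S")
        case True
        have "\<bar>f x\<bar>\<^sup>2 \<le> B\<^sup>2" using B by (intro power_mono) auto
        with True show ?thesis by (simp add: ennreal_leI)
      next
        case False
        then have "f x = 0" using closure_subset[of "{x. f x \<noteq> 0}"] by auto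
        then show ?thesis by simp
      qed
    qed
    also have "\<dots> = ennreal (B\<^sup>2) * emeasure m ?S" by (subst nn_integral_cmult_indicator) auto
    also have "\<dots> < \<infinity>" using mms_bounded_finite[OF mm _ S] by (auto simp: ennreal_mult_less_top)
    finally show "(\<integral>\<^sup>+x. ennreal ((f x)\<^sup>2) \<partial>m) < \<infinity>" .
  qed (intro measurable_completion, simp)
qed

text \<open>The functional whose relaxation in the norm of \<open>L2 m\<close> is
  \<open>Ch\<close>.\<close>

definition lip_energy :: "'a measure \<Rightarrow> ('a :: metric_space \<Rightarrow> real) \<Rightarrow> ennreal"
  where "lip_energy m f = (\<integral>\<^sup>+x. (slope f x)\<^sup>2 \<partial>m)"

lemma lip_energy_finite:
  assumes mm: "metric_measure_space m" and f: "f \<in> Lip_bs"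
  shows "lip_energy m f < \<infinity>"
proof -
  from f obtain L B where L: "L-lipschitz_on UNIV f" and S: "bounded (closure {x. f x \<noteq> 0})"
    and B: "\<forall>x. \<bar>f x\<bar> \<le> B" by (rule Lip_bsE)
  let ?S = "closure {x. f x \<noteq> 0}"
  have [measurable]: "?S \<in> sets m" by (simp add: mms_sets[OF mm])
  have "lip_energy m f \<le> (\<integral>\<^sup>+x. (ennreal L)\<^sup>2 * indicator ?S x \<partial>m)"
    unfolding lip_energy_def
  proof (intro nn_integral_mono)
    fix x
    show "(slope f x)\<^sup>2 \<le> (ennreal L)\<^sup>2 * indicator ?S x"
    proof (cases "x \<in> ?S")
      case True
      then show ?thesis using slope_lipschitz[OF L, of x] by (simp add: power_mono)
    next
      case False
      \<comment> \<open>The slope also sees neighbouring points, hence the closed support, whose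
        complement is open.\<close>
      have zero: "f y = 0" if "y \<in> - ?S" for y using that closure_subset[of "{x. f x \<noteq> 0}"] by auto
      have "slope f x = 0"
      proof (rule slope_eq_0)
        show "open (- ?S)" "x \<in> - ?S" using False by auto
        show "f y = f x" if "y \<in> - ?S" for y using zero[OF that] zero[of x] False by simp
      qed
      then show ?thesis by (metis zero_power2 zero_le)
    qed
  qed
  also have "\<dots> = (ennreal L)\<^sup>2 * emeasure m ?S" by (subst nn_integral_cmult_indicator) auto
  also have "\<dots> < \<infinity>" using mms_bounded_finite[OF mm _ S]
    by (auto simp: ennreal_mult_less_top power2_eq_square)
  finally show ?thesis .
qed

text \<open>Choosing one approximation for each \<epsilon> = 1/(n+1) gives the sequence in the
  definition of \<open>Ch\<close>. With \<open>Ch_lessD\<close> as the reverse direction, later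
  arguments handle single approximations instead of sequences.\<close>

lemma Ch_leI:
  assumes "\<And>\<epsilon>::real. \<epsilon> > 0 \<Longrightarrow> \<exists>F\<in>Lip_bs. L2_norm m (\<lambda>x. F x - f x) < \<epsilon> \<and> lip_energy m F \<le> C + ennreal \<epsilon>"
  shows "Ch m f \<le> C"
proof -
  have "\<forall>n. \<exists>F\<in>Lip_bs. L2_norm m (\<lambda>x. F x - f x) < 1 / real (Suc n) \<and> lip_energy m F \<le> C + ennreal (1 / real (Suc n))"
    by (intro allI assms) simp
  then obtain F where F: "\<And>n. F n \<in> Lip_bs" "\<And>n. L2_norm m (\<lambda>x. F n x - f x) < 1 / real (Suc n)"
    "\<And>n. lip_energy m (F n) \<le> C + ennreal (1 / real (Suc n))"
    by metis
  have "(\<lambda>n. L2_norm m (\<lambda>x. F n x - f x)) \<longlonglongrightarrow> 0"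
    by (rule tendsto_sandwich[OF _ _ tendsto_const LIMSEQ_Suc[OF lim_1_over_n]])
      (auto intro!: always_eventually less_imp_le[OF F(2)] simp: L2_norm_nonneg simp del: of_nat_Suc)
  then have "Ch m f \<le> liminf (\<lambda>n. lip_energy m (F n))"
    unfolding Ch_def lip_energy_def using F(1) by (intro Inf_lower) auto
  also have "\<dots> \<le> liminf (\<lambda>n. C + ennreal (1 / real (Suc n)))"
    by (intro Liminf_mono always_eventually allI F)
  also have "\<dots> = C + ennreal 0"
    by (intro lim_imp_Liminf tendsto_add tendsto_const tendsto_ennrealI LIMSEQ_Suc[OF lim_1_over_n]) simp
  finally show ?thesis by simp
qed

lemma Ch_lessD:
  assumes "Ch m f < C" "\<epsilon> > 0"
  shows "\<exists>F\<in>Lip_bs. L2_norm m (\<lambda>x. F x - f x) < \<epsilon> \<and> lip_energy m F < C"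
proof -
  from assms(1) obtain F where F: "\<And>n. F n \<in> Lip_bs" "(\<lambda>n. L2_norm m (\<lambda>x. F n x - f x)) \<longlonglongrightarrow> 0"
    "liminf (\<lambda>n. lip_energy m (F n)) < C"
    unfolding Ch_def lip_energy_def by (auto simp: Inf_less_iff)
  have "\<not> (\<forall>\<^sub>F n in sequentially. C \<le> lip_energy m (F n))"
    using F(3) Liminf_bounded[of C "\<lambda>n. lip_energy m (F n)" sequentially] by auto
  then have "\<exists>\<^sub>F n in sequentially. lip_energy m (F n) < C"
    by (simp add: frequently_def not_less)
  moreover have "\<forall>\<^sub>F n in sequentially. L2_norm m (\<lambda>x. F n x - f x) < \<epsilon>"
    using F(2) assms(2) by (rule order_tendstoD)
  ultimately obtain n where "lip_energy m (F n) < C" "L2_norm m (\<lambda>x. F n x - f x) < \<epsilon>"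
    using frequently_ex[OF frequently_eventually_frequently] by blast
  then show ?thesis using F(1) by blast
qed

lemma Ch_Lip_bs:
  assumes "f \<in> Lip_bs"
  shows "Ch m f \<le> lip_energy m f"
  using assms by (intro Ch_leI bexI[of _ f]) (auto simp: L2_norm_def L2_inner_def)

lemma Lip_bs_W12:
  assumes mm: "metric_measure_space m" and f: "f \<in> Lip_bs"
  shows "f \<in> W12 m"
  using Ch_Lip_bs[OF f, of m] lip_energy_finite[OF mm f] Lip_bs_L2[OF mm f]
  by (auto simp: W12_def)

text \<open>Lower semicontinuity under norm convergence, by approximating the approximant.
  Membership in \<open>L2 m\<close> matters for the triangle inequality: outside that space the
  integral in \<open>L2_norm\<close> may take the default value 0.\<close>

lemma Ch_lsc:
  assumes mm: "metric_measure_space m" and f: "f \<in> L2 m"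
    and approx: "\<And>\<epsilon>::real. \<epsilon> > 0 \<Longrightarrow> \<exists>g\<in>L2 m. L2_norm m (\<lambda>x. g x - f x) < \<epsilon> \<and> Ch m g \<le> C + ennreal \<epsilon>"
  shows "Ch m f \<le> C"
proof (cases "C = \<infinity>")
  case False
  show ?thesis
  proof (rule Ch_leI)
    fix \<epsilon> :: real assume "\<epsilon> > 0"
    then obtain g where g: "g \<in> L2 m" "L2_norm m (\<lambda>x. g x - f x) < \<epsilon> / 2" "Ch m g \<le> C + ennreal (\<epsilon> / 2)"
      using approx[of "\<epsilon> / 2"] by auto
    \<comment> \<open>Strict because \<open>C\<close> is finite; \<open>Ch_lessD\<close> asks for a
      strict bound.\<close>
    have "C + ennreal (\<epsilon> / 2) < C + ennreal \<epsilon>"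
      using False \<open>\<epsilon> > 0\<close> by (simp add: ennreal_less_iff)
    with g(3) have "Ch m g < C + ennreal \<epsilon>" by (rule le_less_trans)
    from Ch_lessD[OF this, of "\<epsilon> / 2"] \<open>\<epsilon> > 0\<close> obtain F where F: "F \<in> Lip_bs"
      "L2_norm m (\<lambda>x. F x - g x) < \<epsilon> / 2" "lip_energy m F < C + ennreal \<epsilon>" by auto
    have "L2_norm m (\<lambda>x. F x - f x) < \<epsilon>"
      using L2_norm_triangle_diff[OF Lip_bs_L2[OF mm F(1)] g(1) f] F(2) g(2) by simp
    with F show "\<exists>F\<in>Lip_bs. L2_norm m (\<lambda>x. F x - f x) < \<epsilon> \<and> lip_energy m F \<le> C + ennreal \<epsilon>"
      by (intro bexI[of _ F]) auto
  qed
qed simp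

section \<open>Semigroups and invariant sets\<close>

lemma contraction_semigroup_L2:
  "L2_contraction_semigroup m P \<Longrightarrow> t \<ge> 0 \<Longrightarrow> f \<in> L2 m \<Longrightarrow> P t f \<in> L2 m"
  by (simp add: L2_contraction_semigroup_def)

lemma contraction_semigroup_diff_norm:
  assumes sg: "L2_contraction_semigroup m P" and "t \<ge> 0" "f \<in> L2 m" "g \<in> L2 m"
  shows "L2_norm m (\<lambda>x. P t f x - P t g x) \<le> L2_norm m (\<lambda>x. f x - g x)"
proof -
  have contr: "\<And>f. f \<in> L2 m \<Longrightarrow> L2_norm m (P t f) \<le> L2_norm m f"
    and lin: "\<And>a b. AE x in m. P t (\<lambda>y. a * f y + b * g y) x = a * P t f x + b * P t g x"
    using assms by (auto simp: L2_contraction_semigroup_def)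
  have "L2_norm m (\<lambda>x. P t f x - P t g x) = L2_norm m (P t (\<lambda>y. f y - g y))"
    using lin[of 1 "-1"] assms
    by (intro L2_norm_cong_AE L2_measurable contraction_semigroup_L2[OF sg] L2_diff) (auto elim!: eventually_mono)
  also have "\<dots> \<le> L2_norm m (\<lambda>x. f x - g x)" by (intro contr L2_diff assms)
  finally show ?thesis .
qed

context
  fixes m :: "'a measure" and P :: "real \<Rightarrow> ('a \<Rightarrow> real) \<Rightarrow> 'a \<Rightarrow> real" and A :: "'a set"
  assumes sg: "L2_contraction_semigroup m P"
    and A: "A \<in> sets (completion m)"
    and inv: "invariant_set m P A"
begin

text \<open>Invariance speaks of bounded functions, the generator of square integrable ones.
  Truncations lie in both spaces, where \<open>P\<close> is one and the same family, and
  contractivity passes the identity to the limit. Equality almost everywhere is recorded as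
  vanishing norm, the form in which difference quotients use it.\<close>

lemma P_indicator_commute:
  assumes t: "t > 0" and u: "u \<in> L2 m"
  shows "L2_norm m (\<lambda>x. P t (\<lambda>y. indicator A y * u y) x - indicator A x * P t u x) = 0"
proof -
  define w where "w n x = max (- real n) (min (real n) (u x))" for n x
  have [measurable]: "u \<in> borel_measurable (completion m)" by (rule L2_measurable[OF u])
  have [measurable]: "w n \<in> borel_measurable (completion m)" for n unfolding w_def by measurable
  have w: "w n \<in> L2 m" for n
    by (rule L2_bound[OF u]) (auto simp: w_def max_def min_def intro!: AE_I2)
  have winf: "w n \<in> Linf m" for n
    unfolding Linf_def by (auto intro!: exI[of _ "real n"] AE_I2) (auto simp: w_def)
  let ?iu = "\<lambda>y. indicator A y * u y" and ?iw = "\<lambda>n y. indicator A y * w n y"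
  note L = L2_indicator[OF A]
  have t0: "t \<ge> 0" using t by simp
  have le: "L2_norm m (\<lambda>x. P t ?iu x - indicator A x * P t u x) \<le> 2 * L2_norm m (\<lambda>x. u x - w n x)" for n
  proof -
    have 1: "L2_norm m (\<lambda>x. P t ?iu x - P t (?iw n) x) \<le> L2_norm m (\<lambda>x. u x - w n x)"
    proof -
      have "L2_norm m (\<lambda>x. P t ?iu x - P t (?iw n) x) \<le> L2_norm m (\<lambda>x. ?iu x - ?iw n x)"
        by (intro contraction_semigroup_diff_norm[OF sg] t0 L u w)
      also have "\<dots> = L2_norm m (\<lambda>x. indicator A x * (u x - w n x))" by (simp add: algebra_simps)
      also have "\<dots> \<le> L2_norm m (\<lambda>x. u x - w n x)" by (intro L2_norm_indicator_le[OF A] L2_diff u w)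
      finally show ?thesis .
    qed
    have "AE x in m. indicator A x * P t (w n) x = P t (?iw n) x"
      using inv winf[of n] t unfolding invariant_set_def by blast
    then have "L2_norm m (\<lambda>x. P t (?iw n) x - indicator A x * P t u x)
      = L2_norm m (\<lambda>x. indicator A x * (P t (w n) x - P t u x))"
      by (intro L2_norm_cong_AE L2_measurable L L2_diff contraction_semigroup_L2[OF sg] t0 u w) (auto elim!: eventually_mono simp: algebra_simps)
    also have "\<dots> \<le> L2_norm m (\<lambda>x. P t (w n) x - P t u x)"
      by (intro L2_norm_indicator_le[OF A] L2_diff contraction_semigroup_L2[OF sg] t0 u w)
    also have "\<dots> \<le> L2_norm m (\<lambda>x. w n x - u x)" by (intro contraction_semigroup_diff_norm[OF sg] t0 u w)
    also have "\<dots> = L2_norm m (\<lambda>x. u x - w n x)" by (rule L2_norm_minus_commute)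
    finally have 2: "L2_norm m (\<lambda>x. P t (?iw n) x - indicator A x * P t u x) \<le> L2_norm m (\<lambda>x. u x - w n x)" .
    have "L2_norm m (\<lambda>x. P t ?iu x - indicator A x * P t u x)
      \<le> L2_norm m (\<lambda>x. P t ?iu x - P t (?iw n) x) + L2_norm m (\<lambda>x. P t (?iw n) x - indicator A x * P t u x)"
      by (intro L2_norm_triangle_diff contraction_semigroup_L2[OF sg] L t0 u w)
    with 1 2 show ?thesis by linarith
  qed
  have "(\<lambda>n. 2 * L2_norm m (\<lambda>x. u x - w n x)) \<longlonglongrightarrow> 0"
    using tendsto_mult_right_zero[OF truncation_converges[OF u], of 2] by (simp add: w_def)
  then have "L2_norm m (\<lambda>x. P t ?iu x - indicator A x * P t u x) \<le> 0"
    by (rule LIMSEQ_le_const) (auto intro: le)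
  then show ?thesis using L2_norm_nonneg by (intro antisym)
qed

text \<open>Difference quotients commute with multiplication by \<open>indicator A\<close> up to a
  function of norm zero, and this multiplication does not increase norms.\<close>

lemma semigroup_generator_indicator:
  assumes "semigroup_generator m P u h"
  shows "semigroup_generator m P (\<lambda>x. indicator A x * u x) (\<lambda>x. indicator A x * h x)"
proof -
  from assms have u: "u \<in> L2 m" and h: "h \<in> L2 m"
    and lim: "((\<lambda>t. L2_norm m (\<lambda>x. (P t u x - u x) / t - h x)) \<longlongrightarrow> 0) (at_right 0)"
    by (auto simp: semigroup_generator_def)
  let ?iu = "\<lambda>y. indicator A y * u y" and ?ih = "\<lambda>y. indicator A y * h y"
  note L = L2_indicator[OF A]
  have q: "(\<lambda>x. (P t u x - u x) / t - h x) \<in> L2 m" if "t > 0" for t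
    using L2_diff[OF L2_scale[OF L2_diff[OF contraction_semigroup_L2[OF sg less_imp_le[OF that] u] u], of "1/t"] h] by simp
  have "L2_norm m (\<lambda>x. (P t ?iu x - ?iu x) / t - ?ih x) \<le> L2_norm m (\<lambda>x. (P t u x - u x) / t - h x)"
    if t: "t > 0" for t
  proof -
    let ?d = "\<lambda>x. P t ?iu x - indicator A x * P t u x"
    have d: "(\<lambda>x. (1 / t) * ?d x) \<in> L2 m"
      using t by (intro L2_scale L2_diff contraction_semigroup_L2[OF sg] L u) auto
    have "(\<lambda>x. (P t ?iu x - ?iu x) / t - ?ih x)
      = (\<lambda>x. (1 / t) * ?d x + indicator A x * ((P t u x - u x) / t - h x))"
      using t by (auto simp: field_simps)
    then have "L2_norm m (\<lambda>x. (P t ?iu x - ?iu x) / t - ?ih x)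
      \<le> L2_norm m (\<lambda>x. (1 / t) * ?d x) + L2_norm m (\<lambda>x. indicator A x * ((P t u x - u x) / t - h x))"
      using L2_norm_triangle[OF d L[OF q[OF t]]] by simp
    also have "\<dots> \<le> 0 + L2_norm m (\<lambda>x. (P t u x - u x) / t - h x)"
      using P_indicator_commute[OF t u] by (intro add_mono L2_norm_indicator_le[OF A] q t) (subst L2_norm_scale, simp)
    finally show ?thesis by simp
  qed
  then have "((\<lambda>t. L2_norm m (\<lambda>x. (P t ?iu x - ?iu x) / t - ?ih x)) \<longlongrightarrow> 0) (at_right 0)"
    by (intro tendsto_sandwich[OF _ _ tendsto_const lim])
      (auto simp: eventually_at_right_less L2_norm_nonneg intro!: always_eventually eventually_mono[OF eventually_at_right_less])
  then show ?thesis by (simp add: semigroup_generator_def L u h)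
qed

end

section \<open>Resolvents and the energy of restrictions to invariant sets\<close>

text \<open>\<open>enn2real\<close> sends infinity to 0, so this is the energy only on
  \<open>W12 m\<close>; there the quadratic calculus takes place in real numbers.\<close>

definition Ch_real :: "('a :: polish_space) measure \<Rightarrow> ('a \<Rightarrow> real) \<Rightarrow> real"
  where "Ch_real m f = enn2real (Ch m f)"

lemma Ch_real_nonneg: "Ch_real m f \<ge> 0"
  by (simp add: Ch_real_def)

lemma W12_L2: "f \<in> W12 m \<Longrightarrow> f \<in> L2 m"
  by (simp add: W12_def)

lemma W12_Ch: "f \<in> W12 m \<Longrightarrow> Ch m f = ennreal (Ch_real m f)"
  by (simp add: W12_def Ch_real_def)

lemma W12_I: "f \<in> L2 m \<Longrightarrow> Ch m f \<le> ennreal C \<Longrightarrow> f \<in> W12 m"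
  by (auto simp: W12_def intro: le_less_trans)

lemma zero_W12: "(\<lambda>x. 0) \<in> W12 m" and Ch_real_zero: "Ch_real m (\<lambda>x. 0) = 0"
proof -
  have "(\<lambda>x. 0) \<in> Lip_bs"
    unfolding Lip_bs_def by (auto intro!: exI[of _ 0] lipschitz_intros)
  then have "Ch m (\<lambda>x. 0) \<le> lip_energy m (\<lambda>x. 0)" by (rule Ch_Lip_bs)
  then have "Ch m (\<lambda>x. 0) = 0" by (simp add: lip_energy_def)
  then show "(\<lambda>x. 0) \<in> W12 m" "Ch_real m (\<lambda>x. 0) = 0"
    by (auto simp: W12_def Ch_real_def L2_zero)
qed

context
  fixes m :: "('a :: polish_space) measure"
  assumes mm: "metric_measure_space m"
    and hilbert: "infinitesimally_Hilbertian m"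
begin

lemma Ch_parallelogram:
  "f \<in> L2 m \<Longrightarrow> g \<in> L2 m \<Longrightarrow>
    Ch m (\<lambda>x. f x + g x) + Ch m (\<lambda>x. f x - g x) = 2 * Ch m f + 2 * Ch m g"
  using hilbert unfolding infinitesimally_Hilbertian_def by blast

text \<open>Both terms on the left of the parallelogram law are bounded by its finite right-hand
  side. Finiteness has to be settled in the extended reals before the law can be read in real
  numbers.\<close>

lemma W12_add_diff:
  assumes "f \<in> W12 m" "g \<in> W12 m"
  shows W12_add: "(\<lambda>x. f x + g x) \<in> W12 m"
    and W12_diff: "(\<lambda>x. f x - g x) \<in> W12 m"
    and Ch_real_parallelogram:
      "Ch_real m (\<lambda>x. f x + g x) + Ch_real m (\<lambda>x. f x - g x) = 2 * Ch_real m f + 2 * Ch_real m g"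
proof -
  have par: "Ch m (\<lambda>x. f x + g x) + Ch m (\<lambda>x. f x - g x) = 2 * ennreal (Ch_real m f) + 2 * ennreal (Ch_real m g)"
    using Ch_parallelogram[OF W12_L2 W12_L2, OF assms] assms by (simp add: W12_Ch)
  also have "\<dots> = ennreal (2 * Ch_real m f + 2 * Ch_real m g)"
    by (simp add: Ch_real_nonneg ennreal_mult)
  finally have par: "Ch m (\<lambda>x. f x + g x) + Ch m (\<lambda>x. f x - g x) = ennreal (2 * Ch_real m f + 2 * Ch_real m g)" .
  have "Ch m (\<lambda>x. f x + g x) \<le> ennreal (2 * Ch_real m f + 2 * Ch_real m g)"
    "Ch m (\<lambda>x. f x - g x) \<le> ennreal (2 * Ch_real m f + 2 * Ch_real m g)"
    unfolding par[symmetric] by simp_all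
  then show W: "(\<lambda>x. f x + g x) \<in> W12 m" "(\<lambda>x. f x - g x) \<in> W12 m"
    by (auto intro: W12_I[OF L2_add[OF assms[THEN W12_L2]]] W12_I[OF L2_diff[OF assms[THEN W12_L2]]])
  show "Ch_real m (\<lambda>x. f x + g x) + Ch_real m (\<lambda>x. f x - g x) = 2 * Ch_real m f + 2 * Ch_real m g"
  proof -
    have "ennreal (Ch_real m (\<lambda>x. f x + g x) + Ch_real m (\<lambda>x. f x - g x))
        = ennreal (2 * Ch_real m f + 2 * Ch_real m g)"
      unfolding par[symmetric] W12_Ch[OF W(1)] W12_Ch[OF W(2)] by (simp add: Ch_real_nonneg)
    then show ?thesis by (subst (asm) ennreal_inj) (auto intro!: add_nonneg_nonneg Ch_real_nonneg)
  qed
qed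

text \<open>The parallelogram law for the pair \<open>f / 2\<close>, \<open>f / 2\<close>. Apart
  from symmetry under negation, this is the only homogeneity of \<open>Ch\<close> that enters the
  proof.\<close>

lemma W12_half:
  assumes "f \<in> W12 m"
  shows "(\<lambda>x. f x / 2) \<in> W12 m" and Ch_real_half: "Ch_real m (\<lambda>x. f x / 2) = Ch_real m f / 4"
proof -
  have L: "(\<lambda>x. f x / 2) \<in> L2 m" using L2_scale[OF W12_L2[OF assms], of "1/2"] by simp
  have "2 * Ch m (\<lambda>x. f x / 2) \<le> 2 * Ch m (\<lambda>x. f x / 2) + 2 * Ch m (\<lambda>x. f x / 2)" by simp
  also have "\<dots> = Ch m f + Ch m (\<lambda>x. 0)" using Ch_parallelogram[OF L L] by simp
  also have "\<dots> = ennreal (Ch_real m f)" using W12_Ch[OF assms] W12_Ch[OF zero_W12] by (simp add: Ch_real_zero)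
  also have "\<dots> < \<top>" by simp
  finally have "Ch m (\<lambda>x. f x / 2) < \<top>" by (auto simp: ennreal_mult_less_top)
  then show W: "(\<lambda>x. f x / 2) \<in> W12 m" using L by (simp add: W12_def)
  show "Ch_real m (\<lambda>x. f x / 2) = Ch_real m f / 4"
    using Ch_real_parallelogram[OF W W] by (simp add: Ch_real_zero)
qed

text \<open>Its minimiser over \<open>W12 m\<close> is \<open>c\<close> times the resolvent at
  \<open>c\<close> of the generator, applied to \<open>f\<close>: the Euler-Lagrange equation says
  that the generator sends \<open>v\<close> to \<open>c * (v - f)\<close>.\<close>

definition resolvent_functional :: "real \<Rightarrow> ('a \<Rightarrow> real) \<Rightarrow> ('a \<Rightarrow> real) \<Rightarrow> real"
  where "resolvent_functional c f w = Ch_real m w + c * (L2_norm m (\<lambda>x. w x - f x))\<^sup>2"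

text \<open>Uniform convexity: from the energy only convexity along midpoints is kept, while the
  quadratic term contributes a gain in \<open>v - w\<close>. This gain makes minimising sequences
  Cauchy.\<close>

lemma resolvent_functional_midpoint:
  assumes "f \<in> L2 m" "v \<in> W12 m" "w \<in> W12 m"
  shows "(\<lambda>x. v x / 2 + w x / 2) \<in> W12 m"
    and "resolvent_functional c f (\<lambda>x. v x / 2 + w x / 2)
      \<le> (resolvent_functional c f v + resolvent_functional c f w) / 2
        - c * (L2_norm m (\<lambda>x. v x - w x))\<^sup>2 / 4"
proof -
  note h = W12_half(1)[OF assms(2)] W12_half(1)[OF assms(3)]
  show "(\<lambda>x. v x / 2 + w x / 2) \<in> W12 m" by (intro W12_add h)
  have "Ch_real m (\<lambda>x. v x / 2 + w x / 2) + Ch_real m (\<lambda>x. v x / 2 - w x / 2) = Ch_real m v / 2 + Ch_real m w / 2"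
    using Ch_real_parallelogram[OF h] Ch_real_half[OF assms(2)] Ch_real_half[OF assms(3)] by simp
  moreover have "Ch_real m (\<lambda>x. v x / 2 - w x / 2) \<ge> 0" by (rule Ch_real_nonneg)
  ultimately have 1: "Ch_real m (\<lambda>x. v x / 2 + w x / 2) \<le> Ch_real m v / 2 + Ch_real m w / 2" by linarith
  have L: "(\<lambda>x. v x - f x) \<in> L2 m" "(\<lambda>x. w x - f x) \<in> L2 m"
    by (intro L2_diff W12_L2 assms)+
  have e: "(\<lambda>x. v x / 2 + w x / 2 - f x) = (\<lambda>x. (1/2) * (v x - f x) + (1/2) * (w x - f x))"
    "(\<lambda>x. v x - w x) = (\<lambda>x. 1 * (v x - f x) + (-1) * (w x - f x))"
    by (auto simp: field_simps)
  have 2: "(L2_norm m (\<lambda>x. v x / 2 + w x / 2 - f x))\<^sup>2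
    = ((L2_norm m (\<lambda>x. v x - f x))\<^sup>2 + (L2_norm m (\<lambda>x. w x - f x))\<^sup>2) / 2 - (L2_norm m (\<lambda>x. v x - w x))\<^sup>2 / 4"
    unfolding e L2_norm_square_lincomb[OF L] by (simp add: power_divide field_simps)
  show "resolvent_functional c f (\<lambda>x. v x / 2 + w x / 2)
      \<le> (resolvent_functional c f v + resolvent_functional c f w) / 2
        - c * (L2_norm m (\<lambda>x. v x - w x))\<^sup>2 / 4"
    unfolding resolvent_functional_def 2 using 1 by (simp add: field_simps)
qed

text \<open>The direct method with convexity in place of compactness: a minimising sequence
  converges in norm, and lower semicontinuity of \<open>Ch\<close> bounds the energy of its
  limit.\<close>

lemma resolvent_minimiser_exists:
  assumes f: "f \<in> L2 m" and c: "c > 0"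
  shows "\<exists>v\<in>W12 m. \<forall>w\<in>W12 m. resolvent_functional c f v \<le> resolvent_functional c f w"
proof -
  let ?J = "resolvent_functional c f"
  define I where "I = Inf (?J ` W12 m)"
  have bdd: "bdd_below (?J ` W12 m)"
    using c by (intro bdd_belowI[of _ 0]) (auto simp: resolvent_functional_def Ch_real_nonneg)
  have ne: "?J ` W12 m \<noteq> {}" using zero_W12 by blast
  have I_le: "I \<le> ?J w" if "w \<in> W12 m" for w
    unfolding I_def using that bdd by (intro cInf_lower) auto
  have "\<forall>n. \<exists>w\<in>W12 m. ?J w < I + 1 / real (Suc n)"
  proof
    fix n
    have "Inf (?J ` W12 m) < I + 1 / real (Suc n)" by (simp add: I_def)
    from cInf_lessD[OF ne this] show "\<exists>w\<in>W12 m. ?J w < I + 1 / real (Suc n)" by blast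
  qed
  then obtain w where w: "\<And>n. w n \<in> W12 m" "\<And>n. ?J (w n) < I + 1 / real (Suc n)" by metis
  have dist_est: "c * (L2_norm m (\<lambda>x. w i x - w j x))\<^sup>2 \<le> 4 * \<delta>"
    if "?J (w i) \<le> I + \<delta>" "?J (w j) \<le> I + \<delta>" for i j \<delta>
  proof -
    have "I \<le> (?J (w i) + ?J (w j)) / 2 - c * (L2_norm m (\<lambda>x. w i x - w j x))\<^sup>2 / 4"
      using I_le resolvent_functional_midpoint[OF f w(1)[of i] w(1)[of j]] by (meson order_trans)
    then show ?thesis using that by argo
  qed
  have "\<exists>v\<in>L2 m. (\<lambda>n. L2_norm m (\<lambda>x. w n x - v x)) \<longlonglongrightarrow> 0"
  proof (rule L2_complete)
    show "w n \<in> L2 m" for n using w W12_L2 by blast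
    fix \<epsilon> :: real assume "\<epsilon> > 0"
    \<comment> \<open>This is the excess over \<open>I\<close> for which \<open>dist_est\<close>
      returns the distance \<epsilon>.\<close>
    then have "c * \<epsilon>\<^sup>2 / 4 > 0" using c by simp
    then obtain M where M: "1 / real (Suc M) < c * \<epsilon>\<^sup>2 / 4" using nat_approx_posE by blast
    have "L2_norm m (\<lambda>x. w i x - w j x) \<le> \<epsilon>" if "i \<ge> M" "j \<ge> M" for i j
    proof -
      have "?J (w k) \<le> I + c * \<epsilon>\<^sup>2 / 4" if "k \<ge> M" for k
      proof -
        have "1 / real (Suc k) \<le> 1 / real (Suc M)" using that by (intro divide_left_mono) auto
        then show ?thesis using w(2)[of k] M by linarith
      qed
      from dist_est[OF this this, OF that] have "(L2_norm m (\<lambda>x. w i x - w j x))\<^sup>2 \<le> \<epsilon>\<^sup>2"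
        using c by simp
      then show ?thesis using \<open>\<epsilon> > 0\<close> power2_le_imp_le less_imp_le by blast
    qed
    then show "\<exists>M. \<forall>i\<ge>M. \<forall>j\<ge>M. L2_norm m (\<lambda>x. w i x - w j x) \<le> \<epsilon>" by blast
  qed
  then obtain v where v: "v \<in> L2 m" and lim: "(\<lambda>n. L2_norm m (\<lambda>x. w n x - v x)) \<longlonglongrightarrow> 0" by blast
  \<comment> \<open>The limit of the upper bounds for the energies of \<open>w n\<close>. Energy at
    most \<open>a\<close> is exactly what makes the value of the functional at \<open>v\<close> at
    most \<open>I\<close>.\<close>
  define a where "a = I - c * (L2_norm m (\<lambda>x. v x - f x))\<^sup>2"
  have norm_lim: "(\<lambda>n. L2_norm m (\<lambda>x. w n x - f x)) \<longlonglongrightarrow> L2_norm m (\<lambda>x. v x - f x)"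
  proof (rule Lim_transform2[OF tendsto_const])
    have "\<bar>L2_norm m (\<lambda>x. v x - f x) - L2_norm m (\<lambda>x. w n x - f x)\<bar> \<le> L2_norm m (\<lambda>x. w n x - v x)" for n
      using L2_norm_triangle_diff[OF v W12_L2[OF w(1)] f, of n]
        L2_norm_triangle_diff[OF W12_L2[OF w(1)] v f, of n] L2_norm_minus_commute[of m v "w n"]
      by linarith
    then show "(\<lambda>n. L2_norm m (\<lambda>x. v x - f x) - L2_norm m (\<lambda>x. w n x - f x)) \<longlonglongrightarrow> 0"
      by (intro tendsto_rabs_zero_cancel[OF tendsto_sandwich[OF _ _ tendsto_const lim]])
        (auto intro!: always_eventually)
  qed
  have "(\<lambda>n. I + 1 / real (Suc n) - c * (L2_norm m (\<lambda>x. w n x - f x))\<^sup>2) \<longlonglongrightarrow> I + 0 - c * (L2_norm m (\<lambda>x. v x - f x))\<^sup>2"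
    by (intro tendsto_intros norm_lim LIMSEQ_Suc[OF lim_1_over_n])
  then have "(\<lambda>n. I + 1 / real (Suc n) - c * (L2_norm m (\<lambda>x. w n x - f x))\<^sup>2) \<longlonglongrightarrow> a"
    by (simp add: a_def)
  note alim = this
  have appr: "\<exists>n. L2_norm m (\<lambda>x. w n x - v x) < \<epsilon> \<and> Ch_real m (w n) \<le> a + \<epsilon>" if "\<epsilon> > 0" for \<epsilon>
  proof -
    have "\<forall>\<^sub>F n in sequentially. I + 1 / real (Suc n) - c * (L2_norm m (\<lambda>x. w n x - f x))\<^sup>2 < a + \<epsilon>"
      using alim that by (intro order_tendstoD) auto
    moreover have "\<forall>\<^sub>F n in sequentially. L2_norm m (\<lambda>x. w n x - v x) < \<epsilon>"
      using lim that by (rule order_tendstoD)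
    ultimately have "\<forall>\<^sub>F n in sequentially. L2_norm m (\<lambda>x. w n x - v x) < \<epsilon> \<and> Ch_real m (w n) \<le> a + \<epsilon>"
    proof eventually_elim
      case (elim n)
      then show ?case using w(2)[of n] unfolding resolvent_functional_def by linarith
    qed
    then show ?thesis by (auto simp: eventually_sequentially)
  qed
  \<comment> \<open>Otherwise \<open>ennreal a\<close> would be 0, and the bound on
    \<open>Ch m v\<close> would not yield one by \<open>a\<close>.\<close>
  have "0 \<le> a"
  proof (rule field_le_epsilon)
    fix e :: real assume "e > 0"
    then obtain n where "Ch_real m (w n) \<le> a + e" using appr by blast
    then show "0 \<le> a + e" using Ch_real_nonneg[of m "w n"] by linarith
  qed
  have "Ch m v \<le> ennreal a"
  proof (rule Ch_lsc[OF mm v])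
    fix \<epsilon> :: real assume "\<epsilon> > 0"
    then obtain n where n: "L2_norm m (\<lambda>x. w n x - v x) < \<epsilon>" "Ch_real m (w n) \<le> a + \<epsilon>" using appr by blast
    have "Ch m (w n) \<le> ennreal a + ennreal \<epsilon>"
      using n(2) \<open>0 \<le> a\<close> \<open>\<epsilon> > 0\<close> unfolding W12_Ch[OF w(1)]
      by (simp add: ennreal_plus[symmetric] ennreal_leI del: ennreal_plus)
    then show "\<exists>g\<in>L2 m. L2_norm m (\<lambda>x. g x - v x) < \<epsilon> \<and> Ch m g \<le> ennreal a + ennreal \<epsilon>"
      using n w(1) W12_L2 by blast
  qed
  then have vW: "v \<in> W12 m" and "Ch_real m v \<le> a"
    using W12_I[OF v] W12_Ch[of v m] \<open>0 \<le> a\<close> by auto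
  then have "?J v \<le> I" by (simp add: resolvent_functional_def a_def)
  then show ?thesis using vW I_le by (meson order_trans)
qed

text \<open>The first variation \<open>\<alpha>\<close> is only known to be homogeneous under halving and negation, by the
  parallelogram law. Its lower bound \<open>- N\<close> is quadratic, so iterated halving forces \<open>\<alpha> = 0\<close>.\<close>

lemma resolvent_form_generator:
  assumes f: "f \<in> L2 m" and v: "v \<in> W12 m"
    and min: "\<And>w. w \<in> W12 m \<Longrightarrow> resolvent_functional c f v \<le> resolvent_functional c f w"
  shows "form_generator m v (\<lambda>x. c * (v x - f x))"
proof -
  \<comment> \<open>Twice the Euler-Lagrange expression: by the parallelogram law the energy
    differences amount to \<open>2 * Dirichlet_form m v g\<close>.\<close>
  define \<alpha> where "\<alpha> g = Ch_real m (\<lambda>x. v x + g x) - Ch_real m v - Ch_real m g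
    + 2 * c * L2_inner m (\<lambda>x. v x - f x) g" for g
  define N where "N g = Ch_real m g + c * (L2_norm m g)\<^sup>2" for g
  have vf: "(\<lambda>x. v x - f x) \<in> L2 m" by (intro L2_diff W12_L2 v f)
  have lower: "- N g \<le> \<alpha> g" if g: "g \<in> W12 m" for g
  proof -
    have "(L2_norm m (\<lambda>x. v x + g x - f x))\<^sup>2
        = (L2_norm m (\<lambda>x. v x - f x))\<^sup>2 + (L2_norm m g)\<^sup>2 + 2 * L2_inner m (\<lambda>x. v x - f x) g"
      using L2_norm_square_lincomb[OF vf W12_L2[OF g], of 1 1] by (simp add: algebra_simps)
    then show ?thesis
      using min[OF W12_add[OF v g]] unfolding resolvent_functional_def \<alpha>_def N_def
      by (simp add: algebra_simps)
  qed
  have half: "\<alpha> g = 2 * \<alpha> (\<lambda>x. g x / 2)" "N (\<lambda>x. g x / 2) = N g / 4" if g: "g \<in> W12 m" for g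
  proof -
    note h = W12_half(1)[OF g]
    \<comment> \<open>The law for the pair \<open>v + g / 2\<close>, \<open>g / 2\<close> links the
      variation along \<open>g\<close> to the one along \<open>g / 2\<close>.\<close>
    have "Ch_real m (\<lambda>x. v x + g x / 2 + g x / 2) + Ch_real m (\<lambda>x. v x + g x / 2 - g x / 2)
        = 2 * Ch_real m (\<lambda>x. v x + g x / 2) + 2 * Ch_real m (\<lambda>x. g x / 2)"
      by (rule Ch_real_parallelogram[OF W12_add[OF v h] h])
    moreover have "L2_inner m (\<lambda>x. v x - f x) (\<lambda>x. g x / 2) = L2_inner m (\<lambda>x. v x - f x) g / 2"
      using L2_inner_lincomb[OF W12_L2[OF g] W12_L2[OF g] vf, of "1/2" 0]
      by (simp add: L2_inner_commute)
    ultimately show "\<alpha> g = 2 * \<alpha> (\<lambda>x. g x / 2)"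
      using Ch_real_half[OF g] by (simp add: \<alpha>_def algebra_simps)
    show "N (\<lambda>x. g x / 2) = N g / 4"
    proof -
      have "L2_norm m (\<lambda>x. g x / 2) = L2_norm m g / 2" using L2_norm_scale[of m "1/2" g] by simp
      then show ?thesis
        using Ch_real_half[OF g] unfolding N_def by (simp only: power_divide add_divide_distrib) simp
    qed
  qed
  have lower_k: "- N g / 2 ^ k \<le> \<alpha> g" if "g \<in> W12 m" for g k
    using that
  proof (induction k arbitrary: g)
    case 0
    then show ?case using lower by simp
  next
    case (Suc k)
    have "- N (\<lambda>x. g x / 2) / 2 ^ k \<le> \<alpha> (\<lambda>x. g x / 2)"
      using Suc.IH[OF W12_half(1)[OF Suc.prems]] .
    then show ?case unfolding half(1)[OF Suc.prems] half(2)[OF Suc.prems] by (simp add: field_simps)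
  qed
  have nonneg: "0 \<le> \<alpha> g" if "g \<in> W12 m" for g
  proof (rule LIMSEQ_le_const2)
    show "(\<lambda>k. - N g / 2 ^ k) \<longlonglongrightarrow> 0"
      using tendsto_mult_right_zero[OF LIMSEQ_power_zero[of "1/2::real"], of "- N g"] by (simp add: power_one_over)
    show "\<exists>N0. \<forall>n\<ge>N0. - N g / 2 ^ n \<le> \<alpha> g" using lower_k[OF that] by blast
  qed
  have "Dirichlet_form m v g = - L2_inner m (\<lambda>x. c * (v x - f x)) g" if g: "g \<in> W12 m" for g
  proof -
    have neg: "(\<lambda>x. 0 - g x) \<in> W12 m" by (rule W12_diff[OF zero_W12 g])
    have 1: "Ch_real m (\<lambda>x. 0 - g x) = Ch_real m g"
      using Ch_real_parallelogram[OF zero_W12 g] by (simp add: Ch_real_zero)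
    have 2: "L2_inner m (\<lambda>x. v x - f x) (\<lambda>x. 0 - g x) = - L2_inner m (\<lambda>x. v x - f x) g"
      using L2_inner_lincomb[OF W12_L2[OF g] W12_L2[OF g] vf, of "-1" 0]
      by (simp add: L2_inner_commute)
    note par = Ch_real_parallelogram[OF v g]
    \<comment> \<open>Oddness of \<alpha> turns nonnegativity in both directions into the
      equation.\<close>
    have "\<alpha> (\<lambda>x. 0 - g x) = - \<alpha> g"
      using par 1 2 by (simp add: \<alpha>_def)
    then have "\<alpha> g = 0" using nonneg[OF g] nonneg[OF neg] by linarith
    moreover have "L2_inner m (\<lambda>x. c * (v x - f x)) g = c * L2_inner m (\<lambda>x. v x - f x) g"
      using L2_inner_lincomb[OF vf vf W12_L2[OF g], of c 0] by simp
    ultimately show ?thesis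
      using par by (simp add: Dirichlet_form_def Ch_real_def[symmetric] \<alpha>_def)
  qed
  then show ?thesis
    unfolding form_generator_def using v L2_scale[OF vf] by blast
qed

text \<open>The generator takes \<open>indicator A * v\<close> to \<open>indicator A * h\<close>,
  which vanishes wherever \<open>v - indicator A * v\<close> does not. The two pieces of
  \<open>v\<close> are thus orthogonal for the form, and their energies add up to that of
  \<open>v\<close>.\<close>

lemma Ch_indicator_generator:
  assumes heat: "heat_semigroup m P" and A: "A \<in> sets (completion m)" and inv: "invariant_set m P A"
    and gen_v: "form_generator m v h"
  shows "Ch m (\<lambda>x. indicator A x * v x) \<le> Ch m v"
proof -
  have gen: "\<And>f h. semigroup_generator m P f h \<longleftrightarrow> form_generator m f h"
    and sg: "L2_contraction_semigroup m P"
    using heat by (simp_all add: heat_semigroup_def)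
  let ?a = "\<lambda>x. indicator A x * v x" and ?ih = "\<lambda>x. indicator A x * h x"
  let ?b = "\<lambda>x. v x - indicator A x * v x"
  have v: "v \<in> W12 m" using gen_v by (simp add: form_generator_def)
  have "form_generator m ?a ?ih" using semigroup_generator_indicator[OF sg A inv] gen_v gen by blast
  then have a: "?a \<in> W12 m" and eq: "\<And>g. g \<in> W12 m \<Longrightarrow> Dirichlet_form m ?a g = - L2_inner m ?ih g"
    by (auto simp: form_generator_def)
  have b: "?b \<in> W12 m" by (rule W12_diff[OF v a])
  have "(\<lambda>x. ?ih x * ?b x) = (\<lambda>x. 0)" by (auto simp: indicator_def)
  then have "L2_inner m ?ih ?b = 0" unfolding L2_inner_def by (simp only:) simp
  then have "Dirichlet_form m ?a ?b = 0" using eq[OF b] by simp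
  then have "Ch_real m (\<lambda>x. ?a x + ?b x) = Ch_real m (\<lambda>x. ?a x - ?b x)"
    by (simp add: Dirichlet_form_def Ch_real_def)
  then have "Ch_real m v = Ch_real m ?a + Ch_real m ?b"
    using Ch_real_parallelogram[OF a b] by simp
  then show ?thesis
    unfolding W12_Ch[OF v] W12_Ch[OF a] using Ch_real_nonneg[of m ?b] by (intro ennreal_leI) simp
qed

lemma Ch_indicator_le:
  assumes heat: "heat_semigroup m P" and A: "A \<in> sets (completion m)" and inv: "invariant_set m P A"
    and f: "f \<in> W12 m"
  shows "Ch m (\<lambda>x. indicator A x * f x) \<le> Ch m f"
proof (rule Ch_lsc[OF mm])
  note fL = W12_L2[OF f]
  show "(\<lambda>x. indicator A x * f x) \<in> L2 m" by (rule L2_indicator[OF A fL])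
  fix \<epsilon> :: real assume \<epsilon>: "\<epsilon> > 0"
  \<comment> \<open>The competitor \<open>f\<close> bounds \<open>c\<close> times the squared
    distance of the minimiser from \<open>f\<close> by the energy of \<open>f\<close>, so this
    \<open>c\<close> keeps the distance below \<epsilon>. The \<open>+ 1\<close> makes
    \<open>c\<close> positive and the inequality strict even when \<open>f\<close> has energy
    0.\<close>
  define c where "c = (Ch_real m f + 1) / \<epsilon>\<^sup>2"
  have c: "c > 0" using \<epsilon> Ch_real_nonneg[of m f] by (simp add: c_def)
  obtain v where v: "v \<in> W12 m" and min: "\<And>w. w \<in> W12 m \<Longrightarrow> resolvent_functional c f v \<le> resolvent_functional c f w"
    using resolvent_minimiser_exists[OF fL c] by blast
  note vL = W12_L2[OF v]
  have "L2_norm m (\<lambda>x. 0) = 0" by (simp add: L2_norm_def L2_inner_def)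
  then have J: "Ch_real m v + c * (L2_norm m (\<lambda>x. v x - f x))\<^sup>2 \<le> Ch_real m f"
    using min[OF f] by (simp add: resolvent_functional_def)
  moreover have "0 \<le> c * (L2_norm m (\<lambda>x. v x - f x))\<^sup>2" using c by simp
  ultimately have 1: "Ch_real m v \<le> Ch_real m f" by linarith
  have "c * (L2_norm m (\<lambda>x. v x - f x))\<^sup>2 < c * \<epsilon>\<^sup>2"
    using J Ch_real_nonneg[of m v] \<epsilon> by (simp add: c_def)
  then have 2: "L2_norm m (\<lambda>x. v x - f x) < \<epsilon>"
    using c \<epsilon> power_less_imp_less_base[of "L2_norm m (\<lambda>x. v x - f x)" 2 \<epsilon>] by simp
  have "L2_norm m (\<lambda>x. indicator A x * v x - indicator A x * f x) = L2_norm m (\<lambda>x. indicator A x * (v x - f x))"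
    by (simp add: algebra_simps)
  also have "\<dots> \<le> L2_norm m (\<lambda>x. v x - f x)" by (intro L2_norm_indicator_le[OF A] L2_diff vL fL)
  finally have "L2_norm m (\<lambda>x. indicator A x * v x - indicator A x * f x) < \<epsilon>" using 2 by simp
  moreover have "Ch m (\<lambda>x. indicator A x * v x) \<le> Ch m f + ennreal \<epsilon>"
  proof -
    have "Ch m (\<lambda>x. indicator A x * v x) \<le> Ch m v"
      by (rule Ch_indicator_generator[OF heat A inv resolvent_form_generator[OF fL v min]])
    also have "\<dots> \<le> Ch m f" unfolding W12_Ch[OF v] W12_Ch[OF f] by (rule ennreal_leI[OF 1])
    finally show ?thesis by (rule order_trans) simp
  qed
  ultimately show "\<exists>g\<in>L2 m. L2_norm m (\<lambda>x. g x - indicator A x * f x) < \<epsilon> \<and> Ch m g \<le> Ch m f + ennreal \<epsilon>"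
    by (intro bexI[OF _ L2_indicator[OF A vL]] conjI)
qed

end

section \<open>Approximations with small slope\<close>

text \<open>Slopes of Lipschitz functions are finite, so for them nothing is lost, and differences
  of slopes can be measured in \<open>L2 m\<close>.\<close>

definition real_slope :: "('a :: metric_space \<Rightarrow> real) \<Rightarrow> 'a \<Rightarrow> real"
  where "real_slope f x = enn2real (slope f x)"

lemma real_slope_nonneg: "real_slope f x \<ge> 0"
  by (simp add: real_slope_def)

lemma slope_eq_real_slope:
  assumes "L-lipschitz_on UNIV f"
  shows "slope f x = ennreal (real_slope f x)"
  using slope_lipschitz[OF assms, of x] unfolding real_slope_def
  by (metis ennreal_enn2real ennreal_less_top le_less_trans)

lemma real_slope_le_lipschitz:
  assumes "L-lipschitz_on UNIV f"
  shows "real_slope f x \<le> L"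
  using slope_lipschitz[OF assms, of x] lipschitz_on_nonneg[OF assms] slope_eq_real_slope[OF assms, of x]
  by simp

lemma real_slope_borel: "continuous_on UNIV f \<Longrightarrow> real_slope f \<in> borel_measurable borel"
  using slope_borel[of f] unfolding real_slope_def[abs_def] by measurable

lemma Lip_bs_lipschitz: "f \<in> Lip_bs \<Longrightarrow> \<exists>L. L-lipschitz_on UNIV f"
  by (auto simp: Lip_bs_def)

lemma Lip_bs_slope_eq: "f \<in> Lip_bs \<Longrightarrow> slope f x = ennreal (real_slope f x)"
  using slope_eq_real_slope Lip_bs_lipschitz by blast

lemma real_slope_L2:
  assumes mm: "metric_measure_space m" and f: "f \<in> Lip_bs"
  shows "real_slope f \<in> L2 m" and "lip_energy m f = ennreal ((L2_norm m (real_slope f))\<^sup>2)"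
proof -
  have e: "lip_energy m f = (\<integral>\<^sup>+x. ennreal ((real_slope f x)\<^sup>2) \<partial>m)"
    unfolding lip_energy_def by (simp add: Lip_bs_slope_eq[OF f] ennreal_power real_slope_nonneg)
  show L: "real_slope f \<in> L2 m"
    using lip_energy_finite[OF mm f] unfolding e
    by (intro L2_I_nn mms_borel_measurable[OF mm] real_slope_borel Lip_bs_continuous f)
  show "lip_energy m f = ennreal ((L2_norm m (real_slope f))\<^sup>2)"
    unfolding e by (rule L2_norm_square_nn[OF L])
qed

text \<open>Convexity of the slope at each point, inherited from the triangle inequality. The extra
  \<open>e\<close> is there because only strict upper bounds of a slope persist nearby.\<close>

lemma slope_midpoint_le:
  assumes "f \<in> Lip_bs" "g \<in> Lip_bs"
  shows "real_slope (\<lambda>x. (f x + g x) / 2) x \<le> (real_slope f x + real_slope g x) / 2"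
proof (rule field_le_epsilon)
  fix e :: real assume e: "e > 0"
  have lt: "slope h x < ennreal (real_slope h x + e)" if "h \<in> Lip_bs" for h
    unfolding Lip_bs_slope_eq[OF that] using e real_slope_nonneg[of h x] by (subst ennreal_less_iff) auto
  let ?c = "(real_slope f x + real_slope g x) / 2 + e"
  have "slope (\<lambda>x. (f x + g x) / 2) x \<le> ennreal ?c"
  proof (rule slope_leI)
    show "\<forall>\<^sub>F y in at x. \<bar>(f y + g y) / 2 - (f x + g x) / 2\<bar> \<le> ?c * dist x y"
      using slope_lessD[OF lt[OF assms(1)]] slope_lessD[OF lt[OF assms(2)]]
    proof eventually_elim
      case (elim y)
      have "\<bar>(f y + g y) / 2 - (f x + g x) / 2\<bar> \<le> (\<bar>f y - f x\<bar> + \<bar>g y - g x\<bar>) / 2" by argo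
      also have "\<dots> \<le> ((real_slope f x + e) * dist x y + (real_slope g x + e) * dist x y) / 2"
        using elim by simp
      also have "\<dots> = ?c * dist x y" by (simp add: field_simps)
      finally show ?case .
    qed
  qed
  then show "real_slope (\<lambda>x. (f x + g x) / 2) x \<le> ?c"
    unfolding Lip_bs_slope_eq[OF Lip_bs_midpoint[OF assms]]
    using e real_slope_nonneg[of f x] real_slope_nonneg[of g x] by (subst (asm) ennreal_le_iff) auto
qed

text \<open>Truncation to values between 1/4 and 3/4, shifted down so that 0 is fixed and bounded
  supports are preserved. It sends 0 to 0 and 1 to 1/2; this is where \<open>u / 2\<close> comes
  from.\<close>

definition clip :: "real \<Rightarrow> real"
  where "clip s = max (1/4) (min (3/4) s) - 1/4"

lemma clip_contraction: "\<bar>clip s - clip t\<bar> \<le> \<bar>s - t\<bar>"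
  by (auto simp: clip_def max_def min_def abs_if)

lemma clip_Lip_bs: "F \<in> Lip_bs \<Longrightarrow> (\<lambda>x. clip (F x)) \<in> Lip_bs"
  by (rule Lip_bs_contraction[where f = F]) (auto simp: clip_contraction, simp add: clip_def)

lemma real_slope_clip_le:
  assumes F: "F \<in> Lip_bs"
  shows "real_slope (\<lambda>x. clip (F x)) x \<le> real_slope F x"
proof -
  have "slope (\<lambda>x. clip (F x)) x \<le> slope F x" by (rule slope_mono) (rule clip_contraction)
  then show ?thesis
    by (simp add: Lip_bs_slope_eq F clip_Lip_bs real_slope_nonneg)
qed

text \<open>Strict inequalities persist near \<open>x\<close>, so the clipped function is constant
  in a neighbourhood.\<close>

lemma real_slope_clip_eq_0:
  assumes F: "F \<in> Lip_bs" and x: "F x < 1/4 \<or> F x > 3/4"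
  shows "real_slope (\<lambda>x. clip (F x)) x = 0"
proof -
  have o: "open {x. F x < 1/4}" "open {x. F x > 3/4}"
    using Lip_bs_continuous[OF F] by (auto intro!: open_Collect_less continuous_intros)
  have "slope (\<lambda>x. clip (F x)) x = 0"
    using x
  proof
    assume "F x < 1/4" then show ?thesis by (intro slope_eq_0[OF o(1)]) (auto simp: clip_def)
  next
    assume "F x > 3/4" then show ?thesis by (intro slope_eq_0[OF o(2)]) (auto simp: clip_def)
  qed
  then show ?thesis by (simp add: real_slope_def)
qed

text \<open>Lower semicontinuity of the energy at \<open>u\<close> in quantitative form: failure for
  every \<delta> would produce, through \<open>Ch_leI\<close>, an energy of \<open>u\<close> below
  itself.\<close>

lemma lip_energy_lower_bound:
  assumes u: "u \<in> W12 m" and \<kappa>: "\<kappa> > 0"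
  shows "\<exists>\<delta>>0. \<forall>F\<in>Lip_bs. L2_norm m (\<lambda>x. F x - u x) < \<delta> \<longrightarrow> ennreal (Ch_real m u - \<kappa>) \<le> lip_energy m F"
proof (rule ccontr)
  assume neg: "\<not> ?thesis"
  have *: "\<exists>F\<in>Lip_bs. L2_norm m (\<lambda>x. F x - u x) < \<epsilon> \<and> lip_energy m F < ennreal (Ch_real m u - \<kappa>)" if "\<epsilon> > 0" for \<epsilon>
    using neg that by (meson not_le)
  then obtain F where "lip_energy m F < ennreal (Ch_real m u - \<kappa>)" using zero_less_one by blast
  \<comment> \<open>Positivity rules out that \<open>ennreal\<close> has cut a negative difference
    off to 0.\<close>
  then have "0 < ennreal (Ch_real m u - \<kappa>)" using le_less_trans[OF zero_le] by blast
  then have pos: "Ch_real m u - \<kappa> > 0" by simp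
  have "Ch m u \<le> ennreal (Ch_real m u - \<kappa>)"
  proof (rule Ch_leI)
    fix \<epsilon> :: real assume "\<epsilon> > 0"
    from *[OF this] show "\<exists>F\<in>Lip_bs. L2_norm m (\<lambda>x. F x - u x) < \<epsilon> \<and> lip_energy m F \<le> ennreal (Ch_real m u - \<kappa>) + ennreal \<epsilon>"
      by (auto intro!: add_increasing2 intro: less_imp_le)
  qed
  then show False using W12_Ch[OF u] pos \<kappa> by simp
qed

text \<open>Parallelogram argument: midpoints of near-minimisers still have almost the energy of \<open>u\<close>, so the
  slopes of near-minimisers are close in \<open>L\<^sup>2\<close>.\<close>

lemma slopes_close:
  assumes mm: "metric_measure_space m" and u: "u \<in> W12 m" and \<kappa>: "\<kappa> > 0"
  shows "\<exists>\<delta>>0. \<forall>F\<in>Lip_bs. \<forall>G\<in>Lip_bs.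
    L2_norm m (\<lambda>x. F x - u x) < \<delta> \<longrightarrow> L2_norm m (\<lambda>x. G x - u x) < \<delta> \<longrightarrow>
    lip_energy m F < ennreal (Ch_real m u + \<kappa>) \<longrightarrow> lip_energy m G < ennreal (Ch_real m u + \<kappa>) \<longrightarrow>
    (L2_norm m (\<lambda>x. real_slope F x - real_slope G x))\<^sup>2 \<le> 8 * \<kappa>"
proof -
  obtain \<delta> where \<delta>: "\<delta> > 0" and low: "\<And>F. F \<in> Lip_bs \<Longrightarrow> L2_norm m (\<lambda>x. F x - u x) < \<delta> \<Longrightarrow>
      ennreal (Ch_real m u - \<kappa>) \<le> lip_energy m F"
    using lip_energy_lower_bound[OF u \<kappa>] by blast
  have "(L2_norm m (\<lambda>x. real_slope F x - real_slope G x))\<^sup>2 \<le> 8 * \<kappa>"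
    if F: "F \<in> Lip_bs" and G: "G \<in> Lip_bs"
      and dF: "L2_norm m (\<lambda>x. F x - u x) < \<delta>" and dG: "L2_norm m (\<lambda>x. G x - u x) < \<delta>"
      and eF: "lip_energy m F < ennreal (Ch_real m u + \<kappa>)" and eG: "lip_energy m G < ennreal (Ch_real m u + \<kappa>)"
    for F G
  proof -
    let ?M = "\<lambda>x. (F x + G x) / 2"
    note M = Lip_bs_midpoint[OF F G]
    note uL = W12_L2[OF u]
    have d: "(\<lambda>x. F x - u x) \<in> L2 m" "(\<lambda>x. G x - u x) \<in> L2 m"
      by (intro L2_diff Lip_bs_L2[OF mm] F G uL)+
    have "(\<lambda>x. ?M x - u x) = (\<lambda>x. (1/2) * (F x - u x) + (1/2) * (G x - u x))" by (auto simp: field_simps)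
    then have "L2_norm m (\<lambda>x. ?M x - u x) \<le> (1/2) * L2_norm m (\<lambda>x. F x - u x) + (1/2) * L2_norm m (\<lambda>x. G x - u x)"
      using L2_norm_triangle[OF L2_scale[OF d(1), of "1/2"] L2_scale[OF d(2), of "1/2"]]
      unfolding L2_norm_scale by simp
    then have "L2_norm m (\<lambda>x. ?M x - u x) < \<delta>" using dF dG by simp
    from low[OF M this] have "Ch_real m u - \<kappa> \<le> (L2_norm m (real_slope ?M))\<^sup>2"
      unfolding real_slope_L2(2)[OF mm M] by simp
    also have "\<dots> \<le> (L2_norm m (\<lambda>x. (1/2) * real_slope F x + (1/2) * real_slope G x))\<^sup>2"
    proof (intro power_mono L2_norm_nonneg L2_norm_mono_AE AE_I2)
      show "(\<lambda>x. (1/2) * real_slope F x + (1/2) * real_slope G x) \<in> L2 m"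
        by (intro L2_lincomb real_slope_L2[OF mm] F G)
      show "real_slope ?M \<in> borel_measurable (completion m)"
        by (intro L2_measurable real_slope_L2[OF mm] M)
      show "\<bar>real_slope ?M x\<bar> \<le> \<bar>(1/2) * real_slope F x + (1/2) * real_slope G x\<bar>" for x
        using slope_midpoint_le[OF F G, of x] real_slope_nonneg[of ?M x] by simp
    qed
    finally have mid: "Ch_real m u - \<kappa> \<le> (L2_norm m (\<lambda>x. (1/2) * real_slope F x + (1/2) * real_slope G x))\<^sup>2" .
    have "(L2_norm m (real_slope F))\<^sup>2 < Ch_real m u + \<kappa>" "(L2_norm m (real_slope G))\<^sup>2 < Ch_real m u + \<kappa>"
      using eF eG unfolding real_slope_L2(2)[OF mm F] real_slope_L2(2)[OF mm G] by (simp_all add: ennreal_less_iff)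
    \<comment> \<open>With \<open>a\<close> and \<open>b\<close> for the slopes, \<open>\<parallel>a
      - b\<parallel>\<^sup>2 = 2 \<parallel>a\<parallel>\<^sup>2 + 2 \<parallel>b\<parallel>\<^sup>2
      - 4 \<parallel>(a + b) / 2\<parallel>\<^sup>2\<close>; in the three bounds the energy of
      \<open>u\<close> cancels and \<open>8 * \<kappa>\<close> remains.\<close>
    with mid show ?thesis
      using L2_norm_square_lincomb[OF real_slope_L2(1)[OF mm F] real_slope_L2(1)[OF mm G], of 1 "-1"]
        L2_norm_square_lincomb[OF real_slope_L2(1)[OF mm F] real_slope_L2(1)[OF mm G], of "1/2" "1/2"]
      by (simp add: power_divide)
  qed
  then show ?thesis using \<delta> by blast
qed

text \<open>The slope of \<open>clip \<circ> F\<close> lives where \<open>F\<close> is at distance at least \<open>1/4\<close> from \<open>0\<close> and \<open>1\<close>, a set of small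
  measure in \<open>S\<close>. The slopes of good approximations cannot concentrate there, because they are close in
  \<open>L\<^sup>2\<close> to the bounded slope of a fixed one, \<open>G\<close>.\<close>

lemma flat_approximation:
  assumes mm: "metric_measure_space m" and u: "u \<in> W12 m"
    and flat: "\<And>x. x \<in> S \<Longrightarrow> u x = 0 \<or> u x = 1" and \<eta>: "\<eta> > 0"
  shows "\<exists>H\<in>Lip_bs. (\<integral>\<^sup>+x. ennreal ((real_slope H x)\<^sup>2) * indicator S x \<partial>m) \<le> ennreal \<eta> \<and>
    (\<integral>\<^sup>+x. ennreal ((H x - u x / 2)\<^sup>2) * indicator S x \<partial>m) \<le> ennreal \<eta>"
proof -
  note uL = W12_L2[OF u]
  \<comment> \<open>Slopes of two near-minimisers then differ by at most \<eta>/4 in square norm,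
    and the pointwise bound \<open>pt\<close> counts this twice.\<close>
  define \<kappa> where "\<kappa> = \<eta> / 32"
  have \<kappa>: "\<kappa> > 0" using \<eta> by (simp add: \<kappa>_def)
  obtain \<delta> where \<delta>: "\<delta> > 0" and close: "\<forall>F\<in>Lip_bs. \<forall>G\<in>Lip_bs.
      L2_norm m (\<lambda>x. F x - u x) < \<delta> \<longrightarrow> L2_norm m (\<lambda>x. G x - u x) < \<delta> \<longrightarrow>
      lip_energy m F < ennreal (Ch_real m u + \<kappa>) \<longrightarrow> lip_energy m G < ennreal (Ch_real m u + \<kappa>) \<longrightarrow>
      (L2_norm m (\<lambda>x. real_slope F x - real_slope G x))\<^sup>2 \<le> 8 * \<kappa>"
    using slopes_close[OF mm u \<kappa>] by blast
  have lt: "Ch m u < ennreal (Ch_real m u + \<kappa>)"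
    unfolding W12_Ch[OF u] using \<kappa> Ch_real_nonneg[of m u] by (subst ennreal_less_iff) auto
  \<comment> \<open>\<open>G\<close> is fixed before \<open>r\<close>, which depends on its
    Lipschitz constant; \<open>F\<close> is chosen after both.\<close>
  obtain G where G: "G \<in> Lip_bs" "L2_norm m (\<lambda>x. G x - u x) < \<delta>" "lip_energy m G < ennreal (Ch_real m u + \<kappa>)"
    using Ch_lessD[OF lt \<delta>] by blast
  obtain L where L: "L-lipschitz_on UNIV G" using Lip_bs_lipschitz[OF G(1)] by blast
  have L0: "L \<ge> 0" using lipschitz_on_nonneg[OF L] .
  \<comment> \<open>Chosen so that \<open>32 * L\<^sup>2 * r\<^sup>2\<close> is at most \<eta>/2 and
    \<open>r\<^sup>2\<close> at most \<eta>; \<open>L + 1\<close> serves both and covers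
    \<open>L = 0\<close>.\<close>
  define r where "r = min \<delta> (sqrt \<eta> / (8 * (L + 1)))"
  have r: "r > 0" "r \<le> \<delta>" using \<delta> \<eta> L0 by (auto simp: r_def)
  have "r * (8 * (L + 1)) \<le> sqrt \<eta>"
    using L0 by (simp add: r_def pos_le_divide_eq[symmetric])
  then have "(r * (8 * (L + 1)))\<^sup>2 \<le> (sqrt \<eta>)\<^sup>2" using r L0 by (intro power_mono) auto
  moreover have "(r * (8 * (L + 1)))\<^sup>2 = 64 * (r\<^sup>2 * (L + 1)\<^sup>2)" by algebra
  ultimately have rr: "64 * (r\<^sup>2 * (L + 1)\<^sup>2) \<le> \<eta>" using \<eta> by simp
  have "r\<^sup>2 * L\<^sup>2 \<le> r\<^sup>2 * (L + 1)\<^sup>2" "r\<^sup>2 * 1 \<le> r\<^sup>2 * (L + 1)\<^sup>2"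
    using L0 by (intro mult_left_mono; simp add: power_mono)+
  then have rL: "64 * (r\<^sup>2 * L\<^sup>2) \<le> \<eta>" and r1: "r\<^sup>2 \<le> \<eta>" using rr zero_le_power2[of r] by linarith+
  obtain F where F: "F \<in> Lip_bs" "L2_norm m (\<lambda>x. F x - u x) < r" "lip_energy m F < ennreal (Ch_real m u + \<kappa>)"
    using Ch_lessD[OF lt r(1)] by blast
  have ab: "(L2_norm m (\<lambda>x. real_slope F x - real_slope G x))\<^sup>2 \<le> 8 * \<kappa>"
    using close[rule_format, OF F(1) G(1) _ G(2) F(3) G(3)] F(2) r(2) by simp
  have Fu: "(L2_norm m (\<lambda>x. F x - u x))\<^sup>2 \<le> r\<^sup>2"
    using F(2) by (intro power_mono L2_norm_nonneg) auto
  have LL: "(\<lambda>x. real_slope F x - real_slope G x) \<in> L2 m" "(\<lambda>x. F x - u x) \<in> L2 m"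
    by (intro L2_diff real_slope_L2(1)[OF mm] Lip_bs_L2[OF mm] F G uL)+
  have [measurable]: "(\<lambda>x. real_slope F x - real_slope G x) \<in> borel_measurable (completion m)"
    "(\<lambda>x. F x - u x) \<in> borel_measurable (completion m)"
    using LL by (auto intro: L2_measurable)
  let ?H = "\<lambda>x. clip (F x)"
  \<comment> \<open>A pointwise Chebyshev inequality: where the clipped slope is not known to
    vanish, \<open>F\<close> is at least 1/4 away from \<open>u\<close>, so the contribution
    \<open>2 * L\<^sup>2\<close> of \<open>G\<close> may be multiplied by
    \<open>16 * (F x - u x)\<^sup>2\<close>.\<close>
  have pt: "(real_slope ?H x)\<^sup>2 \<le> 2 * (real_slope F x - real_slope G x)\<^sup>2 + 32 * L\<^sup>2 * (F x - u x)\<^sup>2"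
    if "x \<in> S" for x
  proof (cases "F x < 1/4 \<or> F x > 3/4")
    case True
    then show ?thesis using real_slope_clip_eq_0[OF F(1)] by simp
  next
    case False
    then have "1/4 \<le> \<bar>F x - u x\<bar>" using flat[OF that] by auto
    then have "(1/4)\<^sup>2 \<le> \<bar>F x - u x\<bar>\<^sup>2" by (intro power_mono) auto
    then have "1 \<le> 16 * (F x - u x)\<^sup>2" by (simp add: power_divide)
    then have 1: "2 * L\<^sup>2 * 1 \<le> 2 * L\<^sup>2 * (16 * (F x - u x)\<^sup>2)" by (intro mult_left_mono) auto
    have "(real_slope ?H x)\<^sup>2 \<le> (real_slope F x)\<^sup>2"
      using real_slope_clip_le[OF F(1)] by (intro power_mono real_slope_nonneg)
    also have "\<dots> \<le> 2 * (real_slope F x - real_slope G x)\<^sup>2 + 2 * (real_slope G x)\<^sup>2"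
      using zero_le_power2[of "real_slope F x - 2 * real_slope G x"] by (simp add: power2_eq_square algebra_simps)
    also have "(real_slope G x)\<^sup>2 \<le> L\<^sup>2"
      using real_slope_le_lipschitz[OF L] by (intro power_mono real_slope_nonneg)
    finally show ?thesis using 1 by simp
  qed
  have "(\<integral>\<^sup>+x. ennreal ((real_slope ?H x)\<^sup>2) * indicator S x \<partial>completion m)
    \<le> (\<integral>\<^sup>+x. 2 * ennreal ((real_slope F x - real_slope G x)\<^sup>2) + ennreal (32 * L\<^sup>2) * ennreal ((F x - u x)\<^sup>2) \<partial>completion m)"
  proof (intro nn_integral_mono)
    fix x
    have e: "2 * ennreal ((real_slope F x - real_slope G x)\<^sup>2) + ennreal (32 * L\<^sup>2) * ennreal ((F x - u x)\<^sup>2)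
      = ennreal (2 * (real_slope F x - real_slope G x)\<^sup>2 + 32 * L\<^sup>2 * (F x - u x)\<^sup>2)"
      by (simp add: ennreal_mult)
    show "ennreal ((real_slope ?H x)\<^sup>2) * indicator S x
      \<le> 2 * ennreal ((real_slope F x - real_slope G x)\<^sup>2) + ennreal (32 * L\<^sup>2) * ennreal ((F x - u x)\<^sup>2)"
      unfolding e using pt[of x] by (cases "x \<in> S") (auto intro!: ennreal_leI simp del: ennreal_plus)
  qed
  also have "\<dots> = 2 * ennreal ((L2_norm m (\<lambda>x. real_slope F x - real_slope G x))\<^sup>2)
      + ennreal (32 * L\<^sup>2) * ennreal ((L2_norm m (\<lambda>x. F x - u x))\<^sup>2)"
    by (subst nn_integral_add, measurable, subst (1 2) nn_integral_cmult, measurable)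
      (simp add: nn_integral_completion L2_norm_square_nn[OF LL(1)] L2_norm_square_nn[OF LL(2)])
  also have "\<dots> = ennreal (2 * (L2_norm m (\<lambda>x. real_slope F x - real_slope G x))\<^sup>2
      + 32 * L\<^sup>2 * (L2_norm m (\<lambda>x. F x - u x))\<^sup>2)"
    by (simp add: ennreal_mult)
  also have "\<dots> \<le> ennreal \<eta>"
  proof (rule ennreal_leI)
    have "32 * L\<^sup>2 * (L2_norm m (\<lambda>x. F x - u x))\<^sup>2 \<le> 32 * L\<^sup>2 * r\<^sup>2" by (intro mult_left_mono Fu) auto
    then show "2 * (L2_norm m (\<lambda>x. real_slope F x - real_slope G x))\<^sup>2
      + 32 * L\<^sup>2 * (L2_norm m (\<lambda>x. F x - u x))\<^sup>2 \<le> \<eta>"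
      using ab rL unfolding \<kappa>_def by (simp add: algebra_simps)
  qed
  finally have I1: "(\<integral>\<^sup>+x. ennreal ((real_slope ?H x)\<^sup>2) * indicator S x \<partial>m) \<le> ennreal \<eta>"
    by (simp add: nn_integral_completion)
  have "(\<integral>\<^sup>+x. ennreal ((?H x - u x / 2)\<^sup>2) * indicator S x \<partial>m) \<le> (\<integral>\<^sup>+x. ennreal ((F x - u x)\<^sup>2) \<partial>m)"
  proof (intro nn_integral_mono)
    fix x
    have "ennreal ((?H x - u x / 2)\<^sup>2) \<le> ennreal ((F x - u x)\<^sup>2)" if "x \<in> S"
    proof -
      have "u x / 2 = clip (u x)" using flat[OF that] by (auto simp: clip_def)
      then have "\<bar>?H x - u x / 2\<bar> \<le> \<bar>F x - u x\<bar>" using clip_contraction[of "F x" "u x"] by simp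
      then show ?thesis by (intro ennreal_leI) (simp add: abs_le_square_iff)
    qed
    then show "ennreal ((?H x - u x / 2)\<^sup>2) * indicator S x \<le> ennreal ((F x - u x)\<^sup>2)"
      by (cases "x \<in> S") auto
  qed
  also have "\<dots> \<le> ennreal \<eta>"
    unfolding L2_norm_square_nn[OF LL(2)] using Fu r1 by (intro ennreal_leI) simp
  finally have I2: "(\<integral>\<^sup>+x. ennreal ((?H x - u x / 2)\<^sup>2) * indicator S x \<partial>m) \<le> ennreal \<eta>" .
  show ?thesis using I1 I2 clip_Lip_bs[OF F(1)] by blast
qed

section \<open>Upper gradients along geodesics\<close>

text \<open>The local Lipschitz bound defines a gauge, so Henstock-Kurzweil Riemann sums of \<open>g\<close> control the
  telescoping increments of \<open>h\<close> without any differentiability.\<close>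

lemma increment_le_integral:
  fixes h g :: "real \<Rightarrow> real"
  assumes ab: "a \<le> b" and int: "(g has_integral I) {a..b}"
    and local: "\<And>t e. t \<in> {a..b} \<Longrightarrow> e > 0 \<Longrightarrow>
      \<exists>d>0. \<forall>s\<in>{a..b}. \<bar>s - t\<bar> < d \<longrightarrow> \<bar>h s - h t\<bar> \<le> (g t + e) * \<bar>s - t\<bar>"
  shows "h b - h a \<le> I"
proof (rule field_le_epsilon)
  fix e0 :: real assume e0: "e0 > 0"
  \<comment> \<open>One \<open>e\<close> is spent on the Riemann sum and \<open>e * (b - a)\<close>
    on the local bounds; the 1 also covers \<open>a = b\<close>.\<close>
  define e where "e = e0 / (1 + (b - a))"
  have e: "e > 0" using e0 ab by (simp add: e_def)
  have "e * (1 + (b - a)) = e0" using ab by (simp add: e_def)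
  then have ee: "e + e * (b - a) = e0" by (simp add: distrib_left)
  from int e obtain \<gamma> where \<gamma>: "gauge \<gamma>" "\<And>\<D>. \<D> tagged_division_of {a..b} \<Longrightarrow> \<gamma> fine \<D> \<Longrightarrow>
      norm ((\<Sum>(x, k)\<in>\<D>. measure lborel k *\<^sub>R g x) - I) < e"
    unfolding has_integral_real by metis
  have "\<forall>t. \<exists>d>0. t \<in> {a..b} \<longrightarrow> (\<forall>s\<in>{a..b}. \<bar>s - t\<bar> < d \<longrightarrow> \<bar>h s - h t\<bar> \<le> (g t + e) * \<bar>s - t\<bar>)"
    using local[OF _ e] zero_less_one by metis
  then obtain d where d: "\<And>t. d t > 0" "\<And>t s. t \<in> {a..b} \<Longrightarrow> s \<in> {a..b} \<Longrightarrow> \<bar>s - t\<bar> < d t \<Longrightarrow>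
      \<bar>h s - h t\<bar> \<le> (g t + e) * \<bar>s - t\<bar>"
    by metis
  have "gauge (\<lambda>t. \<gamma> t \<inter> ball t (d t))"
    using \<gamma>(1) d(1) by (intro gauge_Int gauge_ball_dependent) auto
  then obtain p where p: "p tagged_division_of {a..b}" "(\<lambda>t. \<gamma> t \<inter> ball t (d t)) fine p"
    using fine_division_exists_real by blast
  have fine: "\<gamma> fine p" "(\<lambda>t. ball t (d t)) fine p" using p(2) by (auto simp: fine_Int)
  have "h b - h a = (\<Sum>(x, k)\<in>p. h (Sup k) - h (Inf k))"
    by (rule additive_tagged_division_1[OF ab p(1), symmetric])
  also have "\<dots> \<le> (\<Sum>(x, k)\<in>p. measure lborel k *\<^sub>R g x + e * (Sup k - Inf k))"
  proof (rule sum_mono, clarify)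
    fix x k assume xk: "(x, k) \<in> p"
    obtain u v where k: "k = {u..v}" using tagged_division_ofD(4)[OF p(1) xk] by auto
    have x: "x \<in> k" and sub: "k \<subseteq> {a..b}" using tagged_division_ofD(2,3)[OF p(1) xk] by auto
    have kb: "k \<subseteq> ball x (d x)" using fineD[OF fine(2) xk] .
    have uv: "u \<le> x" "x \<le> v" using x by (auto simp: k)
    have *: "\<bar>h s - h x\<bar> \<le> (g x + e) * \<bar>s - x\<bar>" if "s \<in> k" for s
      using that x sub kb by (intro d(2)) (auto simp: dist_real_def abs_minus_commute)
    have "\<bar>h v - h x\<bar> \<le> (g x + e) * (v - x)" "\<bar>h u - h x\<bar> \<le> (g x + e) * (x - u)"
      using *[of v] *[of u] uv by (simp_all add: k)
    \<comment> \<open>The tag lies between the endpoints, so the two one-sided bounds add up to the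
      length of the interval.\<close>
    then have "h v - h u \<le> (g x + e) * (v - x) + (g x + e) * (x - u)" by linarith
    then show "h (Sup k) - h (Inf k) \<le> measure lborel k *\<^sub>R g x + e * (Sup k - Inf k)"
      using uv by (simp add: k algebra_simps)
  qed
  also have "\<dots> = (\<Sum>(x, k)\<in>p. measure lborel k *\<^sub>R g x) + e * (\<Sum>(x, k)\<in>p. Sup k - Inf k)"
    by (simp add: split_def sum.distrib sum_distrib_left)
  also have "(\<Sum>(x, k)\<in>p. Sup k - Inf k) = b - a"
    using additive_tagged_division_1[OF ab p(1), of "\<lambda>x. x"] by simp
  finally show "h b - h a \<le> I + e0"
    using \<gamma>(2)[OF p(1) fine(1)] ee unfolding real_norm_def by linarith
qed

text \<open>\<open>unit_of_real\<close> is unspecified outside the unit interval. Clamping extends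
  evaluation to all real times, so that continuity and measurability hold on the whole line.\<close>

definition clamp01 :: "real \<Rightarrow> real"
  where "clamp01 t = max 0 (min 1 t)"

lemma clamp01_mem: "clamp01 t \<in> {0..1}"
  by (auto simp: clamp01_def)

lemma clamp01_id: "t \<in> {0..1} \<Longrightarrow> clamp01 t = t"
  by (auto simp: clamp01_def)

lemma continuous_ev_clamp01: "continuous_on UNIV (\<lambda>t. ev (clamp01 t) \<gamma>)"
proof -
  have "continuous_on {0..1} unit_of_real"
    unfolding continuous_on_iff by (auto simp: dist_unit_interval_def unit_of_real_inverse)
  moreover have "continuous_on UNIV clamp01"
    unfolding clamp01_def by (intro continuous_intros)
  ultimately have "continuous_on UNIV (\<lambda>t. unit_of_real (clamp01 t))"
    by (rule continuous_on_compose2) (use clamp01_mem in auto)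
  then show ?thesis
    unfolding ev_def by (rule continuous_on_compose2[OF continuous_on_apply_bcontfun[of UNIV]]) auto
qed

lemma ev_dist_le: "dist (ev t \<gamma>) (ev t \<gamma>') \<le> dist \<gamma> \<gamma>'"
  unfolding ev_def by (rule dist_bounded)

lemma continuous_ev: "continuous_on UNIV (ev t)"
  unfolding continuous_on_iff using ev_dist_le by (meson le_less_trans)

lemma ev_borel [measurable]: "ev t \<in> borel_measurable borel"
  by (intro borel_measurable_continuous_onI continuous_ev)

text \<open>A map continuous in time and measurable in the path is jointly measurable: with time
  rounded down to a grid it involves countably many evaluations, and refining the grid gives a
  pointwise limit. Fubini needs this for the product sigma-algebra rather than for the Borel sets of
  the product.\<close>

lemma ev_clamp01_borel_pair:
  "(\<lambda>(t, \<gamma>). ev (clamp01 t) \<gamma>) \<in> borel_measurable (borel \<Otimes>\<^sub>M borel)"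
proof (rule borel_measurable_LIMSEQ_metric)
  fix n :: nat
  have "(\<lambda>p. ev (clamp01 (of_int \<lfloor>real (Suc n) * fst p\<rfloor> / real (Suc n))) (snd p))
      \<in> borel_measurable (borel \<Otimes>\<^sub>M borel)"
    by (rule measurable_compose_countable[of "\<lambda>i p. ev (clamp01 (of_int i / real (Suc n))) (snd p)"
        _ _ "\<lambda>p. \<lfloor>real (Suc n) * fst p\<rfloor>"]) measurable
  then show "(\<lambda>(t, \<gamma>). ev (clamp01 (of_int \<lfloor>real (Suc n) * t\<rfloor> / real (Suc n))) \<gamma>)
      \<in> borel_measurable (borel \<Otimes>\<^sub>M borel)"
    by (simp add: split_def)
next
  fix p :: "real \<times> 'a path"
  obtain t \<gamma> where p: "p = (t, \<gamma>)" by (cases p)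
  have "(\<lambda>n. of_int \<lfloor>real (Suc n) * t\<rfloor> / real (Suc n)) \<longlonglongrightarrow> t"
  proof (rule tendsto_sandwich)
    show "(\<lambda>n. t - 1 / real (Suc n)) \<longlonglongrightarrow> t"
      using tendsto_diff[OF tendsto_const[of t] LIMSEQ_Suc[OF lim_1_over_n]] by simp
    have "t * real (Suc n) \<le> of_int \<lfloor>real (Suc n) * t\<rfloor> + 1" "of_int \<lfloor>real (Suc n) * t\<rfloor> \<le> t * real (Suc n)" for n
      by (simp_all add: mult.commute[of t] del: of_nat_Suc)
    moreover have "t - 1 / real (Suc n) = (t * real (Suc n) - 1) / real (Suc n)" for n
      by (simp add: diff_divide_distrib del: of_nat_Suc)
    ultimately have "t - 1 / real (Suc n) \<le> of_int \<lfloor>real (Suc n) * t\<rfloor> / real (Suc n)"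
      "of_int \<lfloor>real (Suc n) * t\<rfloor> / real (Suc n) \<le> t" for n
      by (auto simp: divide_le_eq diff_le_eq simp del: of_nat_Suc intro!: divide_right_mono)
    then show "\<forall>\<^sub>F n in sequentially. t - 1 / real (Suc n) \<le> of_int \<lfloor>real (Suc n) * t\<rfloor> / real (Suc n)"
      "\<forall>\<^sub>F n in sequentially. of_int \<lfloor>real (Suc n) * t\<rfloor> / real (Suc n) \<le> t"
      by (auto intro: always_eventually)
  qed (rule tendsto_const)
  from isCont_tendsto_compose[OF _ this, of "\<lambda>t. ev (clamp01 t) \<gamma>"]
  show "(\<lambda>n. case p of (t, \<gamma>) \<Rightarrow> ev (clamp01 (of_int \<lfloor>real (Suc n) * t\<rfloor> / real (Suc n))) \<gamma>)
      \<longlonglongrightarrow> (case p of (t, \<gamma>) \<Rightarrow> ev (clamp01 t) \<gamma>)"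
    using continuous_ev_clamp01[of \<gamma>] by (simp add: p continuous_on_eq_continuous_at)
qed

text \<open>A geodesic has constant speed \<open>l\<close>, so the slope at a point of the curve
  gives a local Lipschitz bound in time with the factor \<open>l\<close>, as
  \<open>increment_le_integral\<close> requires. The Lipschitz constant bounds the slope, whence
  integrability.\<close>

lemma upper_gradient:
  assumes f: "f \<in> Lip_bs" and \<gamma>: "\<gamma> \<in> Geo"
  shows "ennreal (f (ev 1 \<gamma>) - f (ev 0 \<gamma>))
    \<le> (\<integral>\<^sup>+t\<in>{0..1}. ennreal (dist (ev 0 \<gamma>) (ev 1 \<gamma>) * real_slope f (ev (clamp01 t) \<gamma>)) \<partial>lborel)"
proof -
  define l where "l = dist (ev 0 \<gamma>) (ev 1 \<gamma>)"
  have l: "l \<ge> 0" by (simp add: l_def)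
  have geo: "dist (ev s \<gamma>) (ev t \<gamma>) = \<bar>s - t\<bar> * l" if "s \<in> {0..1}" "t \<in> {0..1}" for s t
    using \<gamma> that unfolding Geo_def l_def by blast
  obtain L where L: "L-lipschitz_on UNIV f" using Lip_bs_lipschitz[OF f] by blast
  define g where "g t = l * real_slope f (ev (clamp01 t) \<gamma>)" for t
  have [measurable]: "(\<lambda>t. ev (clamp01 t) \<gamma>) \<in> borel_measurable borel"
    by (intro borel_measurable_continuous_onI continuous_ev_clamp01)
  have [measurable]: "real_slope f \<in> borel_measurable borel"
    by (intro real_slope_borel Lip_bs_continuous f)
  have g_meas [measurable]: "g \<in> borel_measurable borel" unfolding g_def by measurable
  have g: "0 \<le> g t" "g t \<le> l * L" for t
    using l real_slope_nonneg real_slope_le_lipschitz[OF L] by (auto simp: g_def intro!: mult_left_mono mult_nonneg_nonneg)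
  have int: "set_integrable lborel {0..1} g"
    unfolding set_integrable_def
  proof (rule integrableI_bounded_set[where A = "{0..1}" and B = "l * L"])
    show "AE x in lborel. x \<in> {0..1} \<longrightarrow> norm (indicat_real {0..1} x *\<^sub>R g x) \<le> l * L"
      using g by (auto simp: abs_of_nonneg)
  qed (auto)
  have hi: "(g has_integral (LINT t:{0..1}|lborel. g t)) {0..1}"
    using has_integral_set_lebesgue[of "{0..1}" g] set_borel_integral_eq_integral[OF int]
    by (simp add: has_integral_iff)
  have "f (ev 1 \<gamma>) - f (ev 0 \<gamma>) \<le> (LINT t:{0..1}|lborel. g t)"
  proof (rule increment_le_integral[OF _ hi, of "\<lambda>t. f (ev t \<gamma>)"])
    fix t e :: real assume t: "t \<in> {0..1}" and e: "e > 0"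
    \<comment> \<open>The tolerance for the slope is scaled by the speed; \<open>l + 1\<close> also
      covers constant geodesics.\<close>
    define e' where "e' = e / (l + 1)"
    have e': "e' > 0" "l * e' \<le> e" using e l by (auto simp: e'_def field_simps)
    let ?x = "ev t \<gamma>"
    have "slope f ?x < ennreal (real_slope f ?x + e')"
      unfolding Lip_bs_slope_eq[OF f] using e' real_slope_nonneg[of f ?x] by (subst ennreal_less_iff) auto
    from slope_lessD[OF this] obtain r where r: "r > 0"
      "\<And>y. y \<noteq> ?x \<Longrightarrow> dist y ?x < r \<Longrightarrow> \<bar>f y - f ?x\<bar> \<le> (real_slope f ?x + e') * dist ?x y"
      unfolding eventually_at by auto
    show "\<exists>d>0. \<forall>s\<in>{0..1}. \<bar>s - t\<bar> < d \<longrightarrow> \<bar>f (ev s \<gamma>) - f (ev t \<gamma>)\<bar> \<le> (g t + e) * \<bar>s - t\<bar>"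
    proof (intro exI[of _ "r / (l + 1)"] conjI ballI impI)
      show "r / (l + 1) > 0" using r(1) l by simp
      fix s assume s: "s \<in> {0..1::real}" and d: "\<bar>s - t\<bar> < r / (l + 1)"
      have ds: "dist (ev s \<gamma>) ?x = \<bar>s - t\<bar> * l" using geo[OF s t] .
      have "\<bar>s - t\<bar> * l \<le> \<bar>s - t\<bar> * (l + 1)" by (intro mult_left_mono) auto
      also have "\<dots> < r" using d l by (simp add: pos_less_divide_eq)
      finally have near: "dist (ev s \<gamma>) ?x < r" using ds by simp
      have "\<bar>f (ev s \<gamma>) - f ?x\<bar> \<le> (real_slope f ?x + e') * (\<bar>s - t\<bar> * l)"
      proof (cases "ev s \<gamma> = ?x")
        case True
        then show ?thesis using e' l real_slope_nonneg[of f ?x] by simp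
      next
        case False
        then show ?thesis using r(2)[OF False near] ds by (simp add: dist_commute)
      qed
      also have "\<dots> = (g t + l * e') * \<bar>s - t\<bar>" by (simp add: g_def clamp01_id[OF t] algebra_simps)
      also have "\<dots> \<le> (g t + e) * \<bar>s - t\<bar>" using e' by (intro mult_right_mono) auto
      finally show "\<bar>f (ev s \<gamma>) - f (ev t \<gamma>)\<bar> \<le> (g t + e) * \<bar>s - t\<bar>" .
    qed
  qed auto
  then have "ennreal (f (ev 1 \<gamma>) - f (ev 0 \<gamma>)) \<le> ennreal (LINT t|lborel. indicator {0..1} t * g t)"
    by (intro ennreal_leI) (simp add: set_lebesgue_integral_def)
  also have "\<dots> = (\<integral>\<^sup>+t. ennreal (indicator {0..1} t * g t) \<partial>lborel)"
    using int g by (intro nn_integral_eq_integral[symmetric]) (auto simp: set_integrable_def)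
  also have "\<dots> = (\<integral>\<^sup>+t\<in>{0..1}. ennreal (g t) \<partial>lborel)"
    by (intro nn_integral_cong) (simp split: split_indicator)
  finally show ?thesis by (simp add: g_def l_def)
qed

section \<open>Bounded densities along optimal transport\<close>

lemma ennreal_powr_lower:
  assumes "ennreal s \<le> x" "s > 0" "a \<ge> 0"
  shows "ennreal (s powr a) \<le> ennreal_powr x a"
proof (cases "x = \<infinity>")
  case False
  then have "x = ennreal (enn2real x)" by (simp add: less_top[symmetric])
  then have "s \<le> enn2real x" using assms(1,2) by (metis enn2real_nonneg ennreal_le_iff)
  then show ?thesis
    using False assms by (auto simp: ennreal_powr_def intro!: ennreal_leI powr_mono2)
qed (simp add: ennreal_powr_def)

text \<open>By the addition formula \<open>sin x\<close> is at most
  \<open>sin (t * x) + sin (x - t * x)\<close>, and for \<open>t\<close> at least 1/2 the second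
  summand does not exceed the first. The bound is uniform up to \<open>pi\<close>.\<close>

lemma sin_ratio_ge_half:
  assumes t: "1/2 \<le> t" "t < 1" and x: "0 < x" "x < pi"
  shows "1/2 \<le> sin (t * x) / sin x"
proof -
  have tx: "t * x < x" "x / 2 \<le> t * x" using t x by (simp_all add: mult_le_cancel_right)
  have s: "sin x > 0" using x by (rule sin_gt_zero)
  have "0 \<le> sin ((2 * t - 1) * x / 2)" using t x tx by (intro sin_ge_zero) (auto simp: algebra_simps)
  moreover have "0 \<le> cos (x / 2)" using x by (intro cos_ge_zero) auto
  moreover have "sin (t * x) - sin (x - t * x) = 2 * sin ((t * x - (x - t * x)) / 2) * cos ((t * x + (x - t * x)) / 2)"
    by (rule sin_diff_sin)
  moreover have "t * x - (x - t * x) = (2 * t - 1) * x" by (simp add: algebra_simps)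
  ultimately have "0 \<le> sin (t * x) - sin (x - t * x)" by simp
  then have 1: "sin (x - t * x) \<le> sin (t * x)" by simp
  have nonneg: "0 \<le> sin (t * x)" "0 \<le> sin (x - t * x)" by (intro sin_ge_zero; use tx x in linarith)+
  have "sin x = sin (t * x) * cos (x - t * x) + cos (t * x) * sin (x - t * x)"
    using sin_add[of "t * x" "x - t * x"] by simp
  also have "\<dots> \<le> sin (t * x) * 1 + 1 * sin (x - t * x)"
    using nonneg by (intro add_mono mult_left_mono mult_right_mono) auto
  finally have "sin x \<le> 2 * sin (t * x)" using 1 by simp
  then show ?thesis using s by (simp add: field_simps)
qed

text \<open>Doubling formula at \<open>y / 2\<close>: \<open>sinh (y / 2)\<close> is at most
  \<open>sinh (t * y)\<close>, and \<open>Y\<close> controls the factor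
  \<open>cosh (y / 2)\<close>.\<close>

lemma sinh_ratio_lower:
  assumes t: "1/2 \<le> t" and y: "0 < y" "y \<le> Y"
  shows "1 / (2 * cosh (Y / 2)) \<le> sinh (t * y) / sinh (y :: real)"
proof -
  have "sinh y = 2 * sinh (y / 2) * cosh (y / 2)" using sinh_double[of "y / 2"] by simp
  also have "\<dots> \<le> 2 * sinh (t * y) * cosh (Y / 2)"
  proof (intro mult_mono)
    show "sinh (y / 2) \<le> sinh (t * y)" using mult_right_mono[OF t, of y] y by simp
    show "cosh (y / 2) \<le> cosh (Y / 2)" using y by (subst cosh_real_nonneg_le_iff) auto
  qed (use t y in auto)
  finally have *: "sinh y \<le> 2 * sinh (t * y) * cosh (Y / 2)" .
  have "sinh y > 0" "cosh (Y / 2) > 0" using y by (auto simp: cosh_real_pos)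
  then show ?thesis using * by (simp add: field_simps)
qed

text \<open>The constant is dictated by negative \<open>K\<close>. Since \<open>cosh\<close> is at
  least 1 it does not exceed 1/2, which bounds the coefficient from below in all other cases; the
  absolute value lets one formula serve every sign.\<close>

lemma sigma_coeff_lower:
  assumes n: "n > 0" and t: "1/2 \<le> t" "t < 1" and \<theta>: "0 \<le> \<theta>" "\<theta> \<le> D"
  shows "ennreal (1 / (2 * cosh (D * sqrt \<bar>K / n\<bar> / 2))) \<le> sigma_coeff K n t \<theta>"
proof -
  let ?s = "1 / (2 * cosh (D * sqrt \<bar>K / n\<bar> / 2))"
  have s_half: "?s \<le> z" if "1 / 2 \<le> z" for z
    using cosh_real_ge_1[of "D * sqrt \<bar>K / n\<bar> / 2"] frac_le[of 1 1 2 "2 * cosh (D * sqrt \<bar>K / n\<bar> / 2)"] that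
    by linarith
  consider "K = 0 \<or> \<theta> = 0" | "K > 0" "\<theta> > 0" "\<theta> < pi / sqrt (K / n)"
    | "K > 0" "\<theta> > 0" "\<not> \<theta> < pi / sqrt (K / n)" | "K < 0" "\<theta> > 0"
    using \<theta>(1) by fastforce
  then show ?thesis
  proof cases
    case 1
    then show ?thesis using s_half[OF t(1)] by (auto simp: sigma_coeff_def Let_def intro!: ennreal_leI)
  next
    case 2
    have k: "sqrt (K / n) > 0" using 2 n by simp
    have "1/2 \<le> sin (t * (\<theta> * sqrt (K / n))) / sin (\<theta> * sqrt (K / n))"
      using 2 k t by (intro sin_ratio_ge_half) (auto simp: pos_less_divide_eq)
    then have "?s \<le> sin (t * \<theta> * sqrt (K / n)) / sin (\<theta> * sqrt (K / n))" using s_half by (simp only: mult.assoc)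
    then show ?thesis using 2 by (auto simp: sigma_coeff_def Let_def intro!: ennreal_leI)
  next
    case 3
    then show ?thesis by (simp add: sigma_coeff_def Let_def)
  next
    case 4
    have k: "sqrt (- (K / n)) > 0" "\<bar>K / n\<bar> = - (K / n)" using 4 n by (auto simp: divide_neg_pos abs_of_neg)
    have "?s \<le> sinh (t * (\<theta> * sqrt (- (K / n)))) / sinh (\<theta> * sqrt (- (K / n)))"
      unfolding k(2) using 4 k(1) \<theta>(2) t(1) by (intro sinh_ratio_lower mult_right_mono mult_pos_pos) auto
    then show ?thesis using 4 by (auto simp: sigma_coeff_def Let_def mult.assoc intro!: ennreal_leI)
  qed
qed

text \<open>The coefficients degenerate as \<open>t\<close> tends to 0, so only \<open>t\<close> of
  at least 1/2 is treated; in \<open>QCD\<close> one of \<open>t\<close> and \<open>1 - t\<close> is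
  always of this kind.\<close>

lemma tau_coeff_lower:
  assumes N: "N > 1"
  shows "\<exists>c>0. \<forall>t \<theta>. 1/2 \<le> t \<longrightarrow> t < 1 \<longrightarrow> 0 \<le> \<theta> \<longrightarrow> \<theta> \<le> D \<longrightarrow> ennreal c \<le> tau_coeff K N t \<theta>"
proof -
  define s where "s = 1 / (2 * cosh (D * sqrt \<bar>K / (N - 1)\<bar> / 2))"
  have s: "s > 0" by (simp add: s_def cosh_real_pos)
  define c where "c = (1/2) powr (1 / N) * s powr (1 - 1 / N)"
  have "c > 0" using s by (simp add: c_def)
  moreover have "ennreal c \<le> tau_coeff K N t \<theta>" if "1/2 \<le> t" "t < 1" "0 \<le> \<theta>" "\<theta> \<le> D" for t \<theta>
  proof -
    have "ennreal c = ennreal ((1/2) powr (1 / N)) * ennreal (s powr (1 - 1 / N))"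
      by (simp add: c_def ennreal_mult)
    also have "\<dots> \<le> tau_coeff K N t \<theta>"
      unfolding tau_coeff_def
    proof (rule mult_mono)
      show "ennreal ((1/2) powr (1 / N)) \<le> ennreal (t powr (1 / N))"
        using that N by (intro ennreal_leI powr_mono2) auto
      show "ennreal (s powr (1 - 1 / N)) \<le> ennreal_powr (sigma_coeff K (N - 1) t \<theta>) (1 - 1 / N)"
        using that N s sigma_coeff_lower[of "N - 1" t \<theta> D K] by (intro ennreal_powr_lower) (auto simp: s_def)
    qed auto
    finally show ?thesis .
  qed
  ultimately show ?thesis by blast
qed

lemma powr_neg_inverse_bound:
  fixes x b N :: real
  assumes "b \<le> x powr (- 1 / N)" "b > 0" "N > 0" "x \<ge> 0"
  shows "x \<le> b powr (- N)"
proof (cases "x = 0")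
  case False
  then have "x = (x powr (- 1 / N)) powr (- N)" using assms by (simp add: powr_powr)
  also have "\<dots> \<le> b powr (- N)" using assms by (intro powr_mono2') auto
  finally show ?thesis .
qed simp

section \<open>Bounded densities and uniform measures on compact sets\<close>

lemma mms_sigma_finite:
  assumes mm: "metric_measure_space m"
  shows "sigma_finite_measure m"
proof
  \<comment> \<open>\<open>undefined\<close> is an arbitrary centre; balls of integer radius about
    it exhaust the space.\<close>
  let ?A = "range (\<lambda>n::nat. cball undefined (real n))"
  have "\<Union> ?A = UNIV" by (auto simp: real_arch_simple)
  then show "\<exists>A. countable A \<and> A \<subseteq> sets m \<and> \<Union> A = space m \<and> (\<forall>a\<in>A. emeasure m a \<noteq> \<infinity>)"
    using mms_bounded_finite[OF mm] mms_sets[OF mm] mms_space[OF mm]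
    by (intro exI[of _ ?A]) (auto simp: less_top[symmetric])
qed

text \<open>A density bound that holds almost everywhere for \<mu> also holds almost everywhere for
  \<open>m\<close>, because the density is 0 on what \<mu> does not see. As \<mu> is finite, so is
  its density, and passing to the real-valued \<open>dens\<close> loses nothing.\<close>

lemma nn_integral_le_bounded_density:
  assumes "sigma_finite_measure m" and "prob_space \<mu>" and ac: "absolutely_continuous m \<mu>" and s: "sets \<mu> = sets m"
    and bd: "AE x in \<mu>. dens m \<mu> x \<le> C" and F: "F \<in> borel_measurable m"
  shows "(\<integral>\<^sup>+x. F x \<partial>\<mu>) \<le> ennreal C * (\<integral>\<^sup>+x. F x \<partial>m)"
proof -
  interpret sigma_finite_measure m by fact
  interpret \<mu>: prob_space \<mu> by fact
  let ?\<rho> = "RN_deriv m \<mu>"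
  have d: "density m ?\<rho> = \<mu>" by (rule density_RN_deriv[OF ac s])
  have fin: "AE x in m. ?\<rho> x \<noteq> \<infinity>" by (rule RN_deriv_finite[OF _ ac s]) unfold_locales
  have "AE x in density m ?\<rho>. dens m \<mu> x \<le> C" using bd unfolding d .
  then have "AE x in m. 0 < ?\<rho> x \<longrightarrow> dens m \<mu> x \<le> C"
    by (subst (asm) AE_density) auto
  with fin have le: "AE x in m. ?\<rho> x \<le> ennreal C"
  proof eventually_elim
    case (elim x)
    show ?case
    proof (cases "?\<rho> x = 0")
      case False
      then have "dens m \<mu> x \<le> C" using elim by (simp add: zero_less_iff_neq_zero)
      moreover have "?\<rho> x = ennreal (dens m \<mu> x)" using elim by (simp add: dens_def less_top[symmetric])
      ultimately show ?thesis by (simp add: ennreal_leI)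
    qed simp
  qed
  have "(\<integral>\<^sup>+x. F x \<partial>\<mu>) = (\<integral>\<^sup>+x. ?\<rho> x * F x \<partial>m)" by (rule RN_deriv_nn_integral[OF ac s F])
  also have "\<dots> \<le> (\<integral>\<^sup>+x. ennreal C * F x \<partial>m)"
    using le by (intro nn_integral_mono_AE) (auto elim!: eventually_mono intro: mult_right_mono)
  also have "\<dots> = ennreal C * (\<integral>\<^sup>+x. F x \<partial>m)" by (rule nn_integral_cmult[OF F])
  finally show ?thesis .
qed

text \<open>Inner regularity is applied to a finite Borel measure, whence the restriction to a ball;
  \<open>main_part\<close> trades a set of the completion for a Borel set.\<close>

lemma positive_measure_compact_subset:
  fixes m :: "('a :: polish_space) measure"
  assumes mm: "metric_measure_space m" and A: "A \<in> sets (completion m)" and pos: "emeasure (completion m) A \<noteq> 0"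
  shows "\<exists>K. compact K \<and> K \<subseteq> A \<and> 0 < emeasure m K"
proof -
  define B where "B = main_part m A"
  have B: "B \<in> sets m" "B \<subseteq> A" "emeasure m B \<noteq> 0"
    using A pos main_part_null_part_Un[OF A] unfolding B_def by (simp_all, blast)
  define C where "C n = cball (undefined :: 'a) (real n)" for n :: nat
  have C: "C n \<in> sets m" "emeasure m (C n) < \<infinity>" for n
    using mms_bounded_finite[OF mm] mms_sets[OF mm] by (auto simp: C_def)
  have "(\<Union>n. C n) = UNIV" by (auto simp: C_def real_arch_simple)
  then have "B = (\<Union>n. B \<inter> C n)" by blast
  then have "\<exists>n. emeasure m (B \<inter> C n) \<noteq> 0"
    using B(1,3) C(1) emeasure_UN_eq_0[of m "\<lambda>n. B \<inter> C n"] by (metis (no_types, lifting) image_subsetI sets.Int)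
  then obtain n where n: "emeasure m (B \<inter> C n) \<noteq> 0" by blast
  let ?M = "density m (indicator (C n))"
  have M: "emeasure ?M S = emeasure m (C n \<inter> S)" if "S \<in> sets m" for S
    using C(1)[of n] that by (subst emeasure_density) (auto simp: indicator_inter_arith[symmetric])
  have "emeasure ?M (space ?M) \<noteq> \<infinity>"
    using M[of "space m"] C[of n] sets.sets_into_space[OF C(1)[of n]] by (simp add: Int_absorb2 less_top[symmetric])
  moreover have "B \<in> sets borel" "sets ?M = sets borel" using B(1) mms_sets[OF mm] by simp_all
  ultimately have "emeasure ?M B = (SUP K\<in>{K. K \<subseteq> B \<and> compact K}. emeasure ?M K)"
    by (intro inner_regular)
  moreover have "0 < emeasure ?M B" using M[OF B(1)] n by (simp add: Int_commute zero_less_iff_neq_zero)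
  ultimately obtain K where K: "K \<subseteq> B" "compact K" "0 < emeasure ?M K"
    by (auto simp: less_SUP_iff)
  have Ks: "K \<in> sets m" using K(2) mms_sets[OF mm] by (simp add: compact_imp_closed borel_closed)
  have "emeasure ?M K \<le> emeasure m K"
    unfolding M[OF Ks] by (rule emeasure_mono[OF _ Ks]) auto
  then show ?thesis using K B(2) by (intro exI[of _ K]) auto
qed

text \<open>These measures are the marginals of the transport: compact support makes them admissible
  in \<open>QCD\<close> and \<open>P2\<close>, and a constant density keeps the right-hand side of
  \<open>QCD\<close> away from 0 as long as lengths are bounded.\<close>

lemma uniform_measure_compact:
  assumes mm: "metric_measure_space m" and K: "compact K" "0 < emeasure m K"
  defines "\<mu> \<equiv> uniform_measure m K"
  shows "\<mu> \<in> Pcm m" "\<mu> \<in> P2" "absolutely_continuous m \<mu>" "AE x in \<mu>. x \<in> K"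
    "AE x in \<mu>. dens m \<mu> x = 1 / measure m K" "measure m K > 0"
proof -
  interpret sigma_finite_measure m by (rule mms_sigma_finite[OF mm])
  have Ks [measurable]: "K \<in> sets m" using K(1) mms_sets[OF mm] by (simp add: compact_imp_closed borel_closed)
  have fin: "emeasure m K < \<infinity>"
    using Ks mms_sets[OF mm] by (intro mms_bounded_finite[OF mm] compact_imp_bounded K) auto
  have prob: "prob_space \<mu>"
    unfolding \<mu>_def using K(2) fin by (intro prob_space_uniform_measure) auto
  have s: "sets \<mu> = sets m" by (simp add: \<mu>_def)
  have bp: "borel_prob \<mu>" using prob s mms_sets[OF mm] by (simp add: borel_prob_def)
  show ac: "absolutely_continuous m \<mu>"
    unfolding \<mu>_def uniform_measure_def by (intro absolutely_continuousI_density) auto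
  show inK: "AE x in \<mu>. x \<in> K" unfolding \<mu>_def by (rule AE_uniform_measureI) auto
  have Kb: "K \<in> sets borel" using Ks mms_sets[OF mm] by simp
  have null: "emeasure \<mu> (- K) = 0"
    using inK Kb mms_sets[OF mm] s
    by (subst AE_iff_measurable[symmetric, of "- K" \<mu> "\<lambda>x. x \<in> K"]) (auto simp: mms_space[OF mm] sets_eq_imp_space_eq[OF s])
  have "topological_support \<mu> \<subseteq> K"
  proof
    fix x assume x: "x \<in> topological_support \<mu>"
    have "open (- K)" using K(1) by (simp add: compact_imp_closed open_Compl)
    then show "x \<in> K" using x null unfolding topological_support_def by force
  qed
  moreover have "closed (topological_support \<mu>)"
  proof -
    have "- topological_support \<mu> = \<Union>{U. open U \<and> emeasure \<mu> U = 0}"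
      by (auto simp: topological_support_def zero_less_iff_neq_zero)
    moreover have "open (\<Union>{U. open U \<and> emeasure \<mu> U = 0})" by (rule open_Union) auto
    ultimately show ?thesis unfolding closed_def by simp
  qed
  ultimately have "compact (topological_support \<mu>)"
    using compact_Int_closed[OF K(1), of "topological_support \<mu>"] by (simp add: Int_absorb1)
  then show "\<mu> \<in> Pcm m" using bp ac by (simp add: Pcm_def)
  obtain x0 R where R: "\<And>x. x \<in> K \<Longrightarrow> dist x x0 \<le> R"
    using compact_imp_bounded[OF K(1)] unfolding bounded_def by (metis dist_commute)
  interpret \<mu>: prob_space \<mu> by fact
  have "(\<integral>\<^sup>+x. ennreal ((dist x x0)\<^sup>2) \<partial>\<mu>) \<le> (\<integral>\<^sup>+x. ennreal (R\<^sup>2) \<partial>\<mu>)"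
    using inK by (intro nn_integral_mono_AE) (auto elim!: eventually_mono intro!: ennreal_leI power_mono R)
  also have "\<dots> < \<infinity>" by (simp add: \<mu>.emeasure_space_1)
  finally show "\<mu> \<in> P2" using bp by (auto simp: P2_def)
  have m_eq: "emeasure m K = ennreal (measure m K)" using fin by (simp add: emeasure_eq_ennreal_measure less_top[symmetric])
  show mpos: "measure m K > 0" using K(2) m_eq by simp
  have "AE x in m. indicator K x / emeasure m K = RN_deriv m \<mu> x"
    by (rule RN_deriv_unique) (auto simp: \<mu>_def uniform_measure_def)
  then have "AE x in \<mu>. indicator K x / emeasure m K = RN_deriv m \<mu> x"
    using absolutely_continuous_AE[OF s ac] by blast
  with inK show "AE x in \<mu>. dens m \<mu> x = 1 / measure m K"
  proof eventually_elim
    case (elim x)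
    then have "RN_deriv m \<mu> x = 1 / ennreal (measure m K)" by (simp add: m_eq)
    also have "\<dots> = ennreal (1 / measure m K)" using mpos by (simp add: divide_ennreal[symmetric])
    finally show ?case by (simp add: dens_def)
  qed
qed

lemma QCD_density_bound:
  assumes mm: "metric_measure_space m" and QCD: "QCD m Q K N" and Q: "Q \<ge> 1" and N: "N > 1"
    and \<mu>: "\<mu>0 \<in> Pcm m" "\<mu>1 \<in> Pcm m" and \<pi>: "\<pi> \<in> OptGeo \<mu>0 \<mu>1"
    and r: "r0 > 0" "r1 > 0"
    and dens: "AE x in \<mu>0. dens m \<mu>0 x = r0" "AE x in \<mu>1. dens m \<mu>1 x = r1"
    and dist: "AE \<gamma> in \<pi>. dist (ev 0 \<gamma>) (ev 1 \<gamma>) \<le> D"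
  shows "\<exists>C. \<forall>t\<in>{0<..<1}. AE x in distr \<pi> borel (ev t). dens m (distr \<pi> borel (ev t)) x \<le> C"
proof -
  from \<pi> have s: "sets \<pi> = sets borel" and m0: "distr \<pi> borel (ev 0) = \<mu>0" and m1: "distr \<pi> borel (ev 1) = \<mu>1"
    by (auto simp: OptGeo_def borel_prob_def)
  have ev_meas [measurable]: "ev t \<in> borel_measurable \<pi>" for t
    using ev_borel by (simp cong: measurable_cong_sets add: s)
  have d0: "AE \<gamma> in \<pi>. dens m \<mu>0 (ev 0 \<gamma>) = r0" "AE \<gamma> in \<pi>. dens m \<mu>1 (ev 1 \<gamma>) = r1"
    using AE_distrD[OF ev_meas[of 0], of "\<lambda>x. dens m \<mu>0 x = r0"]
      AE_distrD[OF ev_meas[of 1], of "\<lambda>x. dens m \<mu>1 x = r1"]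
      dens unfolding m0 m1 by blast+
  obtain c where c: "c > 0" and tau: "\<And>t \<theta>. 1/2 \<le> t \<Longrightarrow> t < 1 \<Longrightarrow> 0 \<le> \<theta> \<Longrightarrow> \<theta> \<le> D \<Longrightarrow> ennreal c \<le> tau_coeff K N t \<theta>"
    using tau_coeff_lower[OF N, of D K] by blast
  define p where "p = min (r0 powr (- 1 / N)) (r1 powr (- 1 / N))"
  have p: "p > 0" using r by (simp add: p_def)
  \<comment> \<open>A lower bound for the right-hand side of \<open>QCD\<close>; undoing the
    exponent \<open>- 1 / N\<close> turns it into the density bound
    \<open>b powr (- N)\<close>.\<close>
  define b where "b = Q powr (- 1 / N) * (c * p)"
  have b: "b > 0" using Q c p by (simp add: b_def)
  have "AE x in distr \<pi> borel (ev t). dens m (distr \<pi> borel (ev t)) x \<le> b powr (- N)" if t: "t \<in> {0<..<1}" for t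
  proof -
    let ?\<mu> = "distr \<pi> borel (ev t)"
    have "AE \<gamma> in \<pi>. ennreal (dens m ?\<mu> (ev t \<gamma>) powr (- 1 / N)) \<ge>
      ennreal (Q powr (- 1 / N)) *
        (tau_coeff K N (1 - t) (dist (ev 0 \<gamma>) (ev 1 \<gamma>)) * ennreal (dens m \<mu>0 (ev 0 \<gamma>) powr (- 1 / N)) +
         tau_coeff K N t (dist (ev 0 \<gamma>) (ev 1 \<gamma>)) * ennreal (dens m \<mu>1 (ev 1 \<gamma>) powr (- 1 / N)))"
      using QCD \<mu> \<pi> t unfolding QCD_def by blast
    with d0 dist have "AE \<gamma> in \<pi>. dens m ?\<mu> (ev t \<gamma>) \<le> b powr (- N)"
    proof eventually_elim
      case (elim \<gamma>)
      let ?d = "dist (ev 0 \<gamma>) (ev 1 \<gamma>)" and ?x = "dens m ?\<mu> (ev t \<gamma>)"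
      let ?s0 = "tau_coeff K N (1 - t) ?d * ennreal (r0 powr (- 1 / N))"
      let ?s1 = "tau_coeff K N t ?d * ennreal (r1 powr (- 1 / N))"
      have "ennreal c * ennreal p \<le> ?s0 + ?s1"
      proof (cases "1/2 \<le> t")
        case True
        have "ennreal c * ennreal p \<le> ?s1"
          using True t elim(3) by (intro mult_mono tau ennreal_leI) (auto simp: p_def)
        then show ?thesis by (rule order_trans) simp
      next
        case False
        have "ennreal c * ennreal p \<le> ?s0"
          using False t elim(3) by (intro mult_mono tau ennreal_leI) (auto simp: p_def)
        then show ?thesis by (rule order_trans) simp
      qed
      then have "ennreal (Q powr (- 1 / N)) * (ennreal c * ennreal p) \<le> ennreal (Q powr (- 1 / N)) * (?s0 + ?s1)"
        by (intro mult_left_mono) auto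
      also have "\<dots> \<le> ennreal (?x powr (- 1 / N))" using elim by simp
      finally have "b \<le> ?x powr (- 1 / N)"
        using c p by (simp add: b_def ennreal_mult[symmetric])
      then show ?case by (rule powr_neg_inverse_bound) (use b N in \<open>auto simp: dens_def\<close>)
    qed
    moreover have "{x \<in> space borel. dens m ?\<mu> x \<le> b powr (- N)} \<in> sets borel"
    proof -
      have "RN_deriv m ?\<mu> \<in> borel_measurable borel"
        using borel_measurable_RN_deriv[of m ?\<mu>] by (simp cong: measurable_cong_sets add: mms_sets[OF mm])
      then show ?thesis unfolding dens_def by measurable
    qed
    ultimately show ?thesis by (subst AE_distr_iff[OF ev_meas])
  qed
  then show ?thesis by (intro exI ballI)
qed

lemma ennreal_integral_le_nn_integral:
  fixes f :: "'b \<Rightarrow> real"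
  assumes f: "integrable M f"
  shows "ennreal (\<integral>x. f x \<partial>M) \<le> (\<integral>\<^sup>+x. ennreal (f x) \<partial>M)"
proof -
  have "ennreal (\<integral>x. f x \<partial>M) \<le> ennreal (\<integral>x. max 0 (f x) \<partial>M)"
    using f by (intro ennreal_leI integral_mono) auto
  also have "\<dots> = (\<integral>\<^sup>+x. ennreal (max 0 (f x)) \<partial>M)"
    using f by (intro nn_integral_eq_integral[symmetric]) auto
  also have "\<dots> = (\<integral>\<^sup>+x. ennreal (f x) \<partial>M)"
    by (intro nn_integral_cong) (simp add: max_def ennreal_neg)
  finally show ?thesis .
qed

text \<open>Along each geodesic the increment of \<open>H\<close> is at most the length times the
  integrated slope. Averaging over \<pi> and exchanging integrals leaves, at each time, an integral
  against a law of bounded density. That \<open>C\<close> and \<open>S\<close> do not depend on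
  \<open>H\<close> is essential: \<open>H\<close> is chosen later in terms of both.\<close>

lemma transport_inequality:
  fixes m :: "('a :: polish_space) measure"
  assumes mm: "metric_measure_space m" and Monge: "Monge_space m" and QCD: "QCD m Q K N" and Q: "Q \<ge> 1" and N: "N > 1"
    and K0: "compact K0" "0 < emeasure m K0" and K1: "compact K1" "0 < emeasure m K1"
  shows "\<exists>C S. C \<ge> 0 \<and> bounded S \<and> closed S \<and> K0 \<subseteq> S \<and> K1 \<subseteq> S \<and>
    (\<forall>H\<in>Lip_bs. ennreal ((\<integral>x. H x \<partial>uniform_measure m K1) - (\<integral>x. H x \<partial>uniform_measure m K0))
      \<le> ennreal C * (\<integral>\<^sup>+x. ennreal (real_slope H x) * indicator S x \<partial>m))"
proof -
  define \<mu>0 \<mu>1 where "\<mu>0 = uniform_measure m K0" and "\<mu>1 = uniform_measure m K1"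
  note u0 = uniform_measure_compact[OF mm K0, folded \<mu>0_def]
  note u1 = uniform_measure_compact[OF mm K1, folded \<mu>1_def]
  have "bounded (K0 \<union> K1)" using K0(1) K1(1) by (simp add: compact_imp_bounded)
  then obtain x0 R' where R': "K0 \<union> K1 \<subseteq> cball x0 R'" unfolding bounded_subset_cball by blast
  define R where "R = max 0 R'"
  have R: "R \<ge> 0" "\<And>x. x \<in> K0 \<union> K1 \<Longrightarrow> dist x0 x \<le> R" using R' by (auto simp: R_def le_max_iff_disj)
  \<comment> \<open>Endpoints lie within \<open>R\<close> of \<open>x0\<close>, so geodesics have
    length at most \<open>2 * R\<close> and stay within \<open>3 * R\<close>.\<close>
  define S where "S = cball x0 (3 * R)"
  obtain \<pi> where \<pi>: "\<pi> \<in> OptGeo \<mu>0 \<mu>1"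
    and ac: "\<And>t. t \<in> {0..<1} \<Longrightarrow> absolutely_continuous m (distr \<pi> borel (ev t))"
    using Monge[unfolded Monge_space_def, rule_format, OF u0(2) u1(2) u0(3)] by (metis ex1_implies_ex)
  from \<pi> have s: "sets \<pi> = sets borel" and m0: "distr \<pi> borel (ev 0) = \<mu>0" and m1: "distr \<pi> borel (ev 1) = \<mu>1"
    and geo: "AE \<gamma> in \<pi>. \<gamma> \<in> Geo" and prob: "prob_space \<pi>"
    by (auto simp: OptGeo_def borel_prob_def)
  interpret \<pi>: prob_space \<pi> by fact
  interpret m: sigma_finite_measure m by (rule mms_sigma_finite[OF mm])
  interpret P: pair_sigma_finite \<pi> "lborel :: real measure" by unfold_locales
  have ev_meas [measurable]: "ev t \<in> borel_measurable \<pi>" for t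
    using ev_borel by (simp cong: measurable_cong_sets add: s)
  have in0: "AE \<gamma> in \<pi>. ev 0 \<gamma> \<in> K0" and in1: "AE \<gamma> in \<pi>. ev 1 \<gamma> \<in> K1"
    using AE_distrD[OF ev_meas[of 0], of "\<lambda>x. x \<in> K0"] AE_distrD[OF ev_meas[of 1], of "\<lambda>x. x \<in> K1"] u0(4) u1(4)
    unfolding m0 m1 by blast+
  have dist_le: "dist (ev 0 \<gamma>) (ev 1 \<gamma>) \<le> 2 * R" if "ev 0 \<gamma> \<in> K0" "ev 1 \<gamma> \<in> K1" for \<gamma>
    using R(2)[of "ev 0 \<gamma>"] R(2)[of "ev 1 \<gamma>"] that dist_triangle[of "ev 0 \<gamma>" "ev 1 \<gamma>" x0]
    by (simp add: dist_commute)
  have dist: "AE \<gamma> in \<pi>. dist (ev 0 \<gamma>) (ev 1 \<gamma>) \<le> 2 * R"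
    using in0 in1 by eventually_elim (rule dist_le)
  obtain C0 where C0: "\<And>t. t \<in> {0<..<1} \<Longrightarrow> AE x in distr \<pi> borel (ev t). dens m (distr \<pi> borel (ev t)) x \<le> C0"
    using QCD_density_bound[OF mm QCD Q N u0(1) u1(1) \<pi> _ _ u0(5) u1(5) dist] u0(6) u1(6)
    by (metis zero_less_divide_1_iff)
  define C where "C = max 0 C0"
  have inS: "ev t \<gamma> \<in> S" if \<gamma>: "\<gamma> \<in> Geo" "ev 0 \<gamma> \<in> K0" "ev 1 \<gamma> \<in> K1" and t: "t \<in> {0..1}" for \<gamma> t
  proof -
    have "\<forall>s\<in>{0..1}. \<forall>t\<in>{0..1}. dist (ev s \<gamma>) (ev t \<gamma>) = \<bar>s - t\<bar> * dist (ev 0 \<gamma>) (ev 1 \<gamma>)"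
      using \<gamma>(1) unfolding Geo_def by blast
    then have "\<forall>t\<in>{0..1}. dist (ev 0 \<gamma>) (ev t \<gamma>) = \<bar>0 - t\<bar> * dist (ev 0 \<gamma>) (ev 1 \<gamma>)"
      by (rule bspec) simp
    then have "dist (ev 0 \<gamma>) (ev t \<gamma>) = \<bar>0 - t\<bar> * dist (ev 0 \<gamma>) (ev 1 \<gamma>)"
      using t by (rule bspec)
    also have "\<dots> \<le> 1 * (2 * R)" using t dist_le[OF \<gamma>(2,3)] R(1) by (intro mult_mono) auto
    finally have "dist (ev 0 \<gamma>) (ev t \<gamma>) \<le> 2 * R" by simp
    then show ?thesis
      using R(2)[of "ev 0 \<gamma>"] \<gamma>(2) dist_triangle[of x0 "ev t \<gamma>" "ev 0 \<gamma>"] by (simp add: S_def)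
  qed
  have "ennreal ((\<integral>x. H x \<partial>\<mu>1) - (\<integral>x. H x \<partial>\<mu>0))
      \<le> ennreal (2 * R * C) * (\<integral>\<^sup>+x. ennreal (real_slope H x) * indicator S x \<partial>m)" if H: "H \<in> Lip_bs" for H
  proof -
    have Hb [measurable]: "H \<in> borel_measurable borel" by (rule Lip_bs_borel[OF H])
    have [measurable]: "real_slope H \<in> borel_measurable borel"
      by (rule real_slope_borel[OF Lip_bs_continuous[OF H]])
    have [measurable]: "S \<in> sets borel" by (simp add: S_def)
    define F where "F x = ennreal (real_slope H x) * indicator S x" for x
    have F_meas [measurable]: "F \<in> borel_measurable borel" unfolding F_def by measurable
    have F_m: "F \<in> borel_measurable m" 
      using F_meas by (simp cong: measurable_cong_sets add: mms_sets[OF mm])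
    obtain B where B: "\<forall>x. \<bar>H x\<bar> \<le> B" using H by (rule Lip_bsE)
    have int: "integrable \<pi> (\<lambda>\<gamma>. H (ev t \<gamma>))" for t
      by (rule \<pi>.integrable_const_bound[of _ B]) (use B in auto)
    have "(\<integral>x. H x \<partial>\<mu>1) - (\<integral>x. H x \<partial>\<mu>0) = (\<integral>\<gamma>. H (ev 1 \<gamma>) - H (ev 0 \<gamma>) \<partial>\<pi>)"
      unfolding m0[symmetric] m1[symmetric] by (simp add: integral_distr int)
    also have "ennreal \<dots> \<le> (\<integral>\<^sup>+\<gamma>. ennreal (H (ev 1 \<gamma>) - H (ev 0 \<gamma>)) \<partial>\<pi>)"
      by (intro ennreal_integral_le_nn_integral Bochner_Integration.integrable_diff int)
    also have "\<dots> \<le> (\<integral>\<^sup>+\<gamma>. (\<integral>\<^sup>+t. ennreal (2 * R) * (F (ev (clamp01 t) \<gamma>) * indicator {0..1} t) \<partial>lborel) \<partial>\<pi>)"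
    proof (rule nn_integral_mono_AE)
      show "AE \<gamma> in \<pi>. ennreal (H (ev 1 \<gamma>) - H (ev 0 \<gamma>))
        \<le> (\<integral>\<^sup>+t. ennreal (2 * R) * (F (ev (clamp01 t) \<gamma>) * indicator {0..1} t) \<partial>lborel)"
        using geo in0 in1
      proof eventually_elim
        case (elim \<gamma>)
        have "ennreal (H (ev 1 \<gamma>) - H (ev 0 \<gamma>))
          \<le> (\<integral>\<^sup>+t\<in>{0..1}. ennreal (dist (ev 0 \<gamma>) (ev 1 \<gamma>) * real_slope H (ev (clamp01 t) \<gamma>)) \<partial>lborel)"
          by (rule upper_gradient[OF H elim(1)])
        also have "\<dots> \<le> (\<integral>\<^sup>+t. ennreal (2 * R) * (F (ev (clamp01 t) \<gamma>) * indicator {0..1} t) \<partial>lborel)"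
        proof (rule nn_integral_mono)
          fix t :: real
          have "ev (clamp01 t) \<gamma> \<in> S" by (rule inS[OF elim clamp01_mem])
          moreover have "ennreal (dist (ev 0 \<gamma>) (ev 1 \<gamma>) * real_slope H (ev (clamp01 t) \<gamma>))
            \<le> ennreal (2 * R) * ennreal (real_slope H (ev (clamp01 t) \<gamma>))"
            using dist_le[OF elim(2,3)] R(1) real_slope_nonneg[of H]
            by (subst ennreal_mult[symmetric]) (auto intro!: ennreal_leI mult_right_mono)
          ultimately show "ennreal (dist (ev 0 \<gamma>) (ev 1 \<gamma>) * real_slope H (ev (clamp01 t) \<gamma>)) * indicator {0..1} t
            \<le> ennreal (2 * R) * (F (ev (clamp01 t) \<gamma>) * indicator {0..1} t)"
            by (simp add: F_def split: split_indicator)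
        qed
        finally show ?case .
      qed
    qed
    also have "\<dots> = (\<integral>\<^sup>+t. (\<integral>\<^sup>+\<gamma>. ennreal (2 * R) * (F (ev (clamp01 t) \<gamma>) * indicator {0..1} t) \<partial>\<pi>) \<partial>lborel)"
    proof (rule P.Fubini'[symmetric])
      have "(\<lambda>(\<gamma>, t). ev (clamp01 t) \<gamma>) \<in> borel_measurable (\<pi> \<Otimes>\<^sub>M lborel)"
        using measurable_compose[OF measurable_pair_swap' ev_clamp01_borel_pair]
        by (simp add: split_def s cong: measurable_cong_sets sets_pair_measure_cong)
      then show "(\<lambda>(\<gamma>, t). ennreal (2 * R) * (F (ev (clamp01 t) \<gamma>) * indicator {0..1} t)) \<in> borel_measurable (\<pi> \<Otimes>\<^sub>M lborel)"
        unfolding split_def by measurable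
    qed
    also have "\<dots> \<le> (\<integral>\<^sup>+t. ennreal (2 * R) * (ennreal C * (\<integral>\<^sup>+x. F x \<partial>m)) * indicator {0..1::real} t \<partial>lborel)"
    proof (rule nn_integral_mono_AE)
      \<comment> \<open>The density bound holds at interior times only; the two endpoints form a
        null set.\<close>
      have "AE t in lborel. t \<noteq> (0::real)" "AE t in lborel. t \<noteq> (1::real)" by (rule AE_lborel_singleton)+
      then show "AE t in lborel. (\<integral>\<^sup>+\<gamma>. ennreal (2 * R) * (F (ev (clamp01 t) \<gamma>) * indicator {0..1} t) \<partial>\<pi>)
        \<le> ennreal (2 * R) * (ennreal C * (\<integral>\<^sup>+x. F x \<partial>m)) * indicator {0..1} t"
      proof eventually_elim
        case (elim t)
        show ?case
        proof (cases "t \<in> {0..1}")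
          case True
          then have t: "t \<in> {0<..<1}" "t \<in> {0..<1}" using elim by auto
          let ?\<mu> = "distr \<pi> borel (ev t)"
          have "(\<integral>\<^sup>+\<gamma>. F (ev t \<gamma>) \<partial>\<pi>) = (\<integral>\<^sup>+x. F x \<partial>?\<mu>)" by (simp add: nn_integral_distr)
          also have "\<dots> \<le> ennreal C * (\<integral>\<^sup>+x. F x \<partial>m)"
          proof (rule nn_integral_le_bounded_density[OF _ _ ac[OF t(2)] _ _ F_m])
            show "AE x in ?\<mu>. dens m ?\<mu> x \<le> C" using C0[OF t(1)] by eventually_elim (simp add: C_def)
          qed (auto simp: mms_sets[OF mm] intro: \<pi>.prob_space_distr m.sigma_finite_measure_axioms)
          finally show ?thesis
            using True by (simp add: clamp01_id nn_integral_cmult mult_left_mono)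
        qed simp
      qed
    qed
    also have "\<dots> = ennreal (2 * R) * (ennreal C * (\<integral>\<^sup>+x. F x \<partial>m))"
      by (subst nn_integral_cmult_indicator) auto
    also have "\<dots> = ennreal (2 * R * C) * (\<integral>\<^sup>+x. F x \<partial>m)"
      using R(1) by (simp add: ennreal_mult C_def mult.assoc)
    finally show ?thesis by (simp add: F_def)
  qed
  moreover have "2 * R * C \<ge> 0" using R(1) by (simp add: C_def)
  moreover have "K0 \<subseteq> S" "K1 \<subseteq> S" using R by (fastforce simp: S_def)+
  moreover have "bounded S" "closed S" by (simp_all add: S_def)
  ultimately show ?thesis unfolding \<mu>0_def \<mu>1_def by blast
qed

section \<open>Irreducibility\<close>

text \<open>An elementary inequality replaces Cauchy-Schwarz and keeps the bound linear in \<eta>.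
  The fixed error 1/8 is affordable, since the averages to be separated should be 1/2 apart.\<close>

lemma average_close:
  assumes mm: "metric_measure_space m" and K: "compact K" "0 < emeasure m K" and H: "H \<in> Lip_bs"
    and est: "(\<integral>\<^sup>+x. ennreal ((H x - c)\<^sup>2) * indicator K x \<partial>m) \<le> ennreal \<eta>" and \<eta>: "\<eta> \<ge> 0"
  shows "\<bar>(\<integral>x. H x \<partial>uniform_measure m K) - c\<bar> \<le> 1/8 + 2 * \<eta> / measure m K"
proof -
  let ?\<mu> = "uniform_measure m K"
  note u = uniform_measure_compact[OF mm K]
  interpret prob_space ?\<mu> using u(1) by (auto simp: Pcm_def borel_prob_def)
  have Ks [measurable]: "K \<in> sets m" using K(1) mms_sets[OF mm] by (simp add: compact_imp_closed borel_closed)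
  have fin: "emeasure m K = ennreal (measure m K)"
    using mms_bounded_finite[OF mm _ compact_imp_bounded[OF K(1)]] Ks mms_sets[OF mm]
    by (intro emeasure_eq_ennreal_measure) auto
  have Hm [measurable]: "H \<in> borel_measurable m" by (rule mms_borel_measurable[OF mm Lip_bs_borel[OF H]])
  obtain B where B: "\<forall>x. \<bar>H x\<bar> \<le> B" using H by (rule Lip_bsE)
  have int: "integrable ?\<mu> H"
    by (rule integrable_const_bound[of _ B]) (use B in auto)
  have int2: "integrable ?\<mu> (\<lambda>x. (H x - c)\<^sup>2)"
  proof (rule integrable_const_bound[of _ "(B + \<bar>c\<bar>)\<^sup>2"])
    have "\<bar>H x - c\<bar> \<le> \<bar>B + \<bar>c\<bar>\<bar>" for x using B[rule_format, of x] by linarith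
    then have "(H x - c)\<^sup>2 \<le> (B + \<bar>c\<bar>)\<^sup>2" for x by (simp add: abs_le_square_iff)
    then show "AE x in ?\<mu>. norm ((H x - c)\<^sup>2) \<le> (B + \<bar>c\<bar>)\<^sup>2" by simp
  qed auto
  have "ennreal (\<integral>x. (H x - c)\<^sup>2 \<partial>?\<mu>) = (\<integral>\<^sup>+x. ennreal ((H x - c)\<^sup>2) \<partial>?\<mu>)"
    by (rule nn_integral_eq_integral[symmetric, OF int2]) simp
  also have "\<dots> = (\<integral>\<^sup>+x. ennreal ((H x - c)\<^sup>2) * indicator K x \<partial>m) / emeasure m K"
    by (rule nn_integral_uniform_measure) auto
  also have "\<dots> \<le> ennreal \<eta> / ennreal (measure m K)"
    unfolding fin by (rule divide_right_mono_ennreal[OF est])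
  also have "\<dots> = ennreal (\<eta> / measure m K)" using u(6) \<eta> by (intro divide_ennreal)
  finally have sq: "(\<integral>x. (H x - c)\<^sup>2 \<partial>?\<mu>) \<le> \<eta> / measure m K"
    using \<eta> by (simp add: measure_nonneg)
  have pt: "\<bar>y\<bar> \<le> 1/8 + 2 * y\<^sup>2" for y :: real
  proof -
    have "(\<bar>y\<bar> - 1/4)\<^sup>2 = y\<^sup>2 - \<bar>y\<bar> / 2 + 1/16" by (simp add: power2_eq_square algebra_simps)
    then show ?thesis using zero_le_power2[of "\<bar>y\<bar> - 1/4"] by linarith
  qed
  have total: "measure ?\<mu> (space m) = 1" using prob_space by simp
  have "\<bar>(\<integral>x. H x \<partial>?\<mu>) - c\<bar> = \<bar>\<integral>x. H x - c \<partial>?\<mu>\<bar>" using int by (simp add: total)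
  also have "\<dots> \<le> (\<integral>x. \<bar>H x - c\<bar> \<partial>?\<mu>)" by (rule integral_abs_bound)
  also have "\<dots> \<le> (\<integral>x. 1/8 + 2 * (H x - c)\<^sup>2 \<partial>?\<mu>)"
    using int int2 by (intro integral_mono pt) auto
  also have "\<dots> = 1/8 + 2 * (\<integral>x. (H x - c)\<^sup>2 \<partial>?\<mu>)" using int2 by (simp add: total)
  finally show ?thesis using sq by simp
qed

lemma cutoff_exists:
  fixes S :: "'a :: metric_space set"
  assumes "bounded S"
  shows "\<exists>\<phi>\<in>Lip_bs. \<forall>x\<in>S. \<phi> x = (1::real)"
proof -
  obtain x0 r where r: "S \<subseteq> cball x0 r" using assms unfolding bounded_subset_cball by blast
  define \<phi> where "\<phi> x = max 0 (min 1 (r + 1 - dist x0 x))" for x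
  have "1-lipschitz_on UNIV \<phi>"
  proof (rule lipschitz_onI)
    fix x y
    have "\<bar>\<phi> x - \<phi> y\<bar> \<le> \<bar>dist x0 x - dist x0 y\<bar>" by (auto simp: \<phi>_def max_def min_def abs_if)
    also have "\<dots> \<le> dist x y"
      using dist_triangle[of x0 x y] dist_triangle[of x0 y x] by (simp add: dist_commute abs_le_iff)
    finally show "dist (\<phi> x) (\<phi> y) \<le> 1 * dist x y" by (simp add: dist_real_def)
  qed simp
  moreover have "{x. \<phi> x \<noteq> 0} \<subseteq> cball x0 (r + 1)" by (auto simp: \<phi>_def)
  then have "closure {x. \<phi> x \<noteq> 0} \<subseteq> cball x0 (r + 1)" by (rule closure_minimal) simp
  then have "bounded (closure {x. \<phi> x \<noteq> 0})" using bounded_cball bounded_subset by blast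
  ultimately have "\<phi> \<in> Lip_bs" unfolding Lip_bs_def by blast
  moreover have "\<forall>x\<in>S. \<phi> x = 1" using r by (auto simp: \<phi>_def)
  ultimately show ?thesis by blast
qed

theorem corollary4p6:
  fixes m :: "('a :: polish_space) measure"
    and P :: "real \<Rightarrow> ('a \<Rightarrow> real) \<Rightarrow> 'a \<Rightarrow> real"
    and Q K N :: real
    and A :: "'a set"
  assumes "metric_measure_space m"
    and "geodesic_space TYPE('a)"
    and "Monge_space m"
    and "infinitesimally_Hilbertian m"
    and "Q \<ge> 1" and "N > 1"
    and "QCD m Q K N"
    and "heat_semigroup m P"
    and "A \<in> sets (completion m)"
    and "invariant_set m P A"
  shows "emeasure (completion m) A = 0 \<or> emeasure (completion m) (- A) = 0"
proof (rule ccontr)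
  note mm = assms(1)
  assume "\<not> ?thesis"
  then have pos: "emeasure (completion m) A \<noteq> 0" "emeasure (completion m) (- A) \<noteq> 0" by auto
  have "- A = space (completion m) - A" by (simp add: mms_space[OF mm] Compl_eq_Diff_UNIV)
  then have A': "- A \<in> sets (completion m)" using assms(9) by (metis sets.compl_sets)
  obtain K1 where K1: "compact K1" "K1 \<subseteq> A" "0 < emeasure m K1"
    using positive_measure_compact_subset[OF mm assms(9) pos(1)] by blast
  obtain K0 where K0: "compact K0" "K0 \<subseteq> - A" "0 < emeasure m K0"
    using positive_measure_compact_subset[OF mm A' pos(2)] by blast
  obtain C S where C: "C \<ge> 0" and S: "bounded S" "closed S" "K0 \<subseteq> S" "K1 \<subseteq> S"
    and transport: "\<And>H. H \<in> Lip_bs \<Longrightarrow>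
      ennreal ((\<integral>x. H x \<partial>uniform_measure m K1) - (\<integral>x. H x \<partial>uniform_measure m K0))
        \<le> ennreal C * (\<integral>\<^sup>+x. ennreal (real_slope H x) * indicator S x \<partial>m)"
    using transport_inequality[OF mm assms(3,7,5,6) K0(1,3) K1(1,3)] by metis
  obtain \<phi> where \<phi>: "\<phi> \<in> Lip_bs" "\<And>x. x \<in> S \<Longrightarrow> \<phi> x = 1" using cutoff_exists[OF S(1)] by blast
  define u where "u x = indicator A x * \<phi> x" for x
  have \<phi>W: "\<phi> \<in> W12 m" by (rule Lip_bs_W12[OF mm \<phi>(1)])
  have u: "u \<in> W12 m"
    using Ch_indicator_le[OF mm assms(4,8,9,10) \<phi>W] W12_Ch[OF \<phi>W] L2_indicator[OF assms(9) W12_L2[OF \<phi>W]]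
    unfolding u_def by (intro W12_I) auto
  \<comment> \<open>The cutoff makes \<open>u\<close> two-valued on \<open>S\<close> only, which
    suffices because the transport inequality integrates the slope over \<open>S\<close>.\<close>
  have flat: "u x = 0 \<or> u x = 1" if "x \<in> S" for x using \<phi>(2)[OF that] by (simp add: u_def indicator_def)
  define a0 a1 where "a0 = measure m K0" and "a1 = measure m K1"
  have a: "a0 > 0" "a1 > 0"
    using uniform_measure_compact(6)[OF mm K0(1,3)] uniform_measure_compact(6)[OF mm K1(1,3)]
    by (simp_all add: a0_def a1_def)
  have Ss [measurable]: "S \<in> sets m" using S(2) mms_sets[OF mm] by (simp add: borel_closed)
  have mS: "emeasure m S = ennreal (measure m S)"
    using mms_bounded_finite[OF mm _ S(1)] Ss mms_sets[OF mm] by (intro emeasure_eq_ennreal_measure) auto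
  \<comment> \<open>The slope enters the transport inequality linearly but is controlled in square,
    so \<open>y \<le> \<theta> + y\<^sup>2 / \<theta>\<close> is used below. This \<theta> makes the
    constant part contribute at most 1/32.\<close>
  define \<theta> where "\<theta> = 1 / (32 * (C * measure m S + 1))"
  have CS: "C * measure m S \<ge> 0" using C by simp
  have \<theta>: "\<theta> > 0" using CS by (simp add: \<theta>_def)
  have \<theta>S: "C * (\<theta> * measure m S) \<le> 1 / 32"
  proof -
    have "C * (\<theta> * measure m S) = (C * measure m S) / (C * measure m S + 1) / 32" by (simp add: \<theta>_def)
    also have "\<dots> \<le> 1 / 32" using CS by (intro divide_right_mono) (auto simp: divide_le_eq)
    finally show ?thesis .
  qed
  \<comment> \<open>The first bound adds at most 1/16 to the error of each average, the second makes
    the quadratic part of the slope contribute at most 1/32.\<close>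
  define \<eta> where "\<eta> = min (min a0 a1 / 32) (\<theta> / (32 * (C + 1)))"
  have \<eta>: "\<eta> > 0" using a \<theta> C by (simp add: \<eta>_def)
  have \<eta>a: "2 * \<eta> / a0 \<le> 1/16" "2 * \<eta> / a1 \<le> 1/16"
  proof -
    have "\<eta> \<le> min a0 a1 / 32" unfolding \<eta>_def by (rule min.cobounded1)
    then have "\<eta> \<le> a0 / 32" "\<eta> \<le> a1 / 32" using min.cobounded1[of a0 a1] min.cobounded2[of a0 a1] by linarith+
    then show "2 * \<eta> / a0 \<le> 1/16" "2 * \<eta> / a1 \<le> 1/16" using a by (simp_all add: divide_le_eq)
  qed
  have \<eta>C: "C * (\<eta> / \<theta>) \<le> 1 / 32"
  proof -
    have "\<eta> / \<theta> \<le> \<theta> / (32 * (C + 1)) / \<theta>" using \<theta> by (intro divide_right_mono) (auto simp: \<eta>_def)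
    then have "C * (\<eta> / \<theta>) \<le> C * (1 / (32 * (C + 1)))" using C \<theta> by (intro mult_left_mono) auto
    also have "\<dots> \<le> 1 / 32" using C by (simp add: divide_le_eq)
    finally show ?thesis .
  qed
  obtain H where H: "H \<in> Lip_bs"
    and H_slope: "(\<integral>\<^sup>+x. ennreal ((real_slope H x)\<^sup>2) * indicator S x \<partial>m) \<le> ennreal \<eta>"
    and H_u: "(\<integral>\<^sup>+x. ennreal ((H x - u x / 2)\<^sup>2) * indicator S x \<partial>m) \<le> ennreal \<eta>"
    using flat_approximation[OF mm u flat \<eta>] by blast
  have avg: "\<bar>(\<integral>x. H x \<partial>uniform_measure m K') - c\<bar> \<le> 1/8 + 2 * \<eta> / measure m K'"
    if K': "compact K'" "0 < emeasure m K'" "K' \<subseteq> S" and c: "\<And>x. x \<in> K' \<Longrightarrow> u x / 2 = c" for K' c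
  proof (rule average_close[OF mm K'(1,2) H])
    have "(\<integral>\<^sup>+x. ennreal ((H x - c)\<^sup>2) * indicator K' x \<partial>m) \<le> (\<integral>\<^sup>+x. ennreal ((H x - u x / 2)\<^sup>2) * indicator S x \<partial>m)"
      using K'(3) c by (intro nn_integral_mono) (auto split: split_indicator)
    then show "(\<integral>\<^sup>+x. ennreal ((H x - c)\<^sup>2) * indicator K' x \<partial>m) \<le> ennreal \<eta>" using H_u by (rule order_trans)
  qed (use \<eta> in simp)
  have "\<bar>(\<integral>x. H x \<partial>uniform_measure m K1) - 1/2\<bar> \<le> 1/8 + 2 * \<eta> / a1"
    unfolding a1_def by (rule avg[OF K1(1,3) S(4)]) (use K1(2) S(4) \<phi>(2) in \<open>auto simp: u_def indicator_def\<close>)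
  moreover have "\<bar>(\<integral>x. H x \<partial>uniform_measure m K0) - 0\<bar> \<le> 1/8 + 2 * \<eta> / a0"
    unfolding a0_def by (rule avg[OF K0(1,3) S(3)]) (use K0(2) in \<open>auto simp: u_def indicator_def\<close>)
  \<comment> \<open>The averages are within 3/16 of 1/2 and of 0, which leaves a gap of 1/8, against
    a slope contribution of at most 1/32 + 1/32.\<close>
  ultimately have "1/8 \<le> (\<integral>x. H x \<partial>uniform_measure m K1) - (\<integral>x. H x \<partial>uniform_measure m K0)"
    using \<eta>a by linarith
  then have "ennreal (1/8) \<le> ennreal ((\<integral>x. H x \<partial>uniform_measure m K1) - (\<integral>x. H x \<partial>uniform_measure m K0))"
    by (rule ennreal_leI)
  also have "\<dots> \<le> ennreal C * (\<integral>\<^sup>+x. ennreal (real_slope H x) * indicator S x \<partial>m)" by (rule transport[OF H])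
  also have "(\<integral>\<^sup>+x. ennreal (real_slope H x) * indicator S x \<partial>m) \<le> ennreal (\<theta> * measure m S + \<eta> / \<theta>)"
  proof -
    have [measurable]: "real_slope H \<in> borel_measurable m"
      by (rule mms_borel_measurable[OF mm real_slope_borel[OF Lip_bs_continuous[OF H]]])
    have "(\<integral>\<^sup>+x. ennreal (real_slope H x) * indicator S x \<partial>m)
      \<le> (\<integral>\<^sup>+x. ennreal \<theta> * indicator S x + ennreal (1 / \<theta>) * (ennreal ((real_slope H x)\<^sup>2) * indicator S x) \<partial>m)"
    proof (rule nn_integral_mono)
      fix x
      let ?y = "real_slope H x"
      have "\<theta> * ?y \<le> \<theta>\<^sup>2 + ?y\<^sup>2"
        using sum_squares_bound[of \<theta> ?y] mult_nonneg_nonneg[OF less_imp_le[OF \<theta>] real_slope_nonneg[of H x]]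
        by linarith
      then have "?y \<le> \<theta> + 1 / \<theta> * ?y\<^sup>2" using \<theta> by (simp add: field_simps power2_eq_square)
      then have "ennreal ?y \<le> ennreal (\<theta> + 1 / \<theta> * ?y\<^sup>2)" by (rule ennreal_leI)
      also have "\<dots> = ennreal \<theta> + ennreal (1 / \<theta>) * ennreal (?y\<^sup>2)"
        using \<theta> by (simp add: ennreal_mult[symmetric])
      finally show "ennreal ?y * indicator S x
        \<le> ennreal \<theta> * indicator S x + ennreal (1 / \<theta>) * (ennreal (?y\<^sup>2) * indicator S x)"
        by (simp split: split_indicator)
    qed
    also have "\<dots> = ennreal \<theta> * emeasure m S + ennreal (1 / \<theta>) * (\<integral>\<^sup>+x. ennreal ((real_slope H x)\<^sup>2) * indicator S x \<partial>m)"
      by (subst nn_integral_add) (auto simp: nn_integral_cmult nn_integral_cmult_indicator)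
    also have "\<dots> \<le> ennreal \<theta> * ennreal (measure m S) + ennreal (1 / \<theta>) * ennreal \<eta>"
      unfolding mS by (intro add_mono mult_left_mono H_slope) auto
    also have "\<dots> = ennreal (\<theta> * measure m S + \<eta> / \<theta>)"
      using \<theta> \<eta> by (simp add: ennreal_mult[symmetric])
    finally show ?thesis .
  qed
  finally have "ennreal (1/8) \<le> ennreal C * ennreal (\<theta> * measure m S + \<eta> / \<theta>)"
    by (simp add: mult_left_mono)
  also have "\<dots> = ennreal (C * (\<theta> * measure m S + \<eta> / \<theta>))" by (rule ennreal_mult'[symmetric, OF C])
  also have "\<dots> \<le> ennreal (1/16)"
    unfolding distrib_left using \<theta>S \<eta>C by (intro ennreal_leI) linarith
  finally show False by simp
qed

end
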